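(* Let $0<a<b\le\pi/2$, let $\omega_{a,b}=(-b,-a)\cup(a,b)$ and $\omega=\omega_{a,b}\times(0,2\pi)$. Let $g_0\in L^2(\Omega,\sigma)$ and consider the system $$\begin{cases}\partial_t g-(\Phi^*\mathcal L)g=0 & \text{in }(0,T)\times\Omega,\\ g|_{t=0}=g_0 & \text{in }\Omega.\end{cases}$$ Then the minimal time required for observability in $\omega$ satisfies $T_{\min}\ge\log(1/\cos a)$. Moreover, there exists $T^*>0$ such that, for every $T\ge T^*$, the system is observable in $\omega$ in time $T$.
   Context: $\Omega=(-\pi/2,\pi/2)\times[0,2\pi)$ with coordinates $(x,y)$ and measure $d\sigma=\cos x\,dx\,dy$. On $\mathbb S^2\subset\mathbb R^3$ with its standard Riemannian measure $\mu$, let $X=-x_3\partial_{x_2}+x_2\partial_{x_3}$, $Y=-x_3\partial_{x_1}+x_1\partial_{x_3}$ and $\mathcal L=-X^+X-Y^+Y$ (formal adjoints in $L^2(\mathbb S^2,\mu)$). $\mathcal L$ is essentially self-adjoint on $C^\infty(\mathbb S^2)$; $\mathcal L$ denotes its self-adjoint realization, with domain $D(\mathcal L)=\{u\in L^2(\mathbb S^2,\mu):\mathcal Lu\in L^2(\mathbb S^2,\mu)\}$. Let $\Phi:\Omega\to\mathbb S^2\setminus\{N,S\}$, $\Phi(x,y)=(\cos x\cos y,\cos x\sin y,\sin x)$, where $N,S$ are the north and south poles, and let $T_\Phi:L^2(\Omega,\sigma)\to L^2(\mathbb S^2\setminus\{N,S\},\mu)$ be the unitary map $T_\Phi v=v\circ\Phi^{-1}$.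 The spherical Grushin operator is $\Phi^*\mathcal L=T_\Phi^{-1}\mathcal L T_\Phi$ with domain $D(\Phi^*\mathcal L)=T_\Phi^{-1}(D(\mathcal L))$; it is self-adjoint on $L^2(\Omega,\sigma)$ and is given by $$\Phi^*\mathcal L=\frac1{\cos x}\partial_x(\cos x\,\partial_x)+\tan^2x\,\partial_y^2 .$$ The solution of the system is $g(t)=e^{t\Phi^*\mathcal L}g_0$. The system is observable in $\omega$ in time $T>0$ if there exists $C(T,\omega)>0$ such that for every $g_0\in L^2(\Omega,\sigma)$ the solution $g$ satisfies $$\int_\Omega|g(T,x,y)|^2\,d\sigma\le C(T,\omega)\int_0^T\int_\omega|g(t,x,y)|^2\,d\sigma\,dt .$$ $T_{\min}=\inf\{T>0:\text{the system is observable in }\omega\text{ in time }T\}$. *)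

theory Defs
  imports "HOL-Analysis.Analysis"
begin

text \<open>
  Elements of \<open>L\<^sup>2(M)\<close> are handled through representatives, and identified when they agree
  almost everywhere. An unbounded operator is represented by its graph, that is, by the set of
  all pairs of representatives \<open>(u, A u)\<close> with \<open>u\<close> in the domain.
\<close>

definition L2 :: "'a measure \<Rightarrow> ('a \<Rightarrow> complex) set" where
  "L2 M = {f \<in> borel_measurable M. integrable M (\<lambda>x. (cmod (f x))\<^sup>2)}"

definition L2norm :: "'a measure \<Rightarrow> ('a \<Rightarrow> complex) \<Rightarrow> real" where
  "L2norm M f = sqrt (LINT x|M. (cmod (f x))\<^sup>2)"

type_synonym 'a operator_graph = "(('a \<Rightarrow> complex) \<times> ('a \<Rightarrow> complex)) set"

text \<open>
  Linearity and boundedness together ensure that each \<open>S t\<close> respects almost everywhere equality.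
\<close>

definition C0_semigroup ::
    "'a measure \<Rightarrow> (real \<Rightarrow> ('a \<Rightarrow> complex) \<Rightarrow> ('a \<Rightarrow> complex)) \<Rightarrow> bool" where
  "C0_semigroup M S \<longleftrightarrow>
     (\<forall>t\<ge>0. \<forall>f\<in>L2 M. S t f \<in> L2 M) \<and>
     (\<forall>t\<ge>0. \<forall>f\<in>L2 M. \<forall>g\<in>L2 M. \<forall>c. AE x in M. S t (\<lambda>x. c * f x + g x) x = c * S t f x + S t g x) \<and>
     (\<forall>t\<ge>0. \<exists>K. \<forall>f\<in>L2 M. L2norm M (S t f) \<le> K * L2norm M f) \<and>
     (\<forall>f\<in>L2 M. AE x in M. S 0 f x = f x) \<and>
     (\<forall>s\<ge>0. \<forall>t\<ge>0. \<forall>f\<in>L2 M. AE x in M. S (s + t) f x = S s (S t f) x) \<and>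
     (\<forall>f\<in>L2 M. ((\<lambda>t. L2norm M (\<lambda>x. S t f x - f x)) \<longlongrightarrow> 0) (at_right 0))"

definition generator ::
    "'a measure \<Rightarrow> (real \<Rightarrow> ('a \<Rightarrow> complex) \<Rightarrow> ('a \<Rightarrow> complex)) \<Rightarrow> 'a operator_graph" where
  "generator M S = {(f, h). f \<in> L2 M \<and> h \<in> L2 M \<and>
     ((\<lambda>t. L2norm M (\<lambda>x. (S t f x - f x) / complex_of_real t - h x)) \<longlongrightarrow> 0) (at_right 0)}"

text \<open>
  \<open>e\<^sup>t\<^sup>A\<close>, the strongly continuous semigroup with infinitesimal generator \<open>A\<close>. A generator
  determines its semigroup, so the choice only concerns representatives modulo null sets.
\<close>

definition exp_semigroup ::
    "'a measure \<Rightarrow> 'a operator_graph \<Rightarrow> real \<Rightarrow> ('a \<Rightarrow> complex) \<Rightarrow> ('a \<Rightarrow> complex)" where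
  "exp_semigroup M A = (SOME S. C0_semigroup M S \<and> generator M S = A)"

definition Omega :: "(real \<times> real) set" where
  "Omega = {-(pi/2)<..<pi/2} \<times> {0..<2*pi}"

definition sigma_measure :: "(real \<times> real) measure" where
  "sigma_measure = density (restrict_space lborel Omega) (\<lambda>(x, y). ennreal (cos x))"

definition Phi :: "real \<times> real \<Rightarrow> real^3" where
  "Phi = (\<lambda>(x, y). vector [cos x * cos y, cos x * sin y, sin x])"

definition gram_density :: "(real \<times> real \<Rightarrow> real^3) \<Rightarrow> real \<times> real \<Rightarrow> real" where
  "gram_density F p =
     (let u = frechet_derivative F (at p) (1, 0); v = frechet_derivative F (at p) (0, 1)
      in sqrt ((u \<bullet> u) * (v \<bullet> v) - (u \<bullet> v)\<^sup>2))"

text \<open>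
  The Riemannian measure of the unit sphere, with volume density \<open>sqrt (det g)\<close> in the
  coordinates \<open>Phi\<close>, where \<open>g\<close> is the metric induced from the ambient Euclidean space. These
  coordinates cover all of the sphere except for the two poles, which are null sets.
\<close>

definition sphere_measure :: "(real^3) measure" where
  "sphere_measure =
     distr (density (restrict_space lborel Omega) (\<lambda>p. ennreal (gram_density Phi p)))
           (restrict_space borel (sphere 0 1)) Phi"

primrec Ck_on :: "nat \<Rightarrow> 'a::real_normed_vector set \<Rightarrow> ('a \<Rightarrow> 'b::real_normed_vector) \<Rightarrow> bool" where
  "Ck_on 0 U f \<longleftrightarrow> continuous_on U f"
| "Ck_on (Suc k) U f \<longleftrightarrow>
     f differentiable_on U \<and> (\<forall>v. Ck_on k U (\<lambda>x. frechet_derivative f (at x) v))"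

text \<open>
  Smooth functions on the sphere are represented by smooth functions on an open neighbourhood of
  it. Only the values on the sphere are relevant: the vector fields below are tangent to the
  sphere, so that the restriction of \<open>X_field u\<close> depends only on the restriction of \<open>u\<close>.
\<close>

definition sphere_smooth :: "(real^3 \<Rightarrow> complex) set" where
  "sphere_smooth = {u. \<exists>U. open U \<and> sphere 0 1 \<subseteq> U \<and> (\<forall>k. Ck_on k U u)}"

definition partial :: "3 \<Rightarrow> (real^3 \<Rightarrow> complex) \<Rightarrow> (real^3 \<Rightarrow> complex)" where
  "partial i u = (\<lambda>p. frechet_derivative u (at p) (axis i 1))"

definition X_field :: "(real^3 \<Rightarrow> complex) \<Rightarrow> (real^3 \<Rightarrow> complex)" where
  "X_field u = (\<lambda>p. - (p $ 3) *\<^sub>R partial 2 u p + (p $ 2) *\<^sub>R partial 3 u p)"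

definition Y_field :: "(real^3 \<Rightarrow> complex) \<Rightarrow> (real^3 \<Rightarrow> complex)" where
  "Y_field u = (\<lambda>p. - (p $ 3) *\<^sub>R partial 1 u p + (p $ 1) *\<^sub>R partial 3 u p)"

text \<open>The values on the sphere of the function chosen here are uniquely determined.\<close>

definition formal_adjoint ::
    "((real^3 \<Rightarrow> complex) \<Rightarrow> (real^3 \<Rightarrow> complex)) \<Rightarrow> (real^3 \<Rightarrow> complex) \<Rightarrow> (real^3 \<Rightarrow> complex)" where
  "formal_adjoint P v = (SOME w. w \<in> sphere_smooth \<and>
     (\<forall>u\<in>sphere_smooth.
        (LINT p|sphere_measure. P u p * cnj (v p)) = (LINT p|sphere_measure. u p * cnj (w p))))"

definition L_smooth :: "(real^3 \<Rightarrow> complex) \<Rightarrow> (real^3 \<Rightarrow> complex)" where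
  "L_smooth u = (\<lambda>p. - formal_adjoint X_field (X_field u) p - formal_adjoint Y_field (Y_field u) p)"

text \<open>
  The self-adjoint realization: \<open>L u\<close> is understood in the sense of distributions, and \<open>u\<close> is in
  the domain if both \<open>u\<close> and \<open>L u\<close> are square-integrable. The differential operator is formally
  self-adjoint, so it is \<open>L_smooth\<close> itself that acts on the test functions.
\<close>

definition L_graph :: "(real^3) operator_graph" where
  "L_graph = {(u, f). u \<in> L2 sphere_measure \<and> f \<in> L2 sphere_measure \<and>
     (\<forall>\<phi>\<in>sphere_smooth.
        (LINT p|sphere_measure. u p * cnj (L_smooth \<phi> p)) = (LINT p|sphere_measure. f p * cnj (\<phi> p)))}"

text \<open>Functions on the sphere without the poles are extended by zero, the poles being null sets.\<close>

definition T_Phi :: "(real \<times> real \<Rightarrow> complex) \<Rightarrow> (real^3 \<Rightarrow> complex)" where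
  "T_Phi v = (\<lambda>p. if p \<in> Phi ` Omega then v (inv_into Omega Phi p) else 0)"

definition grushin_graph :: "(real \<times> real) operator_graph" where
  "grushin_graph = {(v, w). v \<in> L2 sigma_measure \<and> w \<in> L2 sigma_measure \<and>
     (T_Phi v, T_Phi w) \<in> L_graph}"

definition solution :: "(real \<times> real \<Rightarrow> complex) \<Rightarrow> real \<Rightarrow> (real \<times> real \<Rightarrow> complex)" where
  "solution g0 t = exp_semigroup sigma_measure grushin_graph t g0"

definition observable :: "(real \<times> real) set \<Rightarrow> real \<Rightarrow> bool" where
  "observable \<omega> T \<longleftrightarrow> T > 0 \<and> (\<exists>C>0. \<forall>g0\<in>L2 sigma_measure.
     (LINT p|sigma_measure. (cmod (solution g0 T p))\<^sup>2)
       \<le> C * (LINT t:{0..T}|lborel. (LINT p:\<omega>|sigma_measure. (cmod (solution g0 t p))\<^sup>2)))"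

definition T_min :: "(real \<times> real) set \<Rightarrow> ereal" where
  "T_min \<omega> = Inf (ereal ` {T. T > 0 \<and> observable \<omega> T})"

definition omega :: "real \<Rightarrow> real \<Rightarrow> (real \<times> real) set" where
  "omega a b = ({-b<..<-a} \<union> {a<..<b}) \<times> {0<..<2*pi}"

lemma Phi_bij_betw: "bij_betw Phi Omega (sphere 0 1 - {axis 3 1, - axis 3 1})"
proof (rule bij_betw_imageI)
  show "inj_on Phi Omega"
  proof (rule inj_onI, clarify)
    fix x y x' y' assume P: "(x, y) \<in> Omega" "(x', y') \<in> Omega" "Phi (x, y) = Phi (x', y')"
    have e: "cos x * cos y = cos x' * cos y'" "cos x * sin y = cos x' * sin y'" "sin x = sin x'"
      using P(3) by (auto simp: Phi_def vec_eq_iff forall_3 vector_3)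
    have x: "x = x'"
      using P e(3) by (auto simp: Omega_def intro: sin_inj_pi)
    have "cos x > 0" using P by (auto simp: Omega_def cos_gt_zero_pi)
    with e x have "cos y = cos y'" "sin y = sin y'" by auto
    then obtain n :: int where n: "y = y' + 2 * pi * n"
      using sin_cos_eq_iff by metis
    have "\<bar>2 * pi * n\<bar> < 2 * pi * 1" using P n by (auto simp: Omega_def)
    then have "\<bar>real_of_int n\<bar> < 1" by (simp add: abs_mult)
    then have "n = 0" by linarith
    with n x show "x = x' \<and> y = y'" by simp
  qed
  show "Phi ` Omega = sphere 0 1 - {axis 3 1, - axis 3 1}"
  proof (intro subset_antisym subsetI)
    fix p assume "p \<in> Phi ` Omega"
    then obtain x y where xy: "(x, y) \<in> Omega" and p: "p = Phi (x, y)" by auto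
    have "cos x > 0" using xy by (auto simp: Omega_def cos_gt_zero_pi)
    then have "sin x \<noteq> 1" "sin x \<noteq> -1"
      using sin_cos_squared_add[of x] by (force simp: power2_eq_square)+
    then have "p \<noteq> axis 3 1" "p \<noteq> - axis 3 1"
      by (auto simp: p Phi_def vec_eq_iff forall_3 vector_3 axis_def)
    moreover have "norm p = 1"
    proof -
      have "(norm p)\<^sup>2 = (cos x * cos y)\<^sup>2 + (cos x * sin y)\<^sup>2 + (sin x)\<^sup>2"
        unfolding power2_norm_eq_inner
        by (simp add: p Phi_def inner_vec_def sum_3 vector_3 power2_eq_square)
      also have "\<dots> = (cos x)\<^sup>2 * ((cos y)\<^sup>2 + (sin y)\<^sup>2) + (sin x)\<^sup>2"
        by (simp only: power_mult_distrib distrib_left)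
      finally show ?thesis by (simp add: power2_eq_1_iff) (use norm_ge_zero[of p] in linarith)
    qed
    ultimately show "p \<in> sphere 0 1 - {axis 3 1, - axis 3 1}" by simp
  next
    fix p :: "real^3" assume p: "p \<in> sphere 0 1 - {axis 3 1, - axis 3 1}"
    then have "(norm p)\<^sup>2 = 1" by simp
    then have n: "(p$1)\<^sup>2 + (p$2)\<^sup>2 + (p$3)\<^sup>2 = 1"
      unfolding power2_norm_eq_inner by (simp add: inner_vec_def sum_3 power2_eq_square)
    have "(p$3)\<^sup>2 \<noteq> 1"
    proof
      assume 1: "(p$3)\<^sup>2 = 1"
      with n have "p$1 = 0" "p$2 = 0" by (auto simp: sum_power2_eq_zero_iff)
      moreover from 1 have "p$3 = 1 \<or> p$3 = -1" by (simp add: power2_eq_1_iff)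
      ultimately have "p = axis 3 1 \<or> p = - axis 3 1"
        by (auto simp: vec_eq_iff forall_3 axis_def)
      with p show False by auto
    qed
    moreover have "(p$3)\<^sup>2 \<le> 1"
      using n zero_le_power2[of "p$1"] zero_le_power2[of "p$2"] by linarith
    ultimately have "(p$3)\<^sup>2 < 1" by simp
    then have b: "-1 < p$3" "p$3 < 1" by (auto simp: abs_square_less_1)
    define x where "x = arcsin (p$3)"
    have x: "-(pi/2) < x" "x < pi/2" "sin x = p$3"
      using b arcsin_lt_bounded[of "p$3"] by (auto simp: x_def)
    then have c: "cos x > 0" by (auto intro: cos_gt_zero_pi)
    have "(p$1)\<^sup>2 + (p$2)\<^sup>2 = (cos x)\<^sup>2"
      using n x(3) by (simp add: cos_squared_eq)
    then have "(p$1 / cos x)\<^sup>2 + (p$2 / cos x)\<^sup>2 = 1"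
      using c by (simp add: power_divide flip: add_divide_distrib)
    then obtain y where y: "0 \<le> y" "y < 2*pi" "p$1 / cos x = cos y" "p$2 / cos x = sin y"
      by (rule sincos_total_2pi)
    have "p = Phi (x, y)"
      using x y c by (auto simp: Phi_def vec_eq_iff forall_3 vector_3 field_simps)
    with x y show "p \<in> Phi ` Omega" by (auto simp: Omega_def)
  qed
qed

lemma Phi_has_derivative:
  "(Phi has_derivative (\<lambda>(h, k). vector [- sin x * cos y * h - cos x * sin y * k,
     - sin x * sin y * h + cos x * cos y * k, cos x * h])) (at (x, y))"
proof (subst has_derivative_componentwise_within, intro ballI)
  fix e :: "real^3" assume "e \<in> Basis"
  then obtain i where e: "e = axis i 1" by (auto simp: Basis_vec_def)
  have "i = 1 \<or> i = 2 \<or> i = 3" by (rule exhaust_3)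
  then show "((\<lambda>p. Phi p \<bullet> e) has_derivative
     (\<lambda>p. (case p of (h, k) \<Rightarrow> vector [- sin x * cos y * h - cos x * sin y * k,
     - sin x * sin y * h + cos x * cos y * k, cos x * h]) \<bullet> e)) (at (x, y))"
    unfolding e Phi_def
    by (elim disjE)
       (auto simp: inner_axis vector_3 case_prod_unfold fun_eq_iff algebra_simps
          intro!: derivative_eq_intros)
qed

lemma gram_density_Phi: "gram_density Phi (x, y) = \<bar>cos x\<bar>"
proof -
  have D: "frechet_derivative Phi (at (x, y)) = (\<lambda>(h, k). vector [- sin x * cos y * h - cos x * sin y * k,
     - sin x * sin y * h + cos x * cos y * k, cos x * h])"
    by (rule frechet_derivative_at[OF Phi_has_derivative, symmetric])
  have s: "(sin z)\<^sup>2 = 1 - (cos z)\<^sup>2" for z :: real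
    by (simp add: sin_squared_eq)
  have "(sin x * cos y)\<^sup>2 + (sin x * sin y)\<^sup>2 + (cos x)\<^sup>2 = 1"
       "(cos x * sin y)\<^sup>2 + (cos x * cos y)\<^sup>2 = (cos x)\<^sup>2"
    by (simp_all add: power_mult_distrib s algebra_simps)
  then show ?thesis
    unfolding gram_density_def D Let_def
    by (simp add: inner_vec_def sum_3 vector_3 power2_eq_square algebra_simps)
qed

lemma sphere_measure_eq:
  "sphere_measure = distr sigma_measure (restrict_space borel (sphere 0 1)) Phi"
proof -
  have "density (restrict_space lborel Omega) (\<lambda>p. ennreal (gram_density Phi p)) = sigma_measure"
    unfolding sigma_measure_def
  proof (rule density_cong)
    have m: "(\<lambda>p. ennreal (cos (fst p))) \<in> borel_measurable (restrict_space lborel Omega)"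
            "(\<lambda>p. ennreal \<bar>cos (fst p)\<bar>) \<in> borel_measurable (restrict_space lborel Omega)"
      by (auto intro!: measurable_restrict_space1 measurable_compose[OF _ measurable_ennreal]
          borel_measurable_continuous_onI continuous_intros)
    have g: "gram_density Phi = (\<lambda>p. \<bar>cos (fst p)\<bar>)"
      by (auto simp: fun_eq_iff gram_density_Phi)
    show "(\<lambda>p. ennreal (gram_density Phi p)) \<in> borel_measurable (restrict_space lborel Omega)"
         "(\<lambda>(x, y). ennreal (cos x)) \<in> borel_measurable (restrict_space lborel Omega)"
      using m by (simp_all add: g case_prod_unfold)
    show "AE p in restrict_space lborel Omega.
        ennreal (gram_density Phi p) = (case p of (x, y) \<Rightarrow> ennreal (cos x))"
      by (rule AE_I2)
         (auto simp: space_restrict_space Omega_def gram_density_Phi abs_of_pos cos_gt_zero_pi)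
  qed
  then show ?thesis by (simp add: sphere_measure_def)
qed

end

theory Submission
  imports Defs
begin

text \<open>
  The spherical harmonics \<open>e\<^sup>i\<^sup>m\<^sup>y cos\<^sup>n x P(sin x)\<close>, with \<open>n = \<bar>m\<bar>\<close> and \<open>P\<close> an ultraspherical
  polynomial of degree \<open>d\<close>, diagonalize the operator, with eigenvalues \<open>-(d(2n + d + 1) + n)\<close>.

  For the lower bound, the solutions \<open>e\<^sup>-\<^sup>n\<^sup>t e\<^sup>i\<^sup>n\<^sup>y cos\<^sup>n x\<close> are at most \<open>cos\<^sup>n a\<close> on \<open>\<omega>\<close>, whereas their
  norm at time \<open>T\<close> behaves like \<open>e\<^sup>-\<^sup>n\<^sup>T\<close> up to subexponential factors; so \<open>e\<^sup>-\<^sup>T \<le> cos a\<close>.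

  For the upper bound, Fourier modes in \<open>y\<close> are orthogonal on \<open>\<omega>\<close> as well, and are treated one at a
  time. A Remez inequality for \<open>P\<close> shows that sums of modes of degree at most \<open>d\<close> lose at most a
  factor \<open>M K\<^sup>d\<^sup>+\<^sup>n\<close> when restricted to \<open>\<omega>\<close>, while the modes of degree above \<open>d\<close> decay at a rate of
  at least \<open>d\<^sup>2 + 2nd + n\<close>. For large times the decay wins, uniformly in \<open>n\<close>.
\<close>

section \<open>Square-integrable functions and orthonormal bases\<close>

text \<open>\<open>exp_semigroup\<close> and \<open>formal_adjoint\<close> are choices, so nothing
  is known about them before existence and uniqueness up to null sets are established. For the
  semigroup this is done on Fourier coefficients: a strongly continuous semigroup commutes with its
  generator, hence preserves the finite-dimensional eigenspaces, where its derivative at 0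
  determines it. \<open>L_graph\<close> is the maximal, distributional realization; completeness of
  the harmonics and symmetry on smooth functions identify it with the diagonal operator.

  The obstacle in the upper bound is that the spectral loss \<open>K^(d+n)\<close> grows with the
  order \<open>n\<close>, whereas the slowest mode of order \<open>n\<close> decays only at rate
  \<open>n\<close>. The cross term \<open>2nd\<close> of the eigenvalue compensates the loss between
  consecutive dyadic intervals, but a factor \<open>K^n\<close> survives the telescoping; a second
  waiting time removes it. All constants are independent of the order and of the truncation, so the
  orders can be summed by orthogonality and the truncation removed by a limit.\<close>

definition ip :: "'a measure \<Rightarrow> ('a \<Rightarrow> complex) \<Rightarrow> ('a \<Rightarrow> complex) \<Rightarrow> complex" where
  "ip M f g = (LINT x|M. f x * cnj (g x))"

definition sqn :: "'a measure \<Rightarrow> ('a \<Rightarrow> complex) \<Rightarrow> real" where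
  "sqn M f = (LINT x|M. (cmod (f x))\<^sup>2)"

lemma sqn_nonneg [simp]: "sqn M f \<ge> 0"
  by (simp add: sqn_def)

lemma L2norm_sqn: "L2norm M f = sqrt (sqn M f)"
  by (simp add: L2norm_def sqn_def)

lemma L2_measurable: "f \<in> L2 M \<Longrightarrow> f \<in> borel_measurable M"
  by (simp add: L2_def)

lemma L2_integrable_sq: "f \<in> L2 M \<Longrightarrow> integrable M (\<lambda>x. (cmod (f x))\<^sup>2)"
  by (simp add: L2_def)

lemma cmod_add_sq_le: "(cmod (z + w))\<^sup>2 \<le> 2 * (cmod z)\<^sup>2 + 2 * (cmod w)\<^sup>2"
proof -
  have "(cmod (z + w))\<^sup>2 \<le> (cmod z + cmod w)\<^sup>2"
    by (intro power_mono norm_triangle_ineq) auto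
  also have "\<dots> \<le> 2 * (cmod z)\<^sup>2 + 2 * (cmod w)\<^sup>2"
    using sum_squares_bound[of "cmod z" "cmod w"] by (simp add: power2_sum)
  finally show ?thesis .
qed

lemma L2_mult_integrable:
  assumes "f \<in> L2 M" "g \<in> L2 M"
  shows "integrable M (\<lambda>x. f x * cnj (g x))"
proof (rule Bochner_Integration.integrable_bound)
  show "integrable M (\<lambda>x. (cmod (f x))\<^sup>2 + (cmod (g x))\<^sup>2)"
    using assms by (intro Bochner_Integration.integrable_add L2_integrable_sq)
  have [measurable]: "f \<in> borel_measurable M" "g \<in> borel_measurable M"
    using assms by (auto simp: L2_measurable)
  have [measurable]: "(\<lambda>x. cnj (g x)) \<in> borel_measurable M"
    by (rule measurable_compose[OF \<open>g \<in> borel_measurable M\<close> borel_measurable_continuous_onI])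
       (intro continuous_intros)
  show "(\<lambda>x. f x * cnj (g x)) \<in> borel_measurable M"
    by measurable
  show "AE x in M. norm (f x * cnj (g x)) \<le> norm ((cmod (f x))\<^sup>2 + (cmod (g x))\<^sup>2)"
  proof (rule AE_I2)
    fix x
    have "cmod (f x) * cmod (g x) \<le> (cmod (f x))\<^sup>2 + (cmod (g x))\<^sup>2"
      using sum_squares_bound[of "cmod (f x)" "cmod (g x)"]
        mult_nonneg_nonneg[OF norm_ge_zero[of "f x"] norm_ge_zero[of "g x"]] by linarith
    then show "norm (f x * cnj (g x)) \<le> norm ((cmod (f x))\<^sup>2 + (cmod (g x))\<^sup>2)"
      by (simp add: norm_mult)
  qed
qed

lemma L2_lin:
  assumes "f \<in> L2 M" "g \<in> L2 M"
  shows "(\<lambda>x. c * f x + g x) \<in> L2 M"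
proof -
  have [measurable]: "f \<in> borel_measurable M" "g \<in> borel_measurable M"
    using assms by (auto simp: L2_measurable)
  have "integrable M (\<lambda>x. (cmod (c * f x + g x))\<^sup>2)"
  proof (rule Bochner_Integration.integrable_bound)
    show "integrable M (\<lambda>x. (2 * (cmod c)\<^sup>2) * (cmod (f x))\<^sup>2 + 2 * (cmod (g x))\<^sup>2)"
      using assms by (intro Bochner_Integration.integrable_add integrable_mult_right L2_integrable_sq)
    show "AE x in M. norm ((cmod (c * f x + g x))\<^sup>2) \<le> norm ((2 * (cmod c)\<^sup>2) * (cmod (f x))\<^sup>2 + 2 * (cmod (g x))\<^sup>2)"
      by (intro AE_I2) (use cmod_add_sq_le[of "c * f x" "g x" for x] in \<open>simp add: norm_mult power_mult_distrib mult.assoc\<close>)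
  qed measurable
  then show ?thesis by (simp add: L2_def)
qed

lemma L2_zero [simp]: "(\<lambda>x. 0) \<in> L2 M"
  by (simp add: L2_def)

lemma L2_scale: "f \<in> L2 M \<Longrightarrow> (\<lambda>x. c * f x) \<in> L2 M"
  using L2_lin[of f M "\<lambda>x. 0" c] by simp

lemma L2_add: "f \<in> L2 M \<Longrightarrow> g \<in> L2 M \<Longrightarrow> (\<lambda>x. f x + g x) \<in> L2 M"
  using L2_lin[of f M g 1] by simp

lemma L2_diff: "f \<in> L2 M \<Longrightarrow> g \<in> L2 M \<Longrightarrow> (\<lambda>x. f x - g x) \<in> L2 M"
  using L2_lin[of g M f "-1"] by simp

lemma L2_sum: "(\<And>i. i \<in> I \<Longrightarrow> f i \<in> L2 M) \<Longrightarrow> (\<lambda>x. \<Sum>i\<in>I. f i x) \<in> L2 M"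
  by (induction I rule: infinite_finite_induct) (auto intro: L2_add)

lemma L2_cong_AE:
  assumes "f \<in> L2 M" "g \<in> borel_measurable M" "AE x in M. f x = g x"
  shows "g \<in> L2 M"
proof -
  have "integrable M (\<lambda>x. (cmod (g x))\<^sup>2)"
    by (rule integrable_cong_AE_imp[OF L2_integrable_sq[OF assms(1)]])
       (use assms in auto)
  then show ?thesis using assms by (simp add: L2_def)
qed

lemma sqn_cong_AE:
  assumes "AE x in M. f x = g x" "f \<in> borel_measurable M" "g \<in> borel_measurable M"
  shows "sqn M f = sqn M g"
  unfolding sqn_def by (rule integral_cong_AE) (use assms in auto)

lemma ip_cong_AE:
  assumes "AE x in M. f x = g x" "f \<in> L2 M" "g \<in> L2 M" "h \<in> L2 M"
  shows "ip M f h = ip M g h"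
  unfolding ip_def by (rule integral_cong_AE)
    (use assms in \<open>auto intro: borel_measurable_integrable L2_mult_integrable\<close>)

lemma ip_lin:
  assumes "f \<in> L2 M" "g \<in> L2 M" "h \<in> L2 M"
  shows "ip M (\<lambda>x. c * f x + g x) h = c * ip M f h + ip M g h"
  unfolding ip_def using assms
  by (simp add: distrib_right mult.assoc L2_mult_integrable)

lemma ip_scale:
  assumes "f \<in> L2 M" "h \<in> L2 M"
  shows "ip M (\<lambda>x. c * f x) h = c * ip M f h"
  using ip_lin[of f M "\<lambda>x. 0" h c] assms by (simp add: ip_def)

lemma ip_diff:
  assumes "f \<in> L2 M" "g \<in> L2 M" "h \<in> L2 M"
  shows "ip M (\<lambda>x. f x - g x) h = ip M f h - ip M g h"
  using ip_lin[of g M f h "-1"] assms by simp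

lemma ip_add:
  assumes "f \<in> L2 M" "g \<in> L2 M" "h \<in> L2 M"
  shows "ip M (\<lambda>x. f x + g x) h = ip M f h + ip M g h"
  using ip_lin[of f M g h 1] assms by simp

lemma ip_sum:
  assumes "\<And>i. i \<in> I \<Longrightarrow> f i \<in> L2 M" "h \<in> L2 M"
  shows "ip M (\<lambda>x. \<Sum>i\<in>I. f i x) h = (\<Sum>i\<in>I. ip M (f i) h)"
  using assms
proof (induction I rule: infinite_finite_induct)
  case (insert x F)
  then show ?case
    by (simp add: ip_add L2_sum)
qed (auto simp: ip_def)

lemma ip_cnj: "ip M g f = cnj (ip M f g)"
  unfolding ip_def by (simp only: Bochner_Integration.integral_cnj[symmetric] complex_cnj_mult complex_cnj_cnj mult.commute)

lemma ip_self: "ip M f f = complex_of_real (sqn M f)"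
  unfolding ip_def sqn_def integral_complex_of_real[symmetric] by (simp only: complex_norm_square)

lemma sqn_diff:
  assumes "f \<in> L2 M" "g \<in> L2 M"
  shows "sqn M (\<lambda>x. f x - g x) = sqn M f - 2 * Re (ip M f g) + sqn M g"
proof -
  have d: "(\<lambda>x. f x - g x) \<in> L2 M" using assms by (rule L2_diff)
  have "complex_of_real (sqn M (\<lambda>x. f x - g x)) = ip M f (\<lambda>x. f x - g x) - ip M g (\<lambda>x. f x - g x)"
    unfolding ip_self[symmetric] using assms d by (intro ip_diff)
  also have "\<dots> = cnj (ip M (\<lambda>x. f x - g x) f) - cnj (ip M (\<lambda>x. f x - g x) g)"
    by (simp flip: ip_cnj)
  also have "\<dots> = cnj (ip M f f - ip M g f) - cnj (ip M f g - ip M g g)"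
    using assms by (simp add: ip_diff)
  also have "\<dots> = complex_of_real (sqn M f) - ip M f g - cnj (ip M f g) + complex_of_real (sqn M g)"
    by (simp add: ip_self flip: ip_cnj)
  also have "Re \<dots> = sqn M f - 2 * Re (ip M f g) + sqn M g" by simp
  finally show ?thesis by simp
qed

lemma sqn_scale: "sqn M (\<lambda>x. c * f x) = (cmod c)\<^sup>2 * sqn M f"
  by (simp add: sqn_def norm_mult power_mult_distrib)

lemma sqn_add_le:
  assumes "f \<in> L2 M" "g \<in> L2 M"
  shows "sqn M (\<lambda>x. f x + g x) \<le> 2 * sqn M f + 2 * sqn M g"
proof -
  have "sqn M (\<lambda>x. f x + g x) \<le> (LINT x|M. 2 * (cmod (f x))\<^sup>2 + 2 * (cmod (g x))\<^sup>2)"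
    unfolding sqn_def using assms
    by (intro integral_mono cmod_add_sq_le L2_integrable_sq L2_add
        Bochner_Integration.integrable_add integrable_mult_right)
  also have "\<dots> = 2 * sqn M f + 2 * sqn M g"
    unfolding sqn_def using assms by (simp add: L2_integrable_sq)
  finally show ?thesis .
qed

lemma sqn_0_AE:
  assumes "f \<in> L2 M" "sqn M f = 0"
  shows "AE x in M. f x = 0"
  using integral_nonneg_eq_0_iff_AE[OF L2_integrable_sq[OF assms(1)]] assms(2)
  by (auto simp: sqn_def)

text \<open>Completeness is assumed in the weak form that only zero is orthogonal to all \<open>E j\<close>.\<close>

locale onb = finite_measure M for M :: "'a measure" +
  fixes E :: "nat \<Rightarrow> 'a \<Rightarrow> complex"
  assumes E_L2 [simp]: "E j \<in> L2 M"
    and E_orth: "ip M (E i) (E j) = (if i = j then 1 else 0)"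
    and E_complete: "f \<in> L2 M \<Longrightarrow> (\<And>j. ip M f (E j) = 0) \<Longrightarrow> AE x in M. f x = 0"
begin

abbreviation cf where "cf f j \<equiv> ip M f (E j)"

definition comb :: "nat set \<Rightarrow> (nat \<Rightarrow> complex) \<Rightarrow> 'a \<Rightarrow> complex" where
  "comb F a = (\<lambda>x. \<Sum>j\<in>F. a j * E j x)"

lemma comb_L2 [simp]: "comb F a \<in> L2 M"
  unfolding comb_def by (intro L2_sum L2_scale E_L2)

lemma cf_comb: "finite F \<Longrightarrow> cf (comb F a) j = (if j \<in> F then a j else 0)"
proof -
  assume F: "finite F"
  have "cf (comb F a) j = (\<Sum>i\<in>F. a i * (if i = j then 1 else 0))"
    unfolding comb_def by (simp add: ip_sum L2_scale ip_scale E_orth)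
  also have "\<dots> = (\<Sum>i\<in>F. if j = i then a i else 0)" by (rule sum.cong) auto
  also have "\<dots> = (if j \<in> F then a j else 0)" using F by (rule sum.delta')
  finally show ?thesis .
qed

lemma ip_comb: "f \<in> L2 M \<Longrightarrow> ip M f (comb F a) = (\<Sum>j\<in>F. cnj (a j) * cf f j)"
proof -
  assume f: "f \<in> L2 M"
  have "ip M (comb F a) f = (\<Sum>j\<in>F. a j * ip M (E j) f)"
    unfolding comb_def using f by (simp add: ip_sum L2_scale ip_scale)
  then have "cnj (ip M (comb F a) f) = (\<Sum>j\<in>F. cnj (a j) * cnj (ip M (E j) f))" by simp
  then show ?thesis by (simp flip: ip_cnj)
qed

lemma sqn_comb: "finite F \<Longrightarrow> sqn M (comb F a) = (\<Sum>j\<in>F. (cmod (a j))\<^sup>2)"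
proof -
  assume F: "finite F"
  have "complex_of_real (sqn M (comb F a)) = (\<Sum>j\<in>F. cnj (a j) * cf (comb F a) j)"
    unfolding ip_self[symmetric] by (rule ip_comb) simp
  also have "\<dots> = (\<Sum>j\<in>F. complex_of_real ((cmod (a j))\<^sup>2))"
    by (rule sum.cong) (simp_all add: cf_comb F complex_norm_square mult.commute del: of_real_power)
  finally show ?thesis unfolding of_real_sum[symmetric] of_real_eq_iff .
qed

lemma sqn_minus_comb:
  assumes "f \<in> L2 M" "finite F"
  shows "sqn M (\<lambda>x. f x - comb F (cf f) x) = sqn M f - (\<Sum>j\<in>F. (cmod (cf f j))\<^sup>2)"
proof -
  have "ip M f (comb F (cf f)) = (\<Sum>j\<in>F. complex_of_real ((cmod (cf f j))\<^sup>2))"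
    unfolding ip_comb[OF assms(1)] by (rule sum.cong) (simp_all add: complex_norm_square mult.commute del: of_real_power)
  then have "Re (ip M f (comb F (cf f))) = (\<Sum>j\<in>F. (cmod (cf f j))\<^sup>2)"
    by (simp flip: of_real_sum)
  then show ?thesis by (simp add: sqn_diff assms sqn_comb)
qed

lemma bessel: "f \<in> L2 M \<Longrightarrow> finite F \<Longrightarrow> (\<Sum>j\<in>F. (cmod (cf f j))\<^sup>2) \<le> sqn M f"
  using sqn_minus_comb[of f F] sqn_nonneg[of M "\<lambda>x. f x - comb F (cf f) x"] by linarith

lemma cf_le: "f \<in> L2 M \<Longrightarrow> (cmod (cf f j))\<^sup>2 \<le> sqn M f"
  using bessel[of f "{j}"] by simp

lemma summable_cf: "f \<in> L2 M \<Longrightarrow> summable (\<lambda>j. (cmod (cf f j))\<^sup>2)"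
  by (rule summableI_nonneg_bounded[where x="sqn M f"]) (auto intro: bessel)

text \<open>Completeness of L2, with a rate. A subsequence of the partial sums with squared gaps at
  most \<open>(1/4)^k\<close> has summable L1 gaps because the measure is finite, so it converges
  almost everywhere; Fatou's lemma then carries the tail bound over to the limit.\<close>

lemma riesz_fischer_approx:
  assumes s: "summable (\<lambda>j. (cmod (a j))\<^sup>2)"
  obtains f where "f \<in> L2 M" "\<And>N. sqn M (\<lambda>x. f x - comb {..<N} a x) \<le> (\<Sum>j. (cmod (a (j + N)))\<^sup>2)"
proof -
  define p where "p N = comb {..<N} a" for N
  have p_meas [measurable]: "p N \<in> borel_measurable M" for N unfolding p_def by (simp add: L2_measurable)
  have pL2: "p N \<in> L2 M" for N by (simp add: p_def)
  define tl where "tl N = (\<Sum>j. (cmod (a (j + N)))\<^sup>2)" for N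
  have tl0: "tl \<longlonglongrightarrow> 0"
    unfolding tl_def using suminf_exist_split2[OF s] by simp
  have dif: "sqn M (\<lambda>x. p m x - p n x) \<le> tl n" if "n \<le> m" for m n
  proof -
    have "(\<lambda>x. p m x - p n x) = comb {n..<m} a"
      unfolding p_def comb_def using that
      by (auto simp: fun_eq_iff atLeast0LessThan[symmetric] sum_diff_nat_ivl)
    then have "sqn M (\<lambda>x. p m x - p n x) = (\<Sum>j=n..<m. (cmod (a j))\<^sup>2)"
      by (simp add: sqn_comb)
    also have "\<dots> = (\<Sum>j<m-n. (cmod (a (j + n)))\<^sup>2)"
      using sum.shift_bounds_nat_ivl[of "\<lambda>j. (cmod (a j))\<^sup>2" 0 n "m - n"] that
      by (simp add: atLeast0LessThan)
    also have "\<dots> \<le> tl n"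
      unfolding tl_def by (rule sum_le_suminf) (use summable_ignore_initial_segment[OF s] in auto)
    finally show ?thesis .
  qed
  have "\<exists>N. \<forall>n\<ge>N. tl n < (1/4)^k" for k
    using order_tendstoD(2)[OF tl0, of "(1/4)^k"] by (simp add: eventually_sequentially)
  then obtain N0 where N0: "\<And>k n. n \<ge> N0 k \<Longrightarrow> tl n < (1/4)^k" by metis
  \<comment> \<open>Summing \<open>N0\<close> makes the sequence monotone; adding \<open>k\<close>
    makes it tend to infinity, so that \<open>N k\<close> eventually exceeds the fixed
    \<open>n\<close> in the Fatou argument below.\<close>
  define N where "N k = (\<Sum>i\<le>k. N0 i) + k" for k
  have N_ge: "N0 k \<le> N k" for k unfolding N_def by (rule trans_le_add1, rule member_le_sum) auto
  have N_mono: "N k \<le> N (Suc k)" for k unfolding N_def by simp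
  have N_k: "k \<le> N k" for k by (simp add: N_def)
  define h where "h k = (\<lambda>x. p (N (Suc k)) x - p (N k) x)" for k
  have h_meas [measurable]: "h k \<in> borel_measurable M" for k unfolding h_def by measurable
  have hL2: "h k \<in> L2 M" for k unfolding h_def by (intro L2_diff pL2)
  have hsq: "sqn M (h k) \<le> (1/4)^k" for k
    unfolding h_def using dif[OF N_mono] N0[OF N_ge, of k] by (meson less_imp_le order_trans)
  define B where "B = (measure M (space M) + 1) / 2"
  have hint: "integrable M (\<lambda>x. cmod (h k x))" and hbd: "(LINT x|M. cmod (h k x)) \<le> B * (1/2)^k" for k
  proof -
    \<comment> \<open>Weighted arithmetic-geometric mean: the weight \<open>2^k\<close> is chosen so
      that the squared bound \<open>(1/4)^k\<close> gives an L1 bound of order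
      \<open>(1/2)^k\<close>.\<close>
    have i2: "integrable M (\<lambda>x. ((1/2)^k + 2^k * (cmod (h k x))\<^sup>2) / 2)"
      by (intro integrable_divide Bochner_Integration.integrable_add integrable_mult_right L2_integrable_sq hL2) simp
    have b: "cmod (h k x) \<le> ((1/2)^k + 2^k * (cmod (h k x))\<^sup>2) / 2" for x
    proof -
      have "0 \<le> (1/2)^k * (1 - 2^k * cmod (h k x))\<^sup>2" by simp
      also have "\<dots> = (1/2)^k - 2 * cmod (h k x) + 2^k * (cmod (h k x))\<^sup>2"
        by (simp add: power2_eq_square algebra_simps power_divide)
      finally show ?thesis by simp
    qed
    show "integrable M (\<lambda>x. cmod (h k x))"
      by (rule Bochner_Integration.integrable_bound[OF i2]) (use b in \<open>auto intro!: AE_I2 order_trans[OF b]\<close>)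
    then have "(LINT x|M. cmod (h k x)) \<le> (LINT x|M. ((1/2)^k + 2^k * (cmod (h k x))\<^sup>2) / 2)"
      by (intro integral_mono i2 b)
    also have "\<dots> = ((1/2)^k * measure M (space M) + 2^k * sqn M (h k)) / 2"
      unfolding sqn_def by (simp add: L2_integrable_sq hL2)
    also have "\<dots> \<le> ((1/2)^k * measure M (space M) + 2^k * (1/4)^k) / 2"
      using hsq[of k] by (simp add: mult_left_mono)
    also have "\<dots> = B * (1/2)^k"
    proof -
      have "(2::real)^k * (1/4)^k = (1/2)^k" by (simp flip: power_mult_distrib)
      then show ?thesis by (simp add: B_def algebra_simps add_divide_distrib)
    qed
    finally show "(LINT x|M. cmod (h k x)) \<le> B * (1/2)^k" .
  qed
  have B0: "B \<ge> 0" by (simp add: B_def)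
  have "(\<integral>\<^sup>+x. (\<Sum>k. ennreal (cmod (h k x))) \<partial>M) = (\<Sum>k. \<integral>\<^sup>+x. ennreal (cmod (h k x)) \<partial>M)"
    by (rule nn_integral_suminf) measurable
  also have "\<dots> = (\<Sum>k. ennreal (LINT x|M. cmod (h k x)))"
    by (intro suminf_cong nn_integral_eq_integral hint) auto
  also have "\<dots> \<le> (\<Sum>k. ennreal (B * (1/2)^k))"
    by (intro suminf_le ennreal_leI hbd) auto
  also have "\<dots> = ennreal (\<Sum>k. B * (1/2)^k)"
    by (rule suminf_ennreal2) (use B0 in \<open>auto intro!: summable_mult summable_geometric\<close>)
  finally have "(\<integral>\<^sup>+x. (\<Sum>k. ennreal (cmod (h k x))) \<partial>M) < \<infinity>"
    by (rule order_le_less_trans) simp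
  then have "AE x in M. (\<Sum>k. ennreal (cmod (h k x))) \<noteq> \<infinity>"
    by (intro nn_integral_PInf_AE) auto
  then have conv: "AE x in M. convergent (\<lambda>k. p (N k) x)"
  proof eventually_elim
    case (elim x)
    then have "summable (\<lambda>k. cmod (h k x))"
      by (intro summable_suminf_not_top) (auto simp: infinity_ennreal_def)
    then have "summable (\<lambda>k. p (N (Suc k)) x - p (N k) x)"
      unfolding h_def by (rule summable_norm_cancel)
    then have "convergent (\<lambda>n. \<Sum>k<n. p (N (Suc k)) x - p (N k) x)"
      by (simp add: summable_iff_convergent)
    then have "convergent (\<lambda>n. p (N n) x - p (N 0) x)"
      using sum_lessThan_telescope[of "\<lambda>k. p (N k) x"] by simp
    then show ?case
      using convergent_add[OF _ convergent_const, of "\<lambda>n. p (N n) x - p (N 0) x" "p (N 0) x"] by simp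
  qed
  define f where "f x = lim (\<lambda>k. p (N k) x)" for x
  have f_meas [measurable]: "f \<in> borel_measurable M"
    unfolding f_def by (rule borel_measurable_lim_metric) measurable
  have key: "(\<lambda>x. f x - p n x) \<in> L2 M \<and> sqn M (\<lambda>x. f x - p n x) \<le> tl n" for n
  proof -
    have "(\<integral>\<^sup>+x. ennreal ((cmod (f x - p n x))\<^sup>2) \<partial>M) \<le> (\<integral>\<^sup>+x. liminf (\<lambda>k. ennreal ((cmod (p (N k) x - p n x))\<^sup>2)) \<partial>M)"
    proof (rule nn_integral_mono_AE)
      show "AE x in M. ennreal ((cmod (f x - p n x))\<^sup>2) \<le> liminf (\<lambda>k. ennreal ((cmod (p (N k) x - p n x))\<^sup>2))"
        using conv
      proof eventually_elim
        case (elim x)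
        then have "(\<lambda>k. p (N k) x) \<longlonglongrightarrow> f x" unfolding f_def by (simp add: convergent_LIMSEQ_iff)
        then have "(\<lambda>k. ennreal ((cmod (p (N k) x - p n x))\<^sup>2)) \<longlonglongrightarrow> ennreal ((cmod (f x - p n x))\<^sup>2)"
          by (intro tendsto_ennrealI tendsto_intros)
        from lim_imp_Liminf[OF trivial_limit_sequentially this] show ?case by (rule eq_refl[OF sym])
      qed
    qed
    also have "\<dots> \<le> liminf (\<lambda>k. \<integral>\<^sup>+x. ennreal ((cmod (p (N k) x - p n x))\<^sup>2) \<partial>M)"
      by (rule nn_integral_liminf) measurable
    also have "\<dots> \<le> ennreal (tl n)"
    proof (rule order_trans[OF Liminf_le_Limsup], simp, rule Limsup_bounded)
      show "\<forall>\<^sub>F k in sequentially. (\<integral>\<^sup>+x. ennreal ((cmod (p (N k) x - p n x))\<^sup>2) \<partial>M) \<le> ennreal (tl n)"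
        using eventually_ge_at_top[of n]
      proof eventually_elim
        case (elim k)
        have "(\<integral>\<^sup>+x. ennreal ((cmod (p (N k) x - p n x))\<^sup>2) \<partial>M) = ennreal (sqn M (\<lambda>x. p (N k) x - p n x))"
          unfolding sqn_def by (intro nn_integral_eq_integral L2_integrable_sq L2_diff pL2) auto
        then show ?case using dif[of n "N k"] elim N_k[of k] by (simp add: ennreal_leI)
      qed
    qed
    finally have *: "(\<integral>\<^sup>+x. ennreal ((cmod (f x - p n x))\<^sup>2) \<partial>M) \<le> ennreal (tl n)" .
    have i: "integrable M (\<lambda>x. (cmod (f x - p n x))\<^sup>2)"
      by (rule integrableI_nonneg) (use * in \<open>auto intro: order_le_less_trans\<close>)
    have "ennreal (sqn M (\<lambda>x. f x - p n x)) \<le> ennreal (tl n)"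
      using * unfolding sqn_def by (subst nn_integral_eq_integral[symmetric]) (use i in auto)
    moreover have "0 \<le> tl n" unfolding tl_def by (intro suminf_nonneg summable_ignore_initial_segment[OF s]) auto
    ultimately have "sqn M (\<lambda>x. f x - p n x) \<le> tl n" by simp
    with i show ?thesis by (simp add: L2_def)
  qed
  have "(\<lambda>x. (f x - p 0 x) + p 0 x) \<in> L2 M" using key[of 0] by (intro L2_add pL2) auto
  then have "f \<in> L2 M" by simp
  with that[of f] key show ?thesis unfolding p_def tl_def by blast
qed

lemma riesz_fischer:
  assumes s: "summable (\<lambda>j. (cmod (a j))\<^sup>2)"
  shows "\<exists>f\<in>L2 M. \<forall>j. cf f j = a j"
proof -
  obtain f where f: "f \<in> L2 M" and
    le: "\<And>N. sqn M (\<lambda>x. f x - comb {..<N} a x) \<le> (\<Sum>j. (cmod (a (j + N)))\<^sup>2)"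
    using riesz_fischer_approx[OF s] by blast
  have "cf f j = a j" for j
  proof -
    have "(cmod (cf f j - a j))\<^sup>2 \<le> 0"
    proof (rule LIMSEQ_le_const)
      show "(\<lambda>N. \<Sum>j. (cmod (a (j + N)))\<^sup>2) \<longlonglongrightarrow> 0" using suminf_exist_split2[OF s] by simp
      have "(cmod (cf f j - a j))\<^sup>2 \<le> (\<Sum>j. (cmod (a (j + N)))\<^sup>2)" if "N \<ge> Suc j" for N
      proof -
        have "cf (\<lambda>x. f x - comb {..<N} a x) j = cf f j - a j"
          using that f by (simp add: ip_diff cf_comb)
        then show ?thesis using cf_le[of "\<lambda>x. f x - comb {..<N} a x" j] le[of N] f
          by (simp add: L2_diff)
      qed
      then show "\<exists>N. \<forall>n\<ge>N. (cmod (cf f j - a j))\<^sup>2 \<le> (\<Sum>j. (cmod (a (j + n)))\<^sup>2)" by blast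
    qed
    then show ?thesis by simp
  qed
  with f show ?thesis by blast
qed

lemma cf_eq_imp_AE:
  assumes "f \<in> L2 M" "g \<in> L2 M" "\<And>j. cf f j = cf g j"
  shows "AE x in M. f x = g x"
  using E_complete[of "\<lambda>x. f x - g x"] assms by (simp add: L2_diff ip_diff)

text \<open>Completeness is available only as a uniqueness property, so a function \<open>g\<close>
  is first built from the coefficients of \<open>f\<close>, for which the convergence holds by
  construction; equal coefficients then give \<open>g = f\<close> almost everywhere.\<close>

lemma sqn_minus_comb_tendsto:
  assumes f: "f \<in> L2 M"
  shows "(\<lambda>N. sqn M (\<lambda>x. f x - comb {..<N} (cf f) x)) \<longlonglongrightarrow> 0"
proof -
  have s: "summable (\<lambda>j. (cmod (cf f j))\<^sup>2)" by (rule summable_cf[OF f])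
  obtain g where g: "g \<in> L2 M" and
    le: "\<And>N. sqn M (\<lambda>x. g x - comb {..<N} (cf f) x) \<le> (\<Sum>j. (cmod (cf f (j + N)))\<^sup>2)"
    using riesz_fischer_approx[OF s] by blast
  have t: "(\<lambda>N. \<Sum>j. (cmod (cf f (j + N)))\<^sup>2) \<longlonglongrightarrow> 0" using suminf_exist_split2[OF s] by simp
  have gl: "(\<lambda>N. sqn M (\<lambda>x. g x - comb {..<N} (cf f) x)) \<longlonglongrightarrow> 0"
    by (rule tendsto_sandwich[OF _ _ tendsto_const t]) (use le in auto)
  have "cf g j = cf f j" for j
  proof -
    have "(\<lambda>N. (cmod (cf g j - cf f j))\<^sup>2) \<longlonglongrightarrow> 0"
    proof (rule tendsto_sandwich[OF _ _ tendsto_const gl])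
      show "\<forall>\<^sub>F N in sequentially. (cmod (cf g j - cf f j))\<^sup>2 \<le> sqn M (\<lambda>x. g x - comb {..<N} (cf f) x)"
        using eventually_ge_at_top[of "Suc j"]
      proof eventually_elim
        case (elim N)
        then show ?case using cf_le[of "\<lambda>x. g x - comb {..<N} (cf f) x" j] g
          by (simp add: L2_diff ip_diff cf_comb)
      qed
    qed auto
    then show ?thesis by (simp add: LIMSEQ_const_iff)
  qed
  then have "AE x in M. g x = f x" using cf_eq_imp_AE f g by blast
  then have "sqn M (\<lambda>x. g x - comb {..<N} (cf f) x) = sqn M (\<lambda>x. f x - comb {..<N} (cf f) x)" for N
    by (intro sqn_cong_AE) (use f g in \<open>auto intro!: L2_measurable L2_diff\<close>)
  with gl show ?thesis by simp
qed

lemma parseval: "f \<in> L2 M \<Longrightarrow> (\<lambda>j. (cmod (cf f j))\<^sup>2) sums sqn M f"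
  using tendsto_diff[OF tendsto_const[of "sqn M f"] sqn_minus_comb_tendsto[of f]]
  by (simp add: sums_def sqn_minus_comb)

end

section \<open>Diagonal operators and their semigroups\<close>

lemma L2norm_tendsto_0_iff:
  "((\<lambda>t. L2norm M (F t)) \<longlongrightarrow> 0) G \<longleftrightarrow> ((\<lambda>t. sqn M (F t)) \<longlongrightarrow> 0) G"
proof
  assume "((\<lambda>t. L2norm M (F t)) \<longlongrightarrow> 0) G"
  then have "((\<lambda>t. (L2norm M (F t))\<^sup>2) \<longlongrightarrow> 0\<^sup>2) G" by (intro tendsto_intros)
  then show "((\<lambda>t. sqn M (F t)) \<longlongrightarrow> 0) G" by (simp add: L2norm_sqn)
next
  assume "((\<lambda>t. sqn M (F t)) \<longlongrightarrow> 0) G"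
  then have "((\<lambda>t. sqrt (sqn M (F t))) \<longlongrightarrow> sqrt 0) G" by (intro tendsto_intros)
  then show "((\<lambda>t. L2norm M (F t)) \<longlongrightarrow> 0) G" by (simp add: L2norm_sqn)
qed

lemma exp_diff_quotient_tendsto:
  "((\<lambda>t::real. (exp (c * t) - 1) / t) \<longlongrightarrow> c) (at_right 0)"
proof -
  have "((\<lambda>t. exp (c * t)) has_real_derivative exp (c * 0) * c) (at 0)"
    by (auto intro!: derivative_eq_intros)
  then have "(\<lambda>t. (exp (c * t) - 1) / t) \<midarrow>0\<rightarrow> c"
    by (simp add: has_field_derivative_iff)
  then show ?thesis by (rule filterlim_mono[OF _ order_refl at_le]) simp
qed

lemma L2_uminus: "f \<in> L2 M \<Longrightarrow> (\<lambda>x. - f x) \<in> L2 M"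
  using L2_scale[of f M "-1"] by simp

lemma ip_uminus: "ip M (\<lambda>x. - f x) h = - ip M f h"
  by (simp add: ip_def)

text \<open>Nonnegative eigenvalues make the semigroup contractive. Finite multiplicity serves the
  uniqueness proof, which evaluates an arbitrary semigroup as a matrix on each eigenspace.\<close>

locale diag = onb +
  fixes lam :: "nat \<Rightarrow> real"
  assumes lam_nonneg: "lam j \<ge> 0"
    and finite_lam: "finite {k. lam k = lam j}"
begin

text \<open>The domain is implicit: \<open>v\<close> belongs to it exactly when the products
  \<open>lam j * cf v j\<close> are the coefficients of a square-integrable function, that is, are
  square-summable.\<close>

definition diag_graph :: "'a operator_graph" where
  "diag_graph = {(v, w). v \<in> L2 M \<and> w \<in> L2 M \<and> (\<forall>j. cf w j = - complex_of_real (lam j) * cf v j)}"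

definition sg :: "real \<Rightarrow> ('a \<Rightarrow> complex) \<Rightarrow> ('a \<Rightarrow> complex)" where
  "sg t f = (SOME h. h \<in> L2 M \<and> (\<forall>j. cf h j = complex_of_real (exp (- lam j * t)) * cf f j))"

lemma sg_exists:
  assumes "t \<ge> 0" "f \<in> L2 M"
  shows "\<exists>h. h \<in> L2 M \<and> (\<forall>j. cf h j = complex_of_real (exp (- lam j * t)) * cf f j)"
proof -
  have "summable (\<lambda>j. (cmod (complex_of_real (exp (- lam j * t)) * cf f j))\<^sup>2)"
  proof (rule summable_comparison_test'[OF summable_cf[OF assms(2)], of 0])
    fix j
    have "exp (- lam j * t) \<le> 1" using lam_nonneg[of j] assms(1) by simp
    then show "norm ((cmod (complex_of_real (exp (- lam j * t)) * cf f j))\<^sup>2) \<le> (cmod (cf f j))\<^sup>2"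
      by (simp add: norm_mult power_mult_distrib mult_left_le_one_le power_le_one)
  qed
  from riesz_fischer[OF this] show ?thesis by blast
qed

lemma sg_L2: "t \<ge> 0 \<Longrightarrow> f \<in> L2 M \<Longrightarrow> sg t f \<in> L2 M"
  and cf_sg: "t \<ge> 0 \<Longrightarrow> f \<in> L2 M \<Longrightarrow> cf (sg t f) j = complex_of_real (exp (- lam j * t)) * cf f j"
  unfolding sg_def using someI_ex[OF sg_exists] by blast+

lemma sqn_mono_cf:
  assumes "f \<in> L2 M" "g \<in> L2 M" "\<And>j. cmod (cf f j) \<le> cmod (cf g j)"
  shows "sqn M f \<le> sqn M g"
  by (rule sums_le[OF _ parseval parseval]) (use assms in \<open>auto intro: power_mono\<close>)

text \<open>Dominated convergence on the side of the coefficients: Parseval's identity turns the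
  squared norm into a series, to which Tannery's theorem applies.\<close>

lemma sqn_tendsto_0:
  assumes F: "\<forall>\<^sub>F t in G. F t \<in> L2 M" and G: "G \<noteq> bot"
    and s: "summable m" and le: "\<forall>\<^sub>F t in G. \<forall>j. (cmod (cf (F t) j))\<^sup>2 \<le> m j"
    and lim: "\<And>j. ((\<lambda>t. cf (F t) j) \<longlongrightarrow> 0) G"
  shows "((\<lambda>t. sqn M (F t)) \<longlongrightarrow> 0) G"
proof -
  have "((\<lambda>t. \<Sum>j. (cmod (cf (F t) j))\<^sup>2) \<longlongrightarrow> (\<Sum>j::nat. 0::real)) G"
  proof (rule tannerys_theorem[THEN conjunct2, THEN conjunct2, OF _ _ s G])
    fix j
    have "((\<lambda>t. (cmod (cf (F t) j))\<^sup>2) \<longlongrightarrow> (cmod 0)\<^sup>2) G" by (intro tendsto_intros lim)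
    then show "((\<lambda>t. (cmod (cf (F t) j))\<^sup>2) \<longlongrightarrow> 0) G" by simp
  next
    have "\<forall>\<^sub>F (j, t) in sequentially \<times>\<^sub>F G. True \<and> (\<forall>j. (cmod (cf (F t) j))\<^sup>2 \<le> m j)"
      by (rule eventually_prodI[OF _ le, of "\<lambda>_. True", THEN eventually_mono]) auto
    then show "\<forall>\<^sub>F (j, t) in sequentially \<times>\<^sub>F G. norm ((cmod (cf (F t) j))\<^sup>2) \<le> m j"
      by (rule eventually_mono) auto
  qed
  then have "((\<lambda>t. \<Sum>j. (cmod (cf (F t) j))\<^sup>2) \<longlongrightarrow> 0) G" by simp
  moreover have "\<forall>\<^sub>F t in G. (\<Sum>j. (cmod (cf (F t) j))\<^sup>2) = sqn M (F t)"
    using F by eventually_elim (metis parseval sums_unique)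
  ultimately show ?thesis by (rule Lim_transform_eventually)
qed

lemma eventually_at_right_0_pos: "\<forall>\<^sub>F t::real in at_right 0. t > 0"
  by (simp add: eventually_at_right_less)

lemma L2_quotient: "f \<in> L2 M \<Longrightarrow> g \<in> L2 M \<Longrightarrow> h \<in> L2 M \<Longrightarrow> (\<lambda>x. (f x - g x) / c - h x) \<in> L2 M"
  using L2_lin[OF L2_diff[of f M g] L2_scale[of h M "-1"], of "1 / c"] by simp

lemma cf_quotient: "f \<in> L2 M \<Longrightarrow> g \<in> L2 M \<Longrightarrow> h \<in> L2 M \<Longrightarrow>
  cf (\<lambda>x. (f x - g x) / c - h x) j = (cf f j - cf g j) / c - cf h j"
  using ip_lin[OF L2_diff[of f M g] L2_scale[of h M "-1"] E_L2, of "1 / c" j]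
  by (simp add: ip_diff ip_scale[of h M _ "-1", simplified])

lemma sg_C0_semigroup: "C0_semigroup M sg"
  unfolding C0_semigroup_def
proof (intro conjI ballI allI impI)
  fix t :: real and f g :: "'a \<Rightarrow> complex" and c
  assume t: "0 \<le> t" and f: "f \<in> L2 M"
  show "sg t f \<in> L2 M" by (rule sg_L2[OF t f])
  assume g: "g \<in> L2 M"
  show "AE x in M. sg t (\<lambda>x. c * f x + g x) x = c * sg t f x + sg t g x"
    by (rule cf_eq_imp_AE) (simp_all add: t f g sg_L2 L2_lin cf_sg ip_lin distrib_left mult.left_commute)
next
  fix t :: real assume t: "0 \<le> t"
  have "L2norm M (sg t f) \<le> 1 * L2norm M f" if "f \<in> L2 M" for f
    using lam_nonneg t that
    by (auto simp: L2norm_sqn cf_sg norm_mult sg_L2 intro!: sqn_mono_cf mult_left_le_one_le)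
  then show "\<exists>K. \<forall>f\<in>L2 M. L2norm M (sg t f) \<le> K * L2norm M f" by blast
next
  fix f assume f: "f \<in> L2 M"
  show "AE x in M. sg 0 f x = f x"
    by (rule cf_eq_imp_AE) (auto simp: f sg_L2 cf_sg)
next
  fix s t :: real and f assume "0 \<le> s" "0 \<le> t" "f \<in> L2 M"
  moreover have "exp (- lam j * (s + t)) = exp (- lam j * s) * exp (- lam j * t)" for j
    by (simp add: algebra_simps flip: exp_add)
  ultimately show "AE x in M. sg (s + t) f x = sg s (sg t f) x"
    by (intro cf_eq_imp_AE) (simp_all add: sg_L2 cf_sg del: mult_minus_left)
next
  fix f assume f: "f \<in> L2 M"
  have "((\<lambda>t. sqn M (\<lambda>x. sg t f x - f x)) \<longlongrightarrow> 0) (at_right 0)"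
  proof (rule sqn_tendsto_0[OF _ _ summable_cf[OF f]])
    show "\<forall>\<^sub>F t in at_right 0. (\<lambda>x. sg t f x - f x) \<in> L2 M"
      using eventually_at_right_0_pos by eventually_elim (intro L2_diff sg_L2 f, simp)
    have eq: "cf (\<lambda>x. sg t f x - f x) j = complex_of_real (exp (- lam j * t) - 1) * cf f j" if "t > 0" for t j
      using that by (simp add: ip_diff sg_L2 f cf_sg algebra_simps)
    show "\<forall>\<^sub>F t in at_right 0. \<forall>j. (cmod (cf (\<lambda>x. sg t f x - f x) j))\<^sup>2 \<le> (cmod (cf f j))\<^sup>2"
      using eventually_at_right_0_pos
    proof (eventually_elim, intro allI power_mono)
      fix t :: real and j assume t: "t > 0"
      have "exp (- lam j * t) \<le> 1" using lam_nonneg[of j] t by simp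
      then have "\<bar>exp (- lam j * t) - 1\<bar> \<le> 1" using exp_ge_zero[of "- lam j * t"] by linarith
      then show "cmod (cf (\<lambda>x. sg t f x - f x) j) \<le> cmod (cf f j)"
        unfolding eq[OF t] norm_mult norm_of_real by (intro mult_left_le_one_le) auto
    qed auto
    fix j
    have "((\<lambda>t. complex_of_real (exp (- lam j * t) - 1) * cf f j) \<longlongrightarrow> complex_of_real (exp (- lam j * 0) - 1) * cf f j) (at_right 0)"
      by (intro tendsto_intros)
    then have "((\<lambda>t. complex_of_real (exp (- lam j * t) - 1) * cf f j) \<longlongrightarrow> 0) (at_right 0)" by simp
    then show "((\<lambda>t. cf (\<lambda>x. sg t f x - f x) j) \<longlongrightarrow> 0) (at_right 0)"
      by (rule Lim_transform_eventually)
         (use eventually_at_right_0_pos in \<open>eventually_elim, simp add: eq\<close>)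
  qed simp
  then show "((\<lambda>t. L2norm M (\<lambda>x. sg t f x - f x)) \<longlongrightarrow> 0) (at_right 0)"
    by (simp add: L2norm_tendsto_0_iff)
qed

text \<open>Each coefficient of the difference quotient converges, so a limit in L2 can only have
  the coefficients \<open>- lam j * cf f j\<close>. Conversely,
  \<open>1 - lam j * t <= exp (- lam j * t) <= 1\<close> bounds the error in each coefficient by
  \<open>cmod (cf h j)\<close> uniformly in \<open>t\<close>, and dominated convergence
  applies.\<close>

lemma generator_sg: "generator M sg = diag_graph"
proof (intro set_eqI, clarify)
  fix f h
  show "(f, h) \<in> generator M sg \<longleftrightarrow> (f, h) \<in> diag_graph"
  proof (cases "f \<in> L2 M \<and> h \<in> L2 M")
    case True
    then have f: "f \<in> L2 M" and h: "h \<in> L2 M" by auto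
    define F where "F t = (\<lambda>x. (sg t f x - f x) / complex_of_real t - h x)" for t
    have F_L2: "F t \<in> L2 M" if "t > 0" for t
      unfolding F_def using that f h by (intro L2_quotient sg_L2) auto
    have cfF: "cf (F t) j = complex_of_real ((exp (- lam j * t) - 1) / t) * cf f j - cf h j" if "t > 0" for t j
      unfolding F_def using that f h by (subst cf_quotient) (simp_all add: sg_L2 cf_sg field_simps)
    have lim: "((\<lambda>t. cf (F t) j) \<longlongrightarrow> complex_of_real (- lam j) * cf f j - cf h j) (at_right 0)" for j
    proof (rule Lim_transform_eventually)
      show "((\<lambda>t. complex_of_real ((exp (- lam j * t) - 1) / t) * cf f j - cf h j) \<longlongrightarrow> complex_of_real (- lam j) * cf f j - cf h j) (at_right 0)"
        by (intro tendsto_intros exp_diff_quotient_tendsto)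
      show "\<forall>\<^sub>F t in at_right 0. complex_of_real ((exp (- lam j * t) - 1) / t) * cf f j - cf h j = cf (F t) j"
        using eventually_at_right_0_pos by eventually_elim (simp add: cfF)
    qed
    have "((\<lambda>t. sqn M (F t)) \<longlongrightarrow> 0) (at_right 0) \<longleftrightarrow> (\<forall>j. cf h j = - complex_of_real (lam j) * cf f j)"
    proof
      assume s: "((\<lambda>t. sqn M (F t)) \<longlongrightarrow> 0) (at_right 0)"
      show "\<forall>j. cf h j = - complex_of_real (lam j) * cf f j"
      proof
        fix j
        have "((\<lambda>t. (cmod (cf (F t) j))\<^sup>2) \<longlongrightarrow> 0) (at_right 0)"
          by (rule tendsto_sandwich[OF _ _ tendsto_const s])
             (use eventually_at_right_0_pos in \<open>auto elim!: eventually_mono intro: cf_le F_L2\<close>)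
        moreover have "((\<lambda>t. (cmod (cf (F t) j))\<^sup>2) \<longlongrightarrow> (cmod (complex_of_real (- lam j) * cf f j - cf h j))\<^sup>2) (at_right 0)"
          by (intro tendsto_intros lim)
        ultimately have "(cmod (complex_of_real (- lam j) * cf f j - cf h j))\<^sup>2 = 0"
          by (rule tendsto_unique[OF trivial_limit_at_right_real, symmetric])
        then show "cf h j = - complex_of_real (lam j) * cf f j" by simp
      qed
    next
      assume e: "\<forall>j. cf h j = - complex_of_real (lam j) * cf f j"
      show "((\<lambda>t. sqn M (F t)) \<longlongrightarrow> 0) (at_right 0)"
      proof (rule sqn_tendsto_0[OF _ _ summable_cf[OF h]])
        show "\<forall>\<^sub>F t in at_right 0. F t \<in> L2 M"
          using eventually_at_right_0_pos by eventually_elim (rule F_L2)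
        show "((\<lambda>t. cf (F t) j) \<longlongrightarrow> 0) (at_right 0)" for j using lim[of j] e by simp
        show "\<forall>\<^sub>F t in at_right 0. \<forall>j. (cmod (cf (F t) j))\<^sup>2 \<le> (cmod (cf h j))\<^sup>2"
          using eventually_at_right_0_pos
        proof (eventually_elim, intro allI power_mono)
          fix t :: real and j assume t: "t > 0"
          have "exp (- lam j * t) \<le> 1" using lam_nonneg[of j] t by simp
          moreover have "1 + - lam j * t \<le> exp (- lam j * t)" by (rule exp_ge_add_one_self)
          ultimately have b: "\<bar>(exp (- lam j * t) - 1) / t + lam j\<bar> \<le> lam j"
            using t lam_nonneg[of j] by (simp add: field_simps abs_le_iff)
          have "cf (F t) j = complex_of_real ((exp (- lam j * t) - 1) / t + lam j) * cf f j"
            unfolding cfF[OF t] using e by (simp add: algebra_simps)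
          then have "cmod (cf (F t) j) = \<bar>(exp (- lam j * t) - 1) / t + lam j\<bar> * cmod (cf f j)"
            by (simp only: norm_mult norm_of_real)
          also have "\<dots> \<le> lam j * cmod (cf f j)" by (rule mult_right_mono[OF b]) simp
          also have "\<dots> = cmod (cf h j)" using e lam_nonneg[of j] by (simp add: norm_mult)
          finally show "cmod (cf (F t) j) \<le> cmod (cf h j)" .
        qed auto
      qed simp
    qed
    then show ?thesis using f h by (simp add: generator_def diag_graph_def L2norm_tendsto_0_iff F_def)
  qed (auto simp: generator_def diag_graph_def)
qed

section \<open>Uniqueness of the semigroup with a diagonal generator\<close>

context
  fixes S :: "real \<Rightarrow> ('a \<Rightarrow> complex) \<Rightarrow> ('a \<Rightarrow> complex)"
  assumes C0: "C0_semigroup M S" and gen: "generator M S = diag_graph"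
begin

lemma S_L2: "t \<ge> 0 \<Longrightarrow> f \<in> L2 M \<Longrightarrow> S t f \<in> L2 M"
  using C0 by (auto simp: C0_semigroup_def)

lemma S_lin: "t \<ge> 0 \<Longrightarrow> f \<in> L2 M \<Longrightarrow> g \<in> L2 M \<Longrightarrow> AE x in M. S t (\<lambda>x. c * f x + g x) x = c * S t f x + S t g x"
  using C0 by (auto simp: C0_semigroup_def)

lemma S_add: "s \<ge> 0 \<Longrightarrow> t \<ge> 0 \<Longrightarrow> f \<in> L2 M \<Longrightarrow> AE x in M. S (s + t) f x = S s (S t f) x"
  using C0 by (auto simp: C0_semigroup_def)

lemma S_bound:
  assumes "t \<ge> 0"
  obtains K where "K \<ge> 0" "\<And>f. f \<in> L2 M \<Longrightarrow> sqn M (S t f) \<le> K * sqn M f"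
proof -
  have "\<forall>t\<ge>0. \<exists>K. \<forall>f\<in>L2 M. L2norm M (S t f) \<le> K * L2norm M f"
    using C0 unfolding C0_semigroup_def by (elim conjE)
  then obtain K where K: "\<And>f. f \<in> L2 M \<Longrightarrow> L2norm M (S t f) \<le> K * L2norm M f"
    using assms by blast
  have b: "sqn M (S t f) \<le> K\<^sup>2 * sqn M f" if "f \<in> L2 M" for f
    using power_mono[OF K[OF that], of 2] by (simp add: L2norm_sqn power_mult_distrib)
  show ?thesis by (rule that[OF _ b]) simp_all
qed

lemma cf_S_lin: "t \<ge> 0 \<Longrightarrow> f \<in> L2 M \<Longrightarrow> g \<in> L2 M \<Longrightarrow>
    cf (S t (\<lambda>x. c * f x + g x)) j = c * cf (S t f) j + cf (S t g) j"
  by (subst ip_cong_AE[OF S_lin]) (auto intro: S_L2 L2_lin simp: ip_lin S_L2)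

lemma cf_S_diff: "t \<ge> 0 \<Longrightarrow> f \<in> L2 M \<Longrightarrow> g \<in> L2 M \<Longrightarrow>
    cf (S t (\<lambda>x. f x - g x)) j = cf (S t f) j - cf (S t g) j"
  using cf_S_lin[of t g f "-1" j] by simp

text \<open>Boundedness makes \<open>S t\<close> respect null sets: a function that vanishes almost
  everywhere has norm 0, and so has its image.\<close>

lemma cf_S_cong:
  assumes "t \<ge> 0" "f \<in> L2 M" "g \<in> L2 M" "AE x in M. f x = g x"
  shows "cf (S t f) j = cf (S t g) j"
proof -
  obtain K where K: "\<And>f. f \<in> L2 M \<Longrightarrow> sqn M (S t f) \<le> K * sqn M f" using S_bound[OF assms(1)] by blast
  have d: "(\<lambda>x. f x - g x) \<in> L2 M" using assms by (auto intro: L2_diff)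
  have "sqn M (\<lambda>x. f x - g x) = sqn M (\<lambda>x. 0)"
    by (rule sqn_cong_AE) (use assms d in \<open>auto intro: L2_measurable\<close>)
  then have "sqn M (S t (\<lambda>x. f x - g x)) \<le> 0" using K[OF d] by (simp add: sqn_def)
  then have "(cmod (cf (S t (\<lambda>x. f x - g x)) j))\<^sup>2 \<le> 0"
    by (rule order_trans[OF cf_le[OF S_L2[OF assms(1) d]]])
  then show ?thesis using assms by (simp add: cf_S_diff)
qed

lemma cf_S_comb: "finite F \<Longrightarrow> t \<ge> 0 \<Longrightarrow> cf (S t (comb F a)) j = (\<Sum>i\<in>F. a i * cf (S t (E i)) j)"
proof (induction F rule: finite_induct)
  case empty
  then have "cf (S t (\<lambda>x. 0 - 0)) j = 0" by (subst cf_S_diff) auto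
  then show ?case by (simp add: comb_def)
next
  case (insert i F)
  have "comb (insert i F) a = (\<lambda>x. a i * E i x + comb F a x)"
    using insert by (simp add: comb_def)
  then show ?case using insert by (simp add: cf_S_lin)
qed

lemma E_in_generator: "(E k, \<lambda>x. - complex_of_real (lam k) * E k x) \<in> generator M S"
  unfolding gen diag_graph_def by (auto simp: L2_scale L2_uminus ip_uminus ip_scale E_orth)

text \<open>Each \<open>S t\<close> commutes with the generator, hence preserves its eigenspaces.\<close>

lemma S_E_in_generator:
  assumes t: "t \<ge> 0"
  shows "(S t (E k), \<lambda>x. - complex_of_real (lam k) * S t (E k) x) \<in> generator M S"
proof -
  let ?l = "- complex_of_real (lam k)"
  obtain K where K: "\<And>f. f \<in> L2 M \<Longrightarrow> sqn M (S t f) \<le> K * sqn M f" using S_bound[OF t] by blast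
  define D where "D h = (\<lambda>x. (S h (E k) x - E k x) / complex_of_real h - ?l * E k x)" for h
  have D0: "((\<lambda>h. sqn M (D h)) \<longlongrightarrow> 0) (at_right 0)"
    using E_in_generator[of k] unfolding D_def generator_def by (auto simp: L2norm_tendsto_0_iff)
  have DL: "D h \<in> L2 M" if "h > 0" for h
    unfolding D_def using that by (intro L2_quotient S_L2 L2_scale E_L2) auto
  have SL: "S t (E k) \<in> L2 M" by (rule S_L2[OF t E_L2])
  have "((\<lambda>h. sqn M (\<lambda>x. (S h (S t (E k)) x - S t (E k) x) / complex_of_real h - ?l * S t (E k) x)) \<longlongrightarrow> 0) (at_right 0)"
  proof (rule tendsto_sandwich[OF _ _ tendsto_const])
    show "((\<lambda>h. K * sqn M (D h)) \<longlongrightarrow> 0) (at_right 0)" using tendsto_mult_right_zero[OF D0] .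
    show "\<forall>\<^sub>F h in at_right 0. sqn M (\<lambda>x. (S h (S t (E k)) x - S t (E k) x) / complex_of_real h - ?l * S t (E k) x) \<le> K * sqn M (D h)"
      using eventually_at_right_0_pos
    proof eventually_elim
      case (elim h)
      then have h: "h \<ge> 0" by simp
      have SS: "S h (S t (E k)) \<in> L2 M" by (rule S_L2[OF h SL])
      have Sh: "S h (E k) \<in> L2 M" by (rule S_L2[OF h E_L2])
      have Q: "(\<lambda>x. (S h (S t (E k)) x - S t (E k) x) / complex_of_real h - ?l * S t (E k) x) \<in> L2 M"
        by (intro L2_quotient SS SL L2_scale)
      have "AE x in M. (S h (S t (E k)) x - S t (E k) x) / complex_of_real h - ?l * S t (E k) x = S t (D h) x"
      proof (rule cf_eq_imp_AE[OF Q S_L2[OF t DL[OF elim]]])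
        fix j
        have 1: "cf (S h (S t (E k))) j = cf (S t (S h (E k))) j"
        proof -
          have "cf (S h (S t (E k))) j = cf (S (h + t) (E k)) j"
            by (rule ip_cong_AE[OF AE_symmetric[OF S_add[OF h t E_L2]] SS]) (use h t in \<open>auto intro: S_L2\<close>)
          also have "\<dots> = cf (S (t + h) (E k)) j" by (simp add: add.commute)
          also have "\<dots> = cf (S t (S h (E k))) j"
            by (rule ip_cong_AE[OF S_add[OF t h E_L2]]) (use h t Sh in \<open>auto intro: S_L2\<close>)
          finally show ?thesis .
        qed
        have "D h = (\<lambda>x. (1 / complex_of_real h) * (S h (E k) x - E k x) + (- ?l) * E k x)"
          by (auto simp: D_def fun_eq_iff)
        then have "cf (S t (D h)) j = (1 / complex_of_real h) * cf (S t (\<lambda>x. S h (E k) x - E k x)) j + cf (S t (\<lambda>x. (- ?l) * E k x)) j"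
          by (simp only: cf_S_lin[OF t L2_diff[OF Sh E_L2] L2_scale[OF E_L2]])
        also have "cf (S t (\<lambda>x. (- ?l) * E k x)) j = - ?l * cf (S t (E k)) j"
          using cf_S_comb[OF _ t, of "{k}" "\<lambda>_. - ?l" j] by (simp add: comb_def)
        also have "cf (S t (\<lambda>x. S h (E k) x - E k x)) j = cf (S t (S h (E k))) j - cf (S t (E k)) j"
          by (rule cf_S_diff[OF t Sh E_L2])
        finally show "cf (\<lambda>x. (S h (S t (E k)) x - S t (E k) x) / complex_of_real h - ?l * S t (E k) x) j = cf (S t (D h)) j"
          by (subst cf_quotient[OF SS SL L2_scale[OF SL]], subst ip_scale[OF SL E_L2]) (simp add: 1)
      qed
      then have "sqn M (\<lambda>x. (S h (S t (E k)) x - S t (E k) x) / complex_of_real h - ?l * S t (E k) x) = sqn M (S t (D h))"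
        by (rule sqn_cong_AE) (use Q S_L2[OF t DL[OF elim]] in \<open>auto intro: L2_measurable\<close>)
      also have "\<dots> \<le> K * sqn M (D h)" by (rule K[OF DL[OF elim]])
      finally show ?case .
    qed
  qed auto
  then show ?thesis using SL unfolding generator_def by (auto simp: L2norm_tendsto_0_iff L2_scale L2_uminus)
qed

text \<open>\<open>S t (E k)\<close> is again an eigenvector for \<open>- lam k\<close>, while the
  generator multiplies the \<open>j\<close>-th coefficient by \<open>- lam j\<close>.\<close>

lemma cf_S_E_eq_0:
  assumes "t \<ge> 0" "lam j \<noteq> lam k"
  shows "cf (S t (E k)) j = 0"
proof -
  have "cf (\<lambda>x. - complex_of_real (lam k) * S t (E k) x) j = - complex_of_real (lam j) * cf (S t (E k)) j"
    using S_E_in_generator[OF assms(1), of k] unfolding gen diag_graph_def by blast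
  then have "- complex_of_real (lam k) * cf (S t (E k)) j = - complex_of_real (lam j) * cf (S t (E k)) j"
    by (subst (asm) ip_scale) (auto intro: S_L2 assms)
  then show ?thesis using assms(2) by auto
qed

text \<open>On an eigenspace the factor \<open>exp (l * h)\<close> cancels the generator, so the
  compensated matrix of \<open>S h\<close> is the identity up to \<open>o(h)\<close>. The derivative
  exists because \<open>E i\<close> lies in the domain of the generator.\<close>

lemma cf_S_E_derivative:
  assumes l: "lam i = l"
  shows "((\<lambda>h. (complex_of_real (exp (l * h)) * cf (S h (E i)) j - (if i = j then 1 else 0)) / h) \<longlongrightarrow> 0) (at_right 0)"
proof -
  let ?d = "(if i = j then 1 else 0) :: complex"
  define D where "D h = (\<lambda>x. (S h (E i) x - E i x) / complex_of_real h - (- complex_of_real l) * E i x)" for h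
  have D0: "((\<lambda>h. sqn M (D h)) \<longlongrightarrow> 0) (at_right 0)"
    using E_in_generator[of i] l unfolding D_def generator_def by (auto simp: L2norm_tendsto_0_iff)
  have DL: "D h \<in> L2 M" if "h > 0" for h
    unfolding D_def using that by (intro L2_quotient S_L2 L2_scale E_L2) auto
  have "((\<lambda>h. (cmod (cf (D h) j))\<^sup>2) \<longlongrightarrow> 0) (at_right 0)"
    by (rule tendsto_sandwich[OF _ _ tendsto_const D0])
       (use eventually_at_right_0_pos in \<open>auto elim!: eventually_mono intro: cf_le DL\<close>)
  then have "((\<lambda>h. sqrt ((cmod (cf (D h) j))\<^sup>2)) \<longlongrightarrow> sqrt 0) (at_right 0)" by (rule tendsto_real_sqrt)
  then have c: "((\<lambda>h. cf (D h) j) \<longlongrightarrow> 0) (at_right 0)" by (simp add: tendsto_norm_zero_iff)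
  have "((\<lambda>h. complex_of_real (exp (l * h)) * (cf (D h) j - complex_of_real l * ?d) + complex_of_real ((exp (l * h) - 1) / h) * ?d)
      \<longlongrightarrow> complex_of_real (exp (l * 0)) * (0 - complex_of_real l * ?d) + complex_of_real l * ?d) (at_right 0)"
    by (intro tendsto_intros c exp_diff_quotient_tendsto)
  then have "((\<lambda>h. complex_of_real (exp (l * h)) * (cf (D h) j - complex_of_real l * ?d) + complex_of_real ((exp (l * h) - 1) / h) * ?d)
      \<longlongrightarrow> 0) (at_right 0)" by simp
  then show ?thesis
  proof (rule Lim_transform_eventually)
    show "\<forall>\<^sub>F h in at_right 0. complex_of_real (exp (l * h)) * (cf (D h) j - complex_of_real l * ?d) + complex_of_real ((exp (l * h) - 1) / h) * ?d
      = (complex_of_real (exp (l * h)) * cf (S h (E i)) j - ?d) / h"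
      using eventually_at_right_0_pos
    proof eventually_elim
      case (elim h)
      have "cf (D h) j = (cf (S h (E i)) j - ?d) / h - (- complex_of_real l) * ?d"
        unfolding D_def using elim
        by (subst cf_quotient) (auto simp: S_L2 L2_scale L2_uminus ip_uminus E_orth ip_scale)
      then have "cf (S h (E i)) j = ?d + complex_of_real h * (cf (D h) j - complex_of_real l * ?d)"
        using elim by (simp add: field_simps)
      then have A: "cf (S h (E i)) j = dd + complex_of_real h * (cf (D h) j - complex_of_real l * dd)" if "dd = ?d" for dd
        unfolding that .
      have "complex_of_real (exp (l * h)) * (cf (D h) j - complex_of_real l * dd) + complex_of_real ((exp (l * h) - 1) / h) * dd
        = (complex_of_real (exp (l * h)) * cf (S h (E i)) j - dd) / h" if "dd = ?d" for dd
        unfolding A[OF that] using elim by (simp add: field_simps)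
      from this[OF refl] show ?case .
    qed
  qed
qed

text \<open>On the finite-dimensional eigenspaces, \<open>S t = (S (t/n))\<^sup>n\<close> is evaluated as \<open>n\<close> tends to
  infinity. This avoids uniform bounds for \<open>S t\<close> on the whole space.\<close>

lemma cf_S_E:
  assumes t: "t \<ge> 0"
  shows "cf (S t (E k)) j = (if j = k then complex_of_real (exp (- lam k * t)) else 0)"
proof (cases "t = 0")
  case True
  have "AE x in M. S 0 (E k) x = E k x" using C0 by (auto simp: C0_semigroup_def)
  then have "cf (S 0 (E k)) j = cf (E k) j" by (rule ip_cong_AE) (auto intro: S_L2)
  then show ?thesis using True by (auto simp: E_orth)
next
  case False
  with t have t: "t > 0" by simp
  define l where "l = lam k"
  define J where "J = {j. lam j = l}"
  have finJ: "finite J" unfolding J_def l_def by (rule finite_lam)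
  have kJ: "k \<in> J" by (simp add: J_def l_def)
  \<comment> \<open>\<open>m h\<close> is the compensated matrix of \<open>S h\<close> on the
    eigenspace, and \<open>b h n\<close> is row \<open>k\<close> of its \<open>n\<close>-th power by
    the semigroup law; both are compared with the identity matrix \<open>d\<close>.\<close>
  define m where "m h i j = complex_of_real (exp (l * h)) * cf (S h (E i)) j" for h i j
  define d where "d i j = (if i = j then 1 else 0 :: complex)" for i j :: nat
  define b where "b h n j = complex_of_real (exp (l * (real n * h))) * cf (S (real n * h) (E k)) j" for h n j
  define c where "c = real (card J)"
  have rec: "b h (Suc n) j = (\<Sum>i\<in>J. b h n i * m h i j)" if h: "h > 0" for h n j
  proof -
    let ?s = "real n * h"
    have s: "?s \<ge> 0" using h by simp
    have h0: "h \<ge> 0" using h by simp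
    have "AE x in M. S ?s (E k) x = comb J (cf (S ?s (E k))) x"
    proof (rule cf_eq_imp_AE[OF S_L2[OF s E_L2] comb_L2])
      fix j show "cf (S ?s (E k)) j = cf (comb J (cf (S ?s (E k)))) j"
        using cf_S_E_eq_0[OF s, of j k] by (cases "j \<in> J") (auto simp: cf_comb[OF finJ], auto simp: J_def l_def)
    qed
    from cf_S_cong[OF h0 S_L2[OF s E_L2] comb_L2 this]
    have "cf (S h (S ?s (E k))) j = (\<Sum>i\<in>J. cf (S ?s (E k)) i * cf (S h (E i)) j)"
      by (simp add: cf_S_comb[OF finJ h0])
    moreover have "cf (S (h + ?s) (E k)) j = cf (S h (S ?s (E k))) j"
      by (rule ip_cong_AE[OF S_add[OF h0 s E_L2]]) (use h0 s in \<open>auto intro!: S_L2\<close>)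
    ultimately have "b h (Suc n) j = complex_of_real (exp (l * (h + ?s))) * (\<Sum>i\<in>J. cf (S ?s (E k)) i * cf (S h (E i)) j)"
      by (simp add: b_def algebra_simps)
    also have "\<dots> = (\<Sum>i\<in>J. b h n i * m h i j)"
      by (simp add: sum_distrib_left b_def m_def distrib_left exp_add mult_ac)
    finally show ?thesis .
  qed
  \<comment> \<open>If each entry of one step differs from the identity by at most
    \<open>e * h\<close>, then one plus the error in the 1-norm grows at most by the factor
    \<open>1 + c * (e * h)\<close> per step; \<open>c\<close> is the size of the matrix.\<close>
  have est: "cmod (b h n j - d k j) \<le> (1 + c * (e * h)) ^ n - 1"
    if h: "h > 0" and e: "e > 0" and md: "\<And>i j. i \<in> J \<Longrightarrow> j \<in> J \<Longrightarrow> cmod (m h i j - d i j) \<le> e * h"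
      and j: "j \<in> J" for h e n j
  proof -
    define q where "q = c * (e * h)"
    have q0: "q \<ge> 0" using h e by (simp add: q_def c_def)
    have "(\<Sum>j\<in>J. cmod (b h n j - d k j)) \<le> (1 + q) ^ n - 1"
    proof (induction n)
      case 0
      have "AE x in M. S 0 (E k) x = E k x" using C0 by (auto simp: C0_semigroup_def)
      then have "cf (S 0 (E k)) j = cf (E k) j" for j by (rule ip_cong_AE) (auto intro: S_L2)
      then show ?case by (simp add: b_def d_def E_orth)
    next
      case (Suc n)
      have "cmod (b h (Suc n) j - b h n j) \<le> (\<Sum>i\<in>J. cmod (b h n i) * (e * h))" if j: "j \<in> J" for j
      proof -
        have "(\<Sum>i\<in>J. b h n i * d i j) = (\<Sum>i\<in>J. if i = j then b h n i else 0)"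
          by (rule sum.cong) (auto simp: d_def)
        also have "\<dots> = b h n j" using finJ j by simp
        finally have "b h (Suc n) j - b h n j = (\<Sum>i\<in>J. b h n i * (m h i j - d i j))"
          by (simp add: rec[OF h] sum_subtractf algebra_simps)
        also have "cmod \<dots> \<le> (\<Sum>i\<in>J. cmod (b h n i * (m h i j - d i j)))" by (rule norm_sum)
        also have "\<dots> \<le> (\<Sum>i\<in>J. cmod (b h n i) * (e * h))"
          by (intro sum_mono) (simp only: norm_mult, intro mult_left_mono md j norm_ge_zero)
        finally show ?thesis .
      qed
      then have "(\<Sum>j\<in>J. cmod (b h (Suc n) j - b h n j)) \<le> (\<Sum>j\<in>J. \<Sum>i\<in>J. cmod (b h n i) * (e * h))"
        by (rule sum_mono)
      also have "\<dots> = q * (\<Sum>i\<in>J. cmod (b h n i))"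
        by (simp add: q_def c_def sum_distrib_left sum_distrib_right mult_ac)
      also have "(\<Sum>i\<in>J. cmod (b h n i)) \<le> (\<Sum>i\<in>J. cmod (b h n i - d k i) + cmod (d k i))"
        by (intro sum_mono) (metis norm_triangle_sub add.commute)
      also have "\<dots> = (\<Sum>i\<in>J. cmod (b h n i - d k i)) + 1"
      proof -
        have "(\<Sum>i\<in>J. cmod (d k i)) = (\<Sum>i\<in>J. if k = i then 1 else 0)"
          by (rule sum.cong) (auto simp: d_def)
        also have "\<dots> = 1" using finJ kJ by simp
        finally show ?thesis by (simp add: sum.distrib)
      qed
      also have "\<dots> \<le> (1 + q) ^ n" using Suc by simp
      finally have 1: "(\<Sum>j\<in>J. cmod (b h (Suc n) j - b h n j)) \<le> q * (1 + q) ^ n"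
        using q0 by (simp add: mult_left_mono)
      have "(\<Sum>j\<in>J. cmod (b h (Suc n) j - d k j)) \<le> (\<Sum>j\<in>J. cmod (b h (Suc n) j - b h n j) + cmod (b h n j - d k j))"
        by (intro sum_mono) (metis norm_triangle_ineq diff_add_cancel add_diff_eq)
      also have "\<dots> \<le> q * (1 + q) ^ n + ((1 + q) ^ n - 1)"
        unfolding sum.distrib by (intro add_mono 1 Suc)
      finally show ?case by (simp add: algebra_simps)
    qed
    moreover have "cmod (b h n j - d k j) \<le> (\<Sum>j\<in>J. cmod (b h n j - d k j))"
      by (rule member_le_sum) (use finJ j in auto)
    ultimately show ?thesis by (simp add: q_def)
  qed
  have small: "\<forall>\<^sub>F h in at_right 0. \<forall>i\<in>J. \<forall>j\<in>J. cmod (m h i j - d i j) \<le> e * h" if e: "e > 0" for e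
  proof (intro eventually_ball_finite finJ ballI)
    fix i j assume "i \<in> J" "j \<in> J"
    then have "lam i = l" by (simp add: J_def)
    from cf_S_E_derivative[OF this] have "((\<lambda>h. (m h i j - d i j) / h) \<longlongrightarrow> 0) (at_right 0)"
      unfolding m_def d_def .
    then have "\<forall>\<^sub>F h in at_right 0. dist ((m h i j - d i j) / complex_of_real h) 0 < e" using e by (rule tendstoD)
    then show "\<forall>\<^sub>F h in at_right 0. cmod (m h i j - d i j) \<le> e * h"
      using eventually_at_right_0_pos by eventually_elim (simp add: norm_divide field_simps)
  qed
  \<comment> \<open>For large \<open>n\<close> the step \<open>t / n\<close> is so small that every
    entry of \<open>m\<close> is within \<open>e * h\<close> of the identity. The resulting bound no
    longer contains \<open>n\<close>, so \<open>e\<close> can be sent to 0 afterwards.\<close>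
  have main: "cmod (complex_of_real (exp (l * t)) * cf (S t (E k)) j - d k j) \<le> exp (c * e * t) - 1" if j: "j \<in> J" and e: "e > 0" for j e
  proof -
    obtain \<delta> where \<delta>: "\<delta> > 0" "\<And>h. 0 < h \<Longrightarrow> h < \<delta> \<Longrightarrow> \<forall>i\<in>J. \<forall>j\<in>J. cmod (m h i j - d i j) \<le> e * h"
      using small[OF e] unfolding eventually_at_right[OF zero_less_one] by blast
    obtain n :: nat where n: "t / \<delta> < n" using reals_Archimedean2 by blast
    moreover have "t / \<delta> > 0" using t \<delta>(1) by simp
    ultimately have n0: "real n > 0" by linarith
    define h where "h = t / n"
    have h: "h > 0" "h < \<delta>" using t n n0 \<delta>(1) by (auto simp: h_def field_simps)
    have nh: "real n * h = t" using n0 by (simp add: h_def)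
    have "cmod (b h n j - d k j) \<le> (1 + c * (e * h)) ^ n - 1"
      by (rule est[OF h(1) e _ j]) (use \<delta>(2)[OF h] in blast)
    also have "(1 + c * (e * h)) ^ n \<le> exp (c * (e * h)) ^ n"
      using h e by (intro power_mono exp_ge_add_one_self) (auto simp: c_def)
    also have "\<dots> = exp (c * e * t)" using nh by (simp flip: exp_of_nat_mult add: mult_ac)
    finally show ?thesis unfolding b_def nh by simp
  qed
  have eq: "complex_of_real (exp (l * t)) * cf (S t (E k)) j = d k j" if j: "j \<in> J"
  proof -
    have "((\<lambda>e. exp (c * e * t) - 1) \<longlongrightarrow> exp (c * 0 * t) - 1) (at_right 0)"
      by (intro tendsto_intros)
    then have "((\<lambda>e. exp (c * e * t) - 1) \<longlongrightarrow> 0) (at_right 0)" by simp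
    moreover have "\<forall>\<^sub>F e in at_right 0. cmod (complex_of_real (exp (l * t)) * cf (S t (E k)) j - d k j) \<le> exp (c * e * t) - 1"
      using eventually_at_right_0_pos by eventually_elim (rule main[OF j])
    ultimately have "cmod (complex_of_real (exp (l * t)) * cf (S t (E k)) j - d k j) \<le> 0"
      by (intro tendsto_lowerbound) auto
    then show ?thesis by simp
  qed
  show ?thesis
  proof (cases "j \<in> J")
    case True
    have "cf (S t (E k)) j = complex_of_real (exp (- l * t)) * (complex_of_real (exp (l * t)) * cf (S t (E k)) j)"
      by (simp add: exp_minus)
    then show ?thesis unfolding eq[OF True] by (auto simp: d_def l_def exp_of_real)
  next
    case False
    then show ?thesis using cf_S_E_eq_0[of t j k] t kJ by (auto simp: J_def l_def)
  qed
qed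

text \<open>Extension from the basis by density: the partial sums of \<open>f\<close> converge to
  \<open>f\<close>, and boundedness of \<open>S t\<close> carries the convergence over to their
  images.\<close>

lemma cf_semigroup:
  assumes t: "t \<ge> 0" and f: "f \<in> L2 M"
  shows "cf (S t f) j = complex_of_real (exp (- lam j * t)) * cf f j"
proof -
  obtain K where K: "\<And>f. f \<in> L2 M \<Longrightarrow> sqn M (S t f) \<le> K * sqn M f" using S_bound[OF t] by blast
  have d: "(\<lambda>x. f x - comb {..<N} (cf f) x) \<in> L2 M" for N using f by (intro L2_diff) auto
  have "(\<lambda>N. (cmod (cf (S t f) j - complex_of_real (exp (- lam j * t)) * cf f j))\<^sup>2) \<longlonglongrightarrow> 0"
  proof (rule tendsto_sandwich[OF _ _ tendsto_const])
    show "(\<lambda>N. K * sqn M (\<lambda>x. f x - comb {..<N} (cf f) x)) \<longlonglongrightarrow> 0"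
      using tendsto_mult_right_zero[OF sqn_minus_comb_tendsto[OF f]] .
    show "\<forall>\<^sub>F N in sequentially. (cmod (cf (S t f) j - complex_of_real (exp (- lam j * t)) * cf f j))\<^sup>2 \<le> K * sqn M (\<lambda>x. f x - comb {..<N} (cf f) x)"
      using eventually_ge_at_top[of "Suc j"]
    proof eventually_elim
      case (elim N)
      have "cf (S t (comb {..<N} (cf f))) j = (\<Sum>i<N. if i = j then cf f i * complex_of_real (exp (- lam i * t)) else 0)"
        unfolding cf_S_comb[OF finite_lessThan t] by (rule sum.cong) (auto simp: cf_S_E[OF t])
      also have "\<dots> = complex_of_real (exp (- lam j * t)) * cf f j" using elim by simp
      finally have "cf (S t (\<lambda>x. f x - comb {..<N} (cf f) x)) j = cf (S t f) j - complex_of_real (exp (- lam j * t)) * cf f j"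
        by (simp add: cf_S_diff[OF t f])
      with cf_le[OF S_L2[OF t d], of N j] K[OF d, of N] show ?case by simp
    qed
  qed auto
  then show ?thesis by (simp add: LIMSEQ_const_iff)
qed

end

text \<open>Existence, witnessed by \<open>sg\<close>, ensures that the choice in
  \<open>exp_semigroup\<close> has the required properties; uniqueness of the coefficients then
  makes it irrelevant which semigroup was chosen.\<close>

lemma exp_semigroup_diag:
  assumes "t \<ge> 0" "f \<in> L2 M"
  shows "exp_semigroup M diag_graph t f \<in> L2 M"
    and "cf (exp_semigroup M diag_graph t f) j = complex_of_real (exp (- lam j * t)) * cf f j"
proof -
  have "C0_semigroup M sg \<and> generator M sg = diag_graph" by (simp add: sg_C0_semigroup generator_sg)
  then have *: "C0_semigroup M (exp_semigroup M diag_graph)" "generator M (exp_semigroup M diag_graph) = diag_graph"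
    unfolding exp_semigroup_def
    using someI[of "\<lambda>S. C0_semigroup M S \<and> generator M S = diag_graph" sg] by auto
  show "exp_semigroup M diag_graph t f \<in> L2 M"
    using *(1) assms by (auto simp: C0_semigroup_def)
  show "cf (exp_semigroup M diag_graph t f) j = complex_of_real (exp (- lam j * t)) * cf f j"
    by (rule cf_semigroup[OF * assms])
qed

end

section \<open>Integration by parts on the sphere\<close>

lemma Ck_on_cong:
  assumes U: "open U" and "\<And>x. x \<in> U \<Longrightarrow> f x = g x"
  shows "Ck_on k U f \<longleftrightarrow> Ck_on k U g"
proof -
  have "Ck_on k U f \<Longrightarrow> (\<And>x. x \<in> U \<Longrightarrow> f x = g x) \<Longrightarrow> Ck_on k U g" for f g
  proof (induction k arbitrary: f g)
    case 0
    then show ?case by (auto cong: continuous_on_cong)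
  next
    case (Suc k)
    have d: "f differentiable at x" if "x \<in> U" for x
      using Suc.prems(1) that by (auto simp: differentiable_on_eq_differentiable_at[OF U])
    have fd: "frechet_derivative f (at x) = frechet_derivative g (at x)" if "x \<in> U" for x
      by (rule frechet_derivative_transform_within_open[OF d[OF that] U that Suc.prems(2)])
    have "g differentiable_on U"
      unfolding differentiable_on_eq_differentiable_at[OF U]
    proof
      fix x assume x: "x \<in> U"
      have "(f has_derivative frechet_derivative f (at x)) (at x)"
        using d[OF x] by (rule frechet_derivative_works[THEN iffD1])
      then have "(g has_derivative frechet_derivative f (at x)) (at x)"
        by (rule has_derivative_transform_within_open[OF _ U x]) (use Suc.prems in auto)
      then show "g differentiable at x" by (rule differentiableI)
    qed
    moreover have "Ck_on k U (\<lambda>x. frechet_derivative g (at x) v)" for v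
      by (rule Suc.IH[of "\<lambda>x. frechet_derivative f (at x) v"]) (use Suc.prems fd in auto)
    ultimately show ?case by simp
  qed
  from this[of f g] this[of g f] assms(2) show ?thesis by auto
qed

lemma Ck_on_subset: "Ck_on k U f \<Longrightarrow> V \<subseteq> U \<Longrightarrow> Ck_on k V f"
  by (induction k arbitrary: f) (auto intro: continuous_on_subset differentiable_on_subset)

lemma Ck_on_const [simp]: "Ck_on k U (\<lambda>x. c)"
  by (induction k arbitrary: c) auto

lemma Ck_on_bounded_linear:
  assumes "bounded_linear f" shows "Ck_on k U f"
proof (cases k)
  case 0
  then show ?thesis using assms by (simp add: linear_continuous_on)
next
  case (Suc l)
  have "(f has_derivative f) (at x)" for x by (rule bounded_linear_imp_has_derivative[OF assms])
  then have "frechet_derivative f (at x) = f" for x by (metis frechet_derivative_at)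
  then show ?thesis using Suc assms by (simp add: bounded_linear_imp_differentiable_on)
qed

lemma Ck_on_add:
  assumes U: "open U"
  shows "Ck_on k U f \<Longrightarrow> Ck_on k U g \<Longrightarrow> Ck_on k U (\<lambda>x. f x + g x)"
proof (induction k arbitrary: f g)
  case 0
  then show ?case by (auto intro: continuous_on_add)
next
  case (Suc k)
  have fd: "frechet_derivative (\<lambda>x. f x + g x) (at x) = (\<lambda>v. frechet_derivative f (at x) v + frechet_derivative g (at x) v)"
    if "x \<in> U" for x
    by (rule frechet_derivative_at[symmetric], rule has_derivative_add)
       (use Suc.prems U that in \<open>auto simp: differentiable_on_eq_differentiable_at frechet_derivative_works[THEN iffD1]\<close>)
  have "Ck_on k U (\<lambda>x. frechet_derivative f (at x) v + frechet_derivative g (at x) v)" for v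
    by (rule Suc.IH) (use Suc.prems in auto)
  then have "Ck_on k U (\<lambda>x. frechet_derivative (\<lambda>x. f x + g x) (at x) v)" for v
    by (subst Ck_on_cong[OF U, of _ "\<lambda>x. frechet_derivative f (at x) v + frechet_derivative g (at x) v"]) (simp_all add: fd)
  then show ?case using Suc.prems by (auto intro: differentiable_on_add)
qed

text \<open>Differentiability of all orders is assumed of both factors: the derivative of a product
  again contains \<open>f\<close> and \<open>g\<close> themselves, and the induction multiplies them
  with derivatives.\<close>

lemma Ck_on_mult:
  fixes f g :: "'a::real_normed_vector \<Rightarrow> 'b::real_normed_algebra"
  assumes U: "open U"
  shows "(\<And>k. Ck_on k U f) \<Longrightarrow> (\<And>k. Ck_on k U g) \<Longrightarrow> Ck_on k U (\<lambda>x. f x * g x)"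
proof (induction k arbitrary: f g)
  case 0
  have "continuous_on U f" "continuous_on U g" using 0(1)[of 0] 0(2)[of 0] by auto
  then show ?case by (auto intro: continuous_on_mult)
next
  case (Suc k)
  have df: "f differentiable_on U" "g differentiable_on U"
    using Suc.prems(1)[of 1] Suc.prems(2)[of 1] by auto
  have sm: "Ck_on k U (\<lambda>x. frechet_derivative f (at x) v)" "Ck_on k U (\<lambda>x. frechet_derivative g (at x) v)" for k v
    using Suc.prems(1)[of "Suc k"] Suc.prems(2)[of "Suc k"] by auto
  have fd: "frechet_derivative (\<lambda>x. f x * g x) (at x) = (\<lambda>v. f x * frechet_derivative g (at x) v + frechet_derivative f (at x) v * g x)"
    if "x \<in> U" for x
    by (rule frechet_derivative_at[symmetric], rule has_derivative_mult)
       (use df U that in \<open>auto simp: differentiable_on_eq_differentiable_at frechet_derivative_works[THEN iffD1]\<close>)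
  have "Ck_on k U (\<lambda>x. f x * frechet_derivative g (at x) v + frechet_derivative f (at x) v * g x)" for v
    by (intro Ck_on_add[OF U] Suc.IH Suc.prems sm)
  then have "Ck_on k U (\<lambda>x. frechet_derivative (\<lambda>x. f x * g x) (at x) v)" for v
    by (subst Ck_on_cong[OF U, of _ "\<lambda>x. f x * frechet_derivative g (at x) v + frechet_derivative f (at x) v * g x"]) (simp_all add: fd)
  then show ?case using df by (auto intro: differentiable_on_mult)
qed

lemma smooth_bounded_linear: "bounded_linear f \<Longrightarrow> f \<in> sphere_smooth"
  unfolding sphere_smooth_def using Ck_on_bounded_linear[of f _ UNIV] by (auto intro!: exI[of _ UNIV])

lemma smooth_const [simp]: "(\<lambda>p. c) \<in> sphere_smooth"
  unfolding sphere_smooth_def by (auto intro!: exI[of _ UNIV])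

lemma smooth_common_domain:
  assumes "f \<in> sphere_smooth" "g \<in> sphere_smooth"
  shows "\<exists>U. open U \<and> sphere 0 1 \<subseteq> U \<and> (\<forall>k. Ck_on k U f) \<and> (\<forall>k. Ck_on k U g)"
proof -
  obtain U V where "open U" "sphere 0 1 \<subseteq> U" "\<forall>k. Ck_on k U f" "open V" "sphere 0 1 \<subseteq> V" "\<forall>k. Ck_on k V g"
    using assms unfolding sphere_smooth_def by blast
  then show ?thesis by (intro exI[of _ "U \<inter> V"]) (meson Ck_on_subset Int_lower1 Int_lower2 open_Int le_inf_iff)
qed

lemma smooth_add:
  assumes "f \<in> sphere_smooth" "g \<in> sphere_smooth"
  shows "(\<lambda>p. f p + g p) \<in> sphere_smooth"
proof -
  obtain U where "open U" "sphere 0 1 \<subseteq> U" "\<And>k. Ck_on k U f" "\<And>k. Ck_on k U g"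
    using smooth_common_domain[OF assms] by blast
  then show ?thesis unfolding sphere_smooth_def by (blast intro: Ck_on_add)
qed

lemma smooth_mult:
  assumes "f \<in> sphere_smooth" "g \<in> sphere_smooth"
  shows "(\<lambda>p. f p * g p) \<in> sphere_smooth"
proof -
  obtain U where "open U" "sphere 0 1 \<subseteq> U" "\<And>k. Ck_on k U f" "\<And>k. Ck_on k U g"
    using smooth_common_domain[OF assms] by blast
  then show ?thesis unfolding sphere_smooth_def by (blast intro: Ck_on_mult)
qed

lemma smooth_uminus: "f \<in> sphere_smooth \<Longrightarrow> (\<lambda>p. - f p) \<in> sphere_smooth"
  using smooth_mult[OF smooth_const[of "-1"]] by simp

lemma bounded_linear_coordinate: "bounded_linear (\<lambda>p::real^3. complex_of_real (p $ i))"
  using bounded_linear_compose[OF bounded_linear_of_real bounded_linear_vec_nth] .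

lemma smooth_coordinate: "(\<lambda>p. complex_of_real (p $ i)) \<in> sphere_smooth"
  by (rule smooth_bounded_linear[OF bounded_linear_coordinate])

lemma smooth_coordinate_scaleR: "f \<in> sphere_smooth \<Longrightarrow> (\<lambda>p. (p $ i) *\<^sub>R f p) \<in> sphere_smooth"
  unfolding scaleR_conv_of_real by (intro smooth_mult smooth_coordinate)

lemma smooth_partial: "f \<in> sphere_smooth \<Longrightarrow> partial i f \<in> sphere_smooth"
  unfolding sphere_smooth_def partial_def using Ck_on.simps(2) by blast

lemma smooth_X_field: "f \<in> sphere_smooth \<Longrightarrow> X_field f \<in> sphere_smooth"
  unfolding X_field_def scaleR_minus_left
  by (intro smooth_add smooth_uminus smooth_coordinate_scaleR smooth_partial)

lemma smooth_Y_field: "f \<in> sphere_smooth \<Longrightarrow> Y_field f \<in> sphere_smooth"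
  unfolding Y_field_def scaleR_minus_left
  by (intro smooth_add smooth_uminus smooth_coordinate_scaleR smooth_partial)

lemma smooth_differentiable: "f \<in> sphere_smooth \<Longrightarrow> p \<in> sphere 0 1 \<Longrightarrow> f differentiable (at p)"
proof -
  assume "f \<in> sphere_smooth" "p \<in> sphere 0 1"
  then obtain U where "open U" "p \<in> U" "Ck_on (Suc 0) U f" unfolding sphere_smooth_def by blast
  then show ?thesis by (auto simp: differentiable_on_eq_differentiable_at)
qed

lemma smooth_continuous_on: "f \<in> sphere_smooth \<Longrightarrow> continuous_on (sphere 0 1) f"
proof -
  assume "f \<in> sphere_smooth"
  then obtain U where "sphere 0 1 \<subseteq> U" "Ck_on 0 U f" unfolding sphere_smooth_def by blast
  then show ?thesis by (auto intro: continuous_on_subset)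
qed

section \<open>The rotation fields in spherical coordinates\<close>

lemma Phi_nth [simp]:
  "Phi (x, y) $ 1 = cos x * cos y" "Phi (x, y) $ 2 = cos x * sin y" "Phi (x, y) $ 3 = sin x"
  by (simp_all add: Phi_def vector_3)

lemma Phi_sphere: "Phi q \<in> sphere 0 1"
proof (cases q)
  case (Pair x y)
  have "(norm (Phi q))\<^sup>2 = (cos x * cos y)\<^sup>2 + (cos x * sin y)\<^sup>2 + (sin x)\<^sup>2"
    unfolding power2_norm_eq_inner Pair
    by (simp add: inner_vec_def sum_3 power2_eq_square)
  also have "\<dots> = (cos x)\<^sup>2 * ((cos y)\<^sup>2 + (sin y)\<^sup>2) + (sin x)\<^sup>2"
    by (simp only: power_mult_distrib distrib_left)
  finally have "(norm (Phi q))\<^sup>2 = (cos x)\<^sup>2 * ((cos y)\<^sup>2 + (sin y)\<^sup>2) + (sin x)\<^sup>2" .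
  then have "(norm (Phi q))\<^sup>2 = 1" by simp
  then show ?thesis using norm_ge_zero[of "Phi q"] by (simp add: power2_eq_1_iff)
qed

lemma continuous_Phi: "continuous_on A Phi"
  by (rule continuous_at_imp_continuous_on, clarify) (rule has_derivative_continuous[OF Phi_has_derivative])

lemma continuous_smooth_Phi: "f \<in> sphere_smooth \<Longrightarrow> continuous_on A (\<lambda>q. f (Phi q))"
  by (rule continuous_on_compose2[OF smooth_continuous_on continuous_Phi]) (use Phi_sphere in auto)

lemma frechet_derivative_partial:
  fixes f :: "real^3 \<Rightarrow> complex"
  assumes "f differentiable (at p)"
  shows "frechet_derivative f (at p) h = (h $ 1) *\<^sub>R partial 1 f p + (h $ 2) *\<^sub>R partial 2 f p + (h $ 3) *\<^sub>R partial 3 f p"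
proof -
  interpret linear "frechet_derivative f (at p)" by (rule linear_frechet_derivative[OF assms])
  have "h = (\<Sum>i\<in>UNIV. (h $ i) *\<^sub>R axis i 1)" by (simp add: basis_expansion scalar_mult_eq_scaleR[symmetric])
  then have "frechet_derivative f (at p) h = frechet_derivative f (at p) (\<Sum>i\<in>UNIV. (h $ i) *\<^sub>R axis i 1)" by simp
  also have "\<dots> = (\<Sum>i\<in>UNIV. (h $ i) *\<^sub>R frechet_derivative f (at p) (axis i 1))" by (simp add: sum scale)
  finally show ?thesis by (simp add: sum_3 partial_def)
qed

text \<open>The chain rule's expression for the \<open>x\<close>-derivative of \<open>f\<close>
  composed with \<open>Phi\<close>.\<close>

definition Phi_dx :: "(real^3 \<Rightarrow> complex) \<Rightarrow> real \<times> real \<Rightarrow> complex" where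
  "Phi_dx f = (\<lambda>(x, y). (- sin x * cos y) *\<^sub>R partial 1 f (Phi (x, y)) + (- sin x * sin y) *\<^sub>R partial 2 f (Phi (x, y))
     + cos x *\<^sub>R partial 3 f (Phi (x, y)))"

definition Phi_dy :: "(real^3 \<Rightarrow> complex) \<Rightarrow> real \<times> real \<Rightarrow> complex" where
  "Phi_dy f = (\<lambda>(x, y). (- cos x * sin y) *\<^sub>R partial 1 f (Phi (x, y)) + (cos x * cos y) *\<^sub>R partial 2 f (Phi (x, y)))"

lemma smooth_Phi_has_derivative:
  assumes "f \<in> sphere_smooth"
  shows "((\<lambda>q. f (Phi q)) has_derivative (\<lambda>(h, k). h *\<^sub>R Phi_dx f (x, y) + k *\<^sub>R Phi_dy f (x, y))) (at (x, y))"
proof -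
  have d: "f differentiable (at (Phi (x, y)))" by (rule smooth_differentiable[OF assms Phi_sphere])
  then have "(f has_derivative frechet_derivative f (at (Phi (x, y)))) (at (Phi (x, y)))"
    by (rule frechet_derivative_works[THEN iffD1])
  from has_derivative_compose[OF Phi_has_derivative this]
  show ?thesis
    by (rule has_derivative_eq_rhs)
       (auto simp: fun_eq_iff frechet_derivative_partial[OF d] Phi_dx_def Phi_dy_def vector_3 algebra_simps)
qed

lemma smooth_Phi_dx:
  assumes "f \<in> sphere_smooth"
  shows "((\<lambda>x. f (Phi (x, y))) has_vector_derivative Phi_dx f (x, y)) (at x within A)"
proof -
  have "((\<lambda>x. (x, y)) has_derivative (\<lambda>h. (h, 0))) (at x within A)" by (auto intro!: derivative_eq_intros)
  from has_derivative_compose[OF this smooth_Phi_has_derivative[OF assms]]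
  show ?thesis by (simp add: has_vector_derivative_def)
qed

lemma smooth_Phi_dy:
  assumes "f \<in> sphere_smooth"
  shows "((\<lambda>y. f (Phi (x, y))) has_vector_derivative Phi_dy f (x, y)) (at y within A)"
proof -
  have "((\<lambda>y. (x, y)) has_derivative (\<lambda>h. (0, h))) (at y within A)" by (auto intro!: derivative_eq_intros)
  from has_derivative_compose[OF this smooth_Phi_has_derivative[OF assms]]
  show ?thesis by (simp add: has_vector_derivative_def)
qed

lemma continuous_Phi_dx: "f \<in> sphere_smooth \<Longrightarrow> continuous_on A (Phi_dx f)"
  and continuous_Phi_dy: "f \<in> sphere_smooth \<Longrightarrow> continuous_on A (Phi_dy f)"
  unfolding Phi_dx_def Phi_dy_def case_prod_unfold prod.collapse
  by (intro continuous_intros continuous_smooth_Phi smooth_partial; assumption)+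

text \<open>With \<open>A = a * sin y + b * cos y\<close> the field is
  \<open>A d/dx - tan x * A' d/dy\<close>, an infinitesimal rotation about a horizontal axis. The
  factor \<open>cos x\<close> clears \<open>tan x\<close>, so that the identity makes sense for all
  \<open>x\<close>, including the poles. The two parameters treat \<open>X_field\<close> and
  \<open>Y_field\<close> at once.\<close>

definition rotation_field :: "((real^3 \<Rightarrow> complex) \<Rightarrow> (real^3 \<Rightarrow> complex)) \<Rightarrow> real \<Rightarrow> real \<Rightarrow> bool" where
  "rotation_field P a b \<longleftrightarrow> (\<forall>f\<in>sphere_smooth. P f \<in> sphere_smooth \<and> (\<forall>x y.
     cos x *\<^sub>R P f (Phi (x, y)) = (cos x * (a * sin y + b * cos y)) *\<^sub>R Phi_dx f (x, y)
       - (sin x * (a * cos y - b * sin y)) *\<^sub>R Phi_dy f (x, y)))"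

lemma rotation_field_X: "rotation_field X_field 1 0"
proof -
  have "cos x *\<^sub>R X_field f (Phi (x, y)) = (cos x * sin y) *\<^sub>R Phi_dx f (x, y) - (sin x * cos y) *\<^sub>R Phi_dy f (x, y)" for f x y
  proof -
    have s: "(complex_of_real (sin y))\<^sup>2 = 1 - (complex_of_real (cos y))\<^sup>2"
      by (simp add: sin_squared_eq flip: of_real_power)
    show ?thesis unfolding X_field_def Phi_dx_def Phi_dy_def scaleR_conv_of_real
      using s by simp algebra
  qed
  then show ?thesis by (auto simp: rotation_field_def smooth_X_field)
qed

lemma rotation_field_Y: "rotation_field Y_field 0 1"
proof -
  have "cos x *\<^sub>R Y_field f (Phi (x, y)) = (cos x * cos y) *\<^sub>R Phi_dx f (x, y) + (sin x * sin y) *\<^sub>R Phi_dy f (x, y)" for f x y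
  proof -
    have s: "(complex_of_real (sin y))\<^sup>2 = 1 - (complex_of_real (cos y))\<^sup>2"
      by (simp add: sin_squared_eq flip: of_real_power)
    show ?thesis unfolding Y_field_def Phi_dx_def Phi_dy_def scaleR_conv_of_real
      using s by simp algebra
  qed
  then show ?thesis by (auto simp: rotation_field_def smooth_Y_field)
qed

section \<open>Integrals over the sphere in coordinates\<close>

lemma Phi_measurable_borel [measurable]: "Phi \<in> borel_measurable borel"
  by (rule borel_measurable_continuous_onI[OF continuous_Phi])

lemma sets_sigma: "sets sigma_measure = sets (restrict_space borel Omega)"
  by (simp add: sigma_measure_def sets_restrict_space)

lemma space_sigma: "space sigma_measure = Omega"
  by (simp add: sigma_measure_def space_restrict_space)

lemma borel_measurable_sigma: "f \<in> borel_measurable borel \<Longrightarrow> f \<in> borel_measurable sigma_measure"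
  using measurable_restrict_space1[of f borel borel Omega] measurable_cong_sets[OF sets_sigma refl] by blast

lemma Phi_measurable_sigma [measurable]: "Phi \<in> measurable sigma_measure (restrict_space borel (sphere 0 1))"
  by (rule measurable_restrict_space2) (use Phi_sphere in \<open>auto intro: borel_measurable_sigma\<close>)

lemma Omega_borel [measurable]: "Omega \<in> sets borel"
proof -
  have "{-(pi/2)<..<pi/2} \<times> {0..<2*pi} \<in> sets (borel \<Otimes>\<^sub>M borel :: (real \<times> real) measure)" by measurable
  then show ?thesis unfolding Omega_def borel_prod .
qed

lemma cos_nonneg_Omega: "q \<in> Omega \<Longrightarrow> 0 \<le> cos (fst q)"
  by (auto simp: Omega_def intro!: less_imp_le cos_gt_zero_pi)

lemma sigma_measure_alt: "sigma_measure = density (restrict_space lborel Omega) (\<lambda>q. ennreal (cos (fst q)))"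
  by (simp add: sigma_measure_def case_prod_unfold)

lemma sigma_integrable_iff:
  fixes f :: "real \<times> real \<Rightarrow> 'b::{banach, second_countable_topology}"
  assumes "f \<in> borel_measurable sigma_measure"
  shows "integrable sigma_measure f \<longleftrightarrow> integrable lborel (\<lambda>q. indicator Omega q *\<^sub>R (cos (fst q) *\<^sub>R f q))"
  unfolding sigma_measure_alt
proof (subst integrable_density)
  show "f \<in> borel_measurable (restrict_space lborel Omega)"
    using assms by (simp add: sigma_measure_def cong: measurable_cong_sets)
  show "AE x in restrict_space lborel Omega. 0 \<le> cos (fst x)"
    by (rule AE_I2) (auto simp: space_restrict_space cos_nonneg_Omega)
  show "(\<lambda>x. cos (fst x)) \<in> borel_measurable (restrict_space lborel Omega)"
    by (intro measurable_restrict_space1) (auto intro!: borel_measurable_continuous_onI continuous_intros)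
  show "integrable (restrict_space lborel Omega) (\<lambda>x. cos (fst x) *\<^sub>R f x) =
    integrable lborel (\<lambda>q. indicat_real Omega q *\<^sub>R cos (fst q) *\<^sub>R f q)"
    by (rule integrable_restrict_space) simp
qed

lemma sigma_integral:
  fixes f :: "real \<times> real \<Rightarrow> 'b::{banach, second_countable_topology}"
  assumes "f \<in> borel_measurable sigma_measure"
  shows "(LINT q|sigma_measure. f q) = (LINT q|lborel. indicator Omega q *\<^sub>R (cos (fst q) *\<^sub>R f q))"
  unfolding sigma_measure_alt
proof (subst integral_density)
  show "f \<in> borel_measurable (restrict_space lborel Omega)"
    using assms by (simp add: sigma_measure_def cong: measurable_cong_sets)
  show "AE x in restrict_space lborel Omega. 0 \<le> cos (fst x)"
    by (rule AE_I2) (auto simp: space_restrict_space cos_nonneg_Omega)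
  show "(\<lambda>x. cos (fst x)) \<in> borel_measurable (restrict_space lborel Omega)"
    by (intro measurable_restrict_space1) (auto intro!: borel_measurable_continuous_onI continuous_intros)
  show "(LINT q|restrict_space lborel Omega. cos (fst q) *\<^sub>R f q) =
    (LINT q|lborel. indicat_real Omega q *\<^sub>R cos (fst q) *\<^sub>R f q)"
    by (rule integral_restrict_space) simp
qed

lemma finite_measure_sigma: "finite_measure sigma_measure"
proof
  let ?N = "restrict_space lborel Omega"
  have m: "(\<lambda>q. ennreal (cos (fst q))) \<in> borel_measurable ?N"
    by (intro measurable_restrict_space1 measurable_compose[OF _ measurable_ennreal])
       (auto intro!: borel_measurable_continuous_onI continuous_intros)
  have "emeasure sigma_measure (space sigma_measure) = (\<integral>\<^sup>+q. ennreal (cos (fst q)) * indicator (space ?N) q \<partial>?N)"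
    unfolding sigma_measure_alt space_density by (rule emeasure_density[OF m sets.top])
  also have "\<dots> = (\<integral>\<^sup>+q. ennreal (cos (fst q)) \<partial>?N)"
    by (rule nn_integral_cong) simp
  also have "\<dots> \<le> (\<integral>\<^sup>+q. 1 \<partial>restrict_space lborel Omega)"
    by (intro nn_integral_mono) (simp add: ennreal_le_1)
  also have "\<dots> = emeasure lborel Omega"
    using emeasure_restrict_space[of Omega lborel Omega] by (simp add: space_restrict_space)
  also have "\<dots> \<le> emeasure lborel (cbox (-(pi/2), 0) (pi/2, 2*pi))"
    by (rule emeasure_mono) (auto simp: Omega_def)
  also have "\<dots> < \<infinity>" by (rule emeasure_lborel_cbox_finite)
  finally show "emeasure sigma_measure (space sigma_measure) \<noteq> \<infinity>" by auto
qed

interpretation sigma: finite_measure sigma_measure by (rule finite_measure_sigma)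

text \<open>\<open>Omega\<close> and the compact rectangle differ by a part of the boundary, a null
  set; on the rectangle the integral of a continuous function can be iterated.\<close>

lemma sigma_integral_continuous:
  fixes f :: "real \<times> real \<Rightarrow> 'b::euclidean_space"
  assumes f: "continuous_on UNIV f"
  shows "(LINT q|sigma_measure. f q) = integral {-(pi/2)..pi/2} (\<lambda>x. integral {0..2*pi} (\<lambda>y. cos x *\<^sub>R f (x, y)))"
    and "integrable sigma_measure f"
proof -
  let ?B = "cbox (-(pi/2), 0::real) (pi/2, 2*pi)"
  let ?g = "\<lambda>q. cos (fst q) *\<^sub>R f q"
  have fm: "f \<in> borel_measurable borel" by (rule borel_measurable_continuous_onI[OF f])
  have gc: "continuous_on A ?g" for A
    by (intro continuous_intros continuous_on_subset[OF f]) auto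
  have gm: "?g \<in> borel_measurable borel" by (rule borel_measurable_continuous_onI[OF gc])
  have gi: "set_integrable lborel ?B ?g" unfolding set_integrable_def by (rule borel_integrable_compact) (auto intro: gc)
  have "AE q in lborel. q \<notin> ?B - box (-(pi/2), 0) (pi/2, 2*pi)"
  proof (rule AE_not_in)
    have "negligible (?B - box (-(pi/2), 0) (pi/2, 2*pi))" by (rule negligible_frontier_interval)
    then show "?B - box (-(pi/2), 0) (pi/2, 2*pi) \<in> null_sets lborel"
      by (simp add: negligible_iff_null_sets null_sets_completion_iff)
  qed
  moreover have "box (-(pi/2), 0) (pi/2, 2*pi) \<subseteq> Omega" "Omega \<subseteq> ?B"
    by (auto simp: Omega_def box_def Basis_prod_def)
  ultimately have AE: "AE q in lborel. indicator Omega q *\<^sub>R ?g q = indicator ?B q *\<^sub>R ?g q"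
    by (auto elim!: eventually_mono split: split_indicator)
  have mB: "(\<lambda>q. indicat_real B q *\<^sub>R ?g q) \<in> borel_measurable lborel" if "B \<in> sets borel" for B
    by (rule borel_measurable_scaleR[OF borel_measurable_indicator]) (use gm that in simp_all)
  have m: "(\<lambda>q. indicat_real Omega q *\<^sub>R ?g q) \<in> borel_measurable lborel" "(\<lambda>q. indicat_real ?B q *\<^sub>R ?g q) \<in> borel_measurable lborel"
    by (rule mB; simp)+
  show "integrable sigma_measure f"
    unfolding sigma_integrable_iff[OF borel_measurable_sigma[OF fm]]
    using integrable_cong_AE[OF m AE] gi by (simp add: set_integrable_def)
  have "(LINT q|sigma_measure. f q) = (LINT q|lborel. indicator ?B q *\<^sub>R ?g q)"
    unfolding sigma_integral[OF borel_measurable_sigma[OF fm]] by (rule integral_cong_AE[OF m AE])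
  also have "\<dots> = integral ?B ?g"
    using set_borel_integral_eq_integral(2)[OF gi] by (simp add: set_lebesgue_integral_def)
  also have "\<dots> = integral (cbox (-(pi/2)) (pi/2)) (\<lambda>x. integral (cbox 0 (2*pi)) (\<lambda>y. ?g (x, y)))"
    by (rule integral_prod_continuous[OF gc])
  finally show "(LINT q|sigma_measure. f q) = integral {-(pi/2)..pi/2} (\<lambda>x. integral {0..2*pi} (\<lambda>y. cos x *\<^sub>R f (x, y)))"
    by simp
qed

lemma sphere_integral:
  fixes f :: "real^3 \<Rightarrow> 'b::{banach, second_countable_topology}"
  assumes "f \<in> borel_measurable (restrict_space borel (sphere 0 1))"
  shows "(LINT p|sphere_measure. f p) = (LINT q|sigma_measure. f (Phi q))"
  unfolding sphere_measure_eq by (rule integral_distr) (use assms in auto)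

lemma smooth_borel: "f \<in> sphere_smooth \<Longrightarrow> f \<in> borel_measurable (restrict_space borel (sphere 0 1))"
  by (rule borel_measurable_continuous_on_restrict[OF smooth_continuous_on])

lemma sets_sphere_measure: "sets sphere_measure = sets (restrict_space borel (sphere 0 1))"
  by (simp add: sphere_measure_eq)

lemma L2_sphere_iff:
  assumes "f \<in> borel_measurable (restrict_space borel (sphere 0 1))"
  shows "f \<in> L2 sphere_measure \<longleftrightarrow> (\<lambda>q. f (Phi q)) \<in> L2 sigma_measure"
proof -
  have [measurable]: "f \<in> borel_measurable (restrict_space borel (sphere 0 1))" by fact
  have "f \<in> borel_measurable sphere_measure" using assms by (simp add: measurable_cong_sets[OF sets_sphere_measure refl])
  moreover have "(\<lambda>q. f (Phi q)) \<in> borel_measurable sigma_measure" by measurable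
  moreover have "integrable sphere_measure (\<lambda>p. (cmod (f p))\<^sup>2) \<longleftrightarrow> integrable sigma_measure (\<lambda>q. (cmod (f (Phi q)))\<^sup>2)"
    unfolding sphere_measure_eq by (rule integrable_distr_eq) measurable
  ultimately show ?thesis by (simp add: L2_def)
qed

lemma continuous_L2_sigma:
  assumes "continuous_on UNIV f" shows "f \<in> L2 sigma_measure"
proof -
  have "continuous_on UNIV (\<lambda>q. (cmod (f q))\<^sup>2)" by (intro continuous_intros assms)
  from sigma_integral_continuous(2)[OF this] show ?thesis
    by (simp add: L2_def borel_measurable_sigma borel_measurable_continuous_onI assms)
qed

lemma smooth_L2: "f \<in> sphere_smooth \<Longrightarrow> f \<in> L2 sphere_measure"
  by (simp add: L2_sphere_iff smooth_borel continuous_L2_sigma continuous_smooth_Phi)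

lemma borel_cnj [measurable (raw)]:
  assumes "f \<in> borel_measurable M" shows "(\<lambda>x. cnj (f x)) \<in> borel_measurable M"
proof -
  have "cnj \<in> borel_measurable borel" by (intro borel_measurable_continuous_onI continuous_intros)
  from measurable_compose[OF assms this] show ?thesis .
qed

lemma ip_sphere:
  assumes [measurable]: "f \<in> borel_measurable (restrict_space borel (sphere 0 1))" "g \<in> borel_measurable (restrict_space borel (sphere 0 1))"
  shows "ip sphere_measure f g = ip sigma_measure (\<lambda>q. f (Phi q)) (\<lambda>q. g (Phi q))"
  unfolding ip_def by (rule sphere_integral) measurable

section \<open>Skew-symmetry of the rotation fields and their formal adjoints\<close>

lemma Phi_periodic: "Phi (x, 2 * pi) = Phi (x, 0)"
  by (simp add: Phi_def)

text \<open>Divergence form: \<open>\<integral>\<close> of \<open>cos x A(y) V\<^sub>x - sin x A'(y) V\<^sub>y\<close> vanishes for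
  \<open>A'' = - A\<close> and periodic \<open>V\<close>, because the integrand is \<open>(cos x A V)\<^sub>x - (sin x A' V)\<^sub>y\<close>.\<close>

lemma integral_rotation_field_eq_0:
  fixes V Vx Vy :: "real \<times> real \<Rightarrow> complex"
  assumes c: "continuous_on UNIV V" "continuous_on UNIV Vx" "continuous_on UNIV Vy"
    and dx: "\<And>x y. ((\<lambda>x. V (x, y)) has_vector_derivative Vx (x, y)) (at x)"
    and dy: "\<And>x y. ((\<lambda>y. V (x, y)) has_vector_derivative Vy (x, y)) (at y)"
    and per: "\<And>x. V (x, 2 * pi) = V (x, 0)"
  shows "integral {-(pi/2)..pi/2} (\<lambda>x. integral {0..2*pi} (\<lambda>y.
     (cos x * (a * sin y + b * cos y)) *\<^sub>R Vx (x, y) - (sin x * (a * cos y - b * sin y)) *\<^sub>R Vy (x, y))) = 0"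
proof -
  define G1 where "G1 = (\<lambda>x y. (cos x * (a * sin y + b * cos y)) *\<^sub>R Vx (x, y) + (- sin x * (a * sin y + b * cos y)) *\<^sub>R V (x, y))"
  define G2 where "G2 = (\<lambda>x y. (sin x * (a * cos y - b * sin y)) *\<^sub>R Vy (x, y) + (sin x * (- a * sin y - b * cos y)) *\<^sub>R V (x, y))"
  have cs: "continuous_on A (\<lambda>q. V (fst q, snd q))" "continuous_on A (\<lambda>q. Vx (fst q, snd q))" "continuous_on A (\<lambda>q. Vy (fst q, snd q))" for A
    using c by (auto intro: continuous_on_subset)
  have cG: "continuous_on A (\<lambda>(x, y). G1 x y)" "continuous_on A (\<lambda>(x, y). G2 x y)" for A
    unfolding G1_def G2_def case_prod_unfold by (intro continuous_intros cs)+
  have cGy: "continuous_on A (G1 x)" "continuous_on A (G2 x)" for x A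
  proof -
    have "continuous_on A (\<lambda>y. (x, y))" by (intro continuous_intros)
    from continuous_on_compose2[OF cG(1)[of UNIV] this] continuous_on_compose2[OF cG(2)[of UNIV] this]
    show "continuous_on A (G1 x)" "continuous_on A (G2 x)" by auto
  qed
  \<comment> \<open>The boundary values vanish because \<open>cos (pi/2) = 0\<close>. This requires
    the \<open>x\<close>-integral of \<open>G1\<close> to be the inner one, hence the exchange of
    integrals at the end.\<close>
  have I1: "integral {-(pi/2)..pi/2} (\<lambda>x. G1 x y) = 0" for y
  proof -
    have "((\<lambda>x. G1 x y) has_integral (cos (pi/2) * (a * sin y + b * cos y)) *\<^sub>R V (pi/2, y) - (cos (-(pi/2)) * (a * sin y + b * cos y)) *\<^sub>R V (-(pi/2), y)) {-(pi/2)..pi/2}"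
      unfolding G1_def
      by (rule fundamental_theorem_of_calculus)
         (auto intro!: has_vector_derivative_scaleR has_vector_derivative_at_within[OF dx] derivative_eq_intros)
    then show ?thesis by (simp add: integral_unique)
  qed
  have I2: "integral {0..2*pi} (G2 x) = 0" for x
  proof -
    have "((\<lambda>y. G2 x y) has_integral (sin x * (a * cos (2*pi) - b * sin (2*pi))) *\<^sub>R V (x, 2*pi) - (sin x * (a * cos 0 - b * sin 0)) *\<^sub>R V (x, 0)) {0..2*pi}"
      unfolding G2_def
      by (rule fundamental_theorem_of_calculus)
         (auto intro!: has_vector_derivative_scaleR has_vector_derivative_at_within[OF dy] derivative_eq_intros)
    then show ?thesis by (simp add: integral_unique per)
  qed
  have "(\<lambda>x. integral {0..2*pi} (\<lambda>y. (cos x * (a * sin y + b * cos y)) *\<^sub>R Vx (x, y) - (sin x * (a * cos y - b * sin y)) *\<^sub>R Vy (x, y)))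
    = (\<lambda>x. integral {0..2*pi} (\<lambda>y. G1 x y - G2 x y))"
    by (simp add: G1_def G2_def algebra_simps)
  also have "\<dots> = (\<lambda>x. integral {0..2*pi} (G1 x) - integral {0..2*pi} (G2 x))"
    by (intro ext Henstock_Kurzweil_Integration.integral_diff integrable_continuous_interval cGy)
  finally have "?thesis \<longleftrightarrow> integral (cbox (-(pi/2)) (pi/2)) (\<lambda>x. integral (cbox 0 (2*pi)) (G1 x)) = 0"
    by (simp add: I2)
  also have "integral (cbox (-(pi/2)) (pi/2)) (\<lambda>x. integral (cbox 0 (2*pi)) (G1 x)) = integral (cbox 0 (2*pi)) (\<lambda>y. integral (cbox (-(pi/2)) (pi/2)) (\<lambda>x. G1 x y))"
    by (rule integral_swap_continuous[OF cG(1)])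
  also have "\<dots> = 0" by (simp add: I1)
  finally show ?thesis by simp
qed

text \<open>Rotations preserve the measure, so their fields have divergence zero; by the product
  rule the claim is that the derivative of \<open>f * cnj g\<close> along the field has integral
  0.\<close>

lemma rotation_field_skew:
  assumes P: "rotation_field P a b" and f: "f \<in> sphere_smooth" and g: "g \<in> sphere_smooth"
  shows "ip sphere_measure (P f) g = - ip sphere_measure f (P g)"
proof -
  have Pf: "P f \<in> sphere_smooth" and Pg: "P g \<in> sphere_smooth" using P f g by (auto simp: rotation_field_def)
  have fe: "cos x *\<^sub>R P f (Phi (x, y)) = (cos x * (a * sin y + b * cos y)) *\<^sub>R Phi_dx f (x, y)
       - (sin x * (a * cos y - b * sin y)) *\<^sub>R Phi_dy f (x, y)" for x y using P f by (simp add: rotation_field_def)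
  have ge: "cos x *\<^sub>R P g (Phi (x, y)) = (cos x * (a * sin y + b * cos y)) *\<^sub>R Phi_dx g (x, y)
       - (sin x * (a * cos y - b * sin y)) *\<^sub>R Phi_dy g (x, y)" for x y using P g by (simp add: rotation_field_def)
  define V where "V q = f (Phi q) * cnj (g (Phi q))" for q
  define Vx where "Vx q = f (Phi q) * cnj (Phi_dx g q) + Phi_dx f q * cnj (g (Phi q))" for q
  define Vy where "Vy q = f (Phi q) * cnj (Phi_dy g q) + Phi_dy f q * cnj (g (Phi q))" for q
  have c: "continuous_on UNIV (\<lambda>q. P f (Phi q) * cnj (g (Phi q)) + f (Phi q) * cnj (P g (Phi q)))"
    by (intro continuous_intros continuous_smooth_Phi f g Pf Pg)
  have L: "integrable sigma_measure (\<lambda>q. P f (Phi q) * cnj (g (Phi q)))" "integrable sigma_measure (\<lambda>q. f (Phi q) * cnj (P g (Phi q)))"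
    by (intro sigma_integral_continuous(2) continuous_intros continuous_smooth_Phi f g Pf Pg)+
  have "ip sphere_measure (P f) g + ip sphere_measure f (P g) =
    (LINT q|sigma_measure. P f (Phi q) * cnj (g (Phi q)) + f (Phi q) * cnj (P g (Phi q)))"
    using L by (simp add: ip_sphere smooth_borel f g Pf Pg) (simp add: ip_def)
  also have "\<dots> = integral {-(pi/2)..pi/2} (\<lambda>x. integral {0..2*pi} (\<lambda>y. cos x *\<^sub>R (P f (Phi (x, y)) * cnj (g (Phi (x, y))) + f (Phi (x, y)) * cnj (P g (Phi (x, y))))))"
    by (rule sigma_integral_continuous(1)[OF c])
  also have "\<dots> = integral {-(pi/2)..pi/2} (\<lambda>x. integral {0..2*pi} (\<lambda>y.
     (cos x * (a * sin y + b * cos y)) *\<^sub>R Vx (x, y) - (sin x * (a * cos y - b * sin y)) *\<^sub>R Vy (x, y)))"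
  proof -
    have "cos x *\<^sub>R (P f (Phi (x, y)) * cnj (g (Phi (x, y))) + f (Phi (x, y)) * cnj (P g (Phi (x, y))))
      = (cos x * (a * sin y + b * cos y)) *\<^sub>R Vx (x, y) - (sin x * (a * cos y - b * sin y)) *\<^sub>R Vy (x, y)" for x y
    proof -
      have "cos x *\<^sub>R (P f (Phi (x, y)) * cnj (g (Phi (x, y))) + f (Phi (x, y)) * cnj (P g (Phi (x, y))))
        = (cos x *\<^sub>R P f (Phi (x, y))) * cnj (g (Phi (x, y))) + f (Phi (x, y)) * cnj (cos x *\<^sub>R P g (Phi (x, y)))"
        by (simp add: scaleR_right_distrib)
      also have "\<dots> = (cos x * (a * sin y + b * cos y)) *\<^sub>R Vx (x, y) - (sin x * (a * cos y - b * sin y)) *\<^sub>R Vy (x, y)"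
        unfolding fe ge Vx_def Vy_def by (simp add: algebra_simps)
      finally show ?thesis .
    qed
    then show ?thesis by (simp only:)
  qed
  also have "\<dots> = 0"
  proof (rule integral_rotation_field_eq_0)
    show "continuous_on UNIV V" "continuous_on UNIV Vx" "continuous_on UNIV Vy"
      unfolding V_def Vx_def Vy_def
      by (intro continuous_intros continuous_smooth_Phi continuous_Phi_dx continuous_Phi_dy f g)+
    show "((\<lambda>x. V (x, y)) has_vector_derivative Vx (x, y)) (at x)" for x y
      unfolding V_def Vx_def
      by (intro has_vector_derivative_mult smooth_Phi_dx f has_vector_derivative_cnj g)
    show "((\<lambda>y. V (x, y)) has_vector_derivative Vy (x, y)) (at y)" for x y
      unfolding V_def Vy_def
      by (intro has_vector_derivative_mult smooth_Phi_dy f has_vector_derivative_cnj g)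
    show "V (x, 2 * pi) = V (x, 0)" for x by (simp add: V_def Phi_periodic)
  qed
  finally show ?thesis by (simp add: add_eq_0_iff2)
qed

text \<open>By skew-symmetry \<open>- P v\<close> qualifies as an adjoint, so the choice has the
  defining property. Testing that property with the difference of the chosen adjoint and
  \<open>- P v\<close> shows this difference to be orthogonal to itself, hence null for the surface
  measure.\<close>

lemma formal_adjoint_rotation_field:
  assumes P: "rotation_field P a b" and v: "v \<in> sphere_smooth"
  shows "formal_adjoint P v \<in> sphere_smooth"
    and "u \<in> sphere_smooth \<Longrightarrow> ip sphere_measure (P u) v = ip sphere_measure u (formal_adjoint P v)"
    and "AE p in sphere_measure. formal_adjoint P v p = - P v p"
proof -
  have Pv: "P v \<in> sphere_smooth" using P v by (auto simp: rotation_field_def)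
  let ?Q = "\<lambda>w. w \<in> sphere_smooth \<and> (\<forall>u\<in>sphere_smooth.
        (LINT p|sphere_measure. P u p * cnj (v p)) = (LINT p|sphere_measure. u p * cnj (w p)))"
  have m: "ip sphere_measure u (\<lambda>p. - P v p) = - ip sphere_measure u (P v)" for u
    by (simp add: ip_def)
  have "?Q (\<lambda>p. - P v p)"
    using rotation_field_skew[OF P _ v] by (simp add: smooth_uminus Pv m flip: ip_def)
  then have Q: "?Q (formal_adjoint P v)" unfolding formal_adjoint_def by (rule someI[of ?Q])
  then show 1: "formal_adjoint P v \<in> sphere_smooth" by simp
  show 2: "ip sphere_measure (P u) v = ip sphere_measure u (formal_adjoint P v)" if "u \<in> sphere_smooth" for u
    using Q that by (simp add: ip_def)
  let ?d = "\<lambda>p. formal_adjoint P v p - (- P v p)"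
  have d: "?d \<in> sphere_smooth" unfolding diff_minus_eq_add by (rule smooth_add[OF 1 Pv])
  have "cnj (ip sphere_measure ?d ?d) = cnj (ip sphere_measure (formal_adjoint P v) ?d - ip sphere_measure (\<lambda>p. - P v p) ?d)"
    by (subst ip_diff) (intro smooth_L2 1 d Pv smooth_uminus refl)+
  also have "\<dots> = ip sphere_measure ?d (formal_adjoint P v) - ip sphere_measure ?d (\<lambda>p. - P v p)"
    by (simp flip: ip_cnj)
  also have "\<dots> = 0" using 2[OF d] rotation_field_skew[OF P d v] m by simp
  finally have "sqn sphere_measure ?d = 0" by (simp add: ip_self)
  from sqn_0_AE[OF smooth_L2[OF d] this] show "AE p in sphere_measure. formal_adjoint P v p = - P v p"
    by (simp add: add_eq_0_iff2)
qed

lemma smooth_L_smooth: "u \<in> sphere_smooth \<Longrightarrow> L_smooth u \<in> sphere_smooth"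
  unfolding L_smooth_def diff_conv_add_uminus
  by (intro smooth_add smooth_uminus formal_adjoint_rotation_field(1)[OF rotation_field_X]
      formal_adjoint_rotation_field(1)[OF rotation_field_Y] smooth_X_field smooth_Y_field)

text \<open>The minus signs in the definition meet those of the skew adjoints, which leaves a sum of
  squares of vector fields.\<close>

lemma L_smooth_AE:
  assumes u: "u \<in> sphere_smooth"
  shows "AE p in sphere_measure. L_smooth u p = X_field (X_field u) p + Y_field (Y_field u) p"
  using formal_adjoint_rotation_field(3)[OF rotation_field_X smooth_X_field[OF u]]
    formal_adjoint_rotation_field(3)[OF rotation_field_Y smooth_Y_field[OF u]]
  by eventually_elim (simp add: L_smooth_def)

lemma ip_L_smooth:
  assumes u: "u \<in> sphere_smooth" and v: "v \<in> sphere_smooth"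
  shows "ip sphere_measure u (L_smooth v) = - ip sphere_measure (X_field u) (X_field v) - ip sphere_measure (Y_field u) (Y_field v)"
proof -
  let ?A = "formal_adjoint X_field (X_field v)" and ?B = "formal_adjoint Y_field (Y_field v)"
  have A: "?A \<in> sphere_smooth" by (rule formal_adjoint_rotation_field(1)[OF rotation_field_X smooth_X_field[OF v]])
  have B: "?B \<in> sphere_smooth" by (rule formal_adjoint_rotation_field(1)[OF rotation_field_Y smooth_Y_field[OF v]])
  have "cnj (ip sphere_measure u (L_smooth v)) = ip sphere_measure (\<lambda>p. - ?A p - ?B p) u"
    by (simp add: L_smooth_def flip: ip_cnj)
  also have "\<dots> = - ip sphere_measure ?A u - ip sphere_measure ?B u"
    by (subst ip_diff) (auto intro!: smooth_L2 A B u smooth_uminus simp: ip_uminus)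
  finally have "ip sphere_measure u (L_smooth v) = cnj (- ip sphere_measure ?A u - ip sphere_measure ?B u)"
    by (metis complex_cnj_cnj)
  also have "\<dots> = - ip sphere_measure u ?A - ip sphere_measure u ?B"
    by (simp flip: ip_cnj)
  finally show ?thesis
    using formal_adjoint_rotation_field(2)[OF rotation_field_X smooth_X_field[OF v] u]
      formal_adjoint_rotation_field(2)[OF rotation_field_Y smooth_Y_field[OF v] u] by simp
qed

lemma L_smooth_symmetric:
  assumes u: "u \<in> sphere_smooth" and v: "v \<in> sphere_smooth"
  shows "ip sphere_measure (L_smooth u) v = ip sphere_measure u (L_smooth v)"
proof -
  have "ip sphere_measure (L_smooth u) v = cnj (ip sphere_measure v (L_smooth u))" by (rule ip_cnj)
  also have "\<dots> = - ip sphere_measure (X_field u) (X_field v) - ip sphere_measure (Y_field u) (Y_field v)"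
    unfolding ip_L_smooth[OF v u] by (simp flip: ip_cnj)
  finally show ?thesis by (simp add: ip_L_smooth[OF u v])
qed

section \<open>Spherical harmonics\<close>

text \<open>Rodrigues' formula for the ultraspherical (Gegenbauer) polynomials, up to normalization.\<close>

definition ultra :: "nat \<Rightarrow> nat \<Rightarrow> complex poly" where
  "ultra n d = (pderiv ^^ (2 * n + d)) ([:-1, 0, 1:] ^ (n + d))"

lemma pderiv_funpow_nonzero:
  fixes p :: "complex poly"
  assumes "p \<noteq> 0" "k \<le> degree p"
  shows "(pderiv ^^ k) p \<noteq> 0 \<and> degree ((pderiv ^^ k) p) = degree p - k"
  using assms(2)
proof (induction k)
  case 0
  then show ?case using assms(1) by simp
next
  case (Suc k)
  then show ?case by (auto simp: degree_pderiv pderiv_eq_0_iff)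
qed

lemma degree_ultra: "degree (ultra n d) = d" and ultra_nonzero: "ultra n d \<noteq> 0"
proof -
  have "degree ([:-1, 0, 1:] ^ (n + d) :: complex poly) = 2 * (n + d)"
    by (subst degree_power_eq) auto
  moreover have "([:-1, 0, 1:] ^ (n + d) :: complex poly) \<noteq> 0" by simp
  ultimately show "degree (ultra n d) = d" "ultra n d \<noteq> 0"
    using pderiv_funpow_nonzero[of "[:-1, 0, 1:] ^ (n + d)" "2 * n + d"] by (simp_all add: ultra_def)
qed

lemma pderiv_of_int: "pderiv (of_int k) = 0"
  by (simp add: of_int_poly pderiv_pCons)

text \<open>With \<open>Q = X^2 - 1\<close>, the identity
  \<open>Q * (Q^l)' = 2 * l * X * Q^l\<close> is differentiated \<open>k + 1\<close> times, one
  derivative per induction step. The coefficients are taken in the integers since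
  \<open>k + 1 - l\<close> may be negative.\<close>

lemma ultra_recursion:
  fixes l k :: nat
  defines "q \<equiv> \<lambda>k. (pderiv ^^ k) ([:-1, 0, 1:] ^ l :: complex poly)"
  shows "[:-1, 0, 1:] * q (k + 2) + of_int (2 * (int k + 1 - int l)) * ([:0, 1:] * q (k + 1))
    = of_int ((int k + 1) * (2 * int l - int k)) * q k"
proof -
  have q_Suc: "q (Suc k) = pderiv (q k)" for k by (simp add: q_def)
  have pQ: "pderiv [:-1, 0, 1 :: complex:] = of_int 2 * [:0, 1:]"
    by (simp add: pderiv_pCons of_int_poly)
  have pX: "pderiv [:0, 1 :: complex:] = 1" by (simp add: pderiv_pCons one_pCons)
  show ?thesis
  proof (induction k)
    case 0
    have "[:-1, 0, 1:] * q 1 = of_int (2 * int l) * ([:0, 1:] * q 0)"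
    proof (cases l)
      case (Suc l')
      have "q 1 = smult (of_nat l) ([:-1, 0, 1:] ^ l' * pderiv [:-1, 0, 1:])"
        using Suc by (simp add: q_def pderiv_power del: power_Suc)
      also have "\<dots> = of_nat l * [:-1, 0, 1:] ^ l' * (of_int 2 * [:0, 1:])"
        unfolding pQ by (simp add: of_nat_poly)
      finally show ?thesis using Suc by (simp add: q_def algebra_simps)
    qed (simp add: q_def)
    then have "pderiv ([:-1, 0, 1:] * q 1) = pderiv (of_int (2 * int l) * ([:0, 1:] * q 0))" by simp
    then have "[:-1, 0, 1:] * q 2 + q 1 * (of_int 2 * [:0, 1:]) = of_int (2 * int l) * ([:0, 1:] * q 1 + q 0)"
      unfolding pderiv_mult pQ pX pderiv_of_int
      by (simp add: numeral_2_eq_2 q_Suc)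
    moreover have "Q * q2 + q1 * (of_int 2 * X) = of_int (2 * j) * (X * q1 + q0) \<Longrightarrow>
      Q * q2 + of_int (2 * (0 + 1 - j)) * (X * q1) = of_int ((0 + 1) * (2 * j - 0)) * q0"
      for Q X q0 q1 q2 :: "complex poly" and j :: int
      by (simp add: algebra_simps)
    ultimately show ?case by (simp only: of_nat_0 add_0)
  next
    case (Suc k)
    have "pderiv ([:-1, 0, 1:] * q (k + 2) + of_int (2 * (int k + 1 - int l)) * ([:0, 1:] * q (k + 1)))
      = pderiv (of_int ((int k + 1) * (2 * int l - int k)) * q k)" using Suc by simp
    then have "[:-1, 0, 1:] * q (k + 3) + q (k + 2) * (of_int 2 * [:0, 1:])
        + of_int (2 * (int k + 1 - int l)) * ([:0, 1:] * q (k + 2) + q (k + 1))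
      = of_int ((int k + 1) * (2 * int l - int k)) * q (k + 1)"
      unfolding pderiv_mult pderiv_add pQ pX pderiv_of_int
      by (simp add: q_Suc numeral_2_eq_2 numeral_3_eq_3)
    moreover have "Q * q3 + q2 * (of_int 2 * X) + of_int (2 * (i + 1 - j)) * (X * q2 + q1) = of_int ((i + 1) * (2 * j - i)) * q1 \<Longrightarrow>
      Q * q3 + of_int (2 * (i + 1 - j) + 2) * (X * q2) = of_int ((i + 1) * (2 * j - i) - 2 * (i + 1 - j)) * q1"
      for Q X q1 q2 q3 :: "complex poly" and i j :: int
      by (simp add: algebra_simps)
    ultimately have *: "[:-1, 0, 1:] * q (k + 3) + of_int (2 * (int k + 1 - int l) + 2) * ([:0, 1:] * q (k + 2))
      = of_int ((int k + 1) * (2 * int l - int k) - 2 * (int k + 1 - int l)) * q (k + 1)"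
      by (simp only:)
    have e: "2 * (int k + 1 - int l) + 2 = 2 * (int (Suc k) + 1 - int l)"
      "(int k + 1) * (2 * int l - int k) - 2 * (int k + 1 - int l) = (int (Suc k) + 1) * (2 * int l - int (Suc k))"
      "k + 3 = Suc k + 2" "k + 2 = Suc k + 1" "k + 1 = Suc k"
      by (simp_all add: algebra_simps)
    show ?case using * unfolding e .
  qed
qed

text \<open>The recursion at \<open>k = 2n + d\<close> and \<open>l = n + d\<close>, with the sign
  reversed because \<open>Q = s^2 - 1\<close>. This is the Gegenbauer equation with parameter
  \<open>n + 1/2\<close>.\<close>

lemma ultra_ode:
  "(1 - s\<^sup>2) * poly (pderiv (pderiv (ultra n d))) s - 2 * (of_nat n + 1) * s * poly (pderiv (ultra n d)) s
    = - of_nat (d * (2 * n + d + 1)) * poly (ultra n d) s"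
proof -
  have "[:-1, 0, 1:] * pderiv (pderiv (ultra n d)) + of_int (2 * (int n + 1)) * ([:0, 1:] * pderiv (ultra n d))
    = of_int ((2 * int n + int d + 1) * int d) * ultra n d"
    using ultra_recursion[of "2 * n + d" "n + d"] unfolding ultra_def
    by (simp add: numeral_2_eq_2 algebra_simps)
  then have "poly ([:-1, 0, 1:] * pderiv (pderiv (ultra n d)) + of_int (2 * (int n + 1)) * ([:0, 1:] * pderiv (ultra n d))) s
    = poly (of_int ((2 * int n + int d + 1) * int d) * ultra n d) s" by simp
  then show ?thesis by (simp add: power2_eq_square algebra_simps poly_of_int)
qed

text \<open>For \<open>s = 1\<close> and \<open>s = -1\<close> this is \<open>x1 + i x2\<close> and
  \<open>x1 - i x2\<close>, on the sphere \<open>cos x * exp (i s y)\<close>. Being polynomial, its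
  powers extend the Fourier modes smoothly across the poles, as membership in
  \<open>sphere_smooth\<close> requires.\<close>

definition zeta :: "complex \<Rightarrow> real^3 \<Rightarrow> complex" where
  "zeta s p = complex_of_real (p $ 1) + \<i> * s * complex_of_real (p $ 2)"

definition zpoly :: "complex \<Rightarrow> nat \<Rightarrow> complex poly \<Rightarrow> real^3 \<Rightarrow> complex" where
  "zpoly s n r p = zeta s p ^ n * poly r (complex_of_real (p $ 3))"

lemma coordinate_has_derivative: "((\<lambda>p::real^3. complex_of_real (p $ i)) has_derivative (\<lambda>h. complex_of_real (h $ i))) (at p)"
  by (rule bounded_linear_imp_has_derivative[OF bounded_linear_coordinate])

lemma poly_coordinate_has_derivative:
  "((\<lambda>p::real^3. poly r (complex_of_real (p $ i))) has_derivative
    (\<lambda>h. poly (pderiv r) (complex_of_real (p $ i)) * complex_of_real (h $ i))) (at p)"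
  using has_derivative_compose[OF coordinate_has_derivative poly_DERIV[of r, unfolded has_field_derivative_def]] .

lemma zeta_has_derivative:
  "(zeta s has_derivative (\<lambda>h. complex_of_real (h $ 1) + \<i> * s * complex_of_real (h $ 2))) (at p)"
  unfolding zeta_def[abs_def]
  by (intro has_derivative_add has_derivative_mult_right coordinate_has_derivative)

lemma smooth_poly_coordinate: "(\<lambda>p. poly r (complex_of_real (p $ i))) \<in> sphere_smooth"
  by (induction r) (auto intro!: smooth_add smooth_mult smooth_coordinate)

lemma smooth_zeta_power: "(\<lambda>p. zeta s p ^ n) \<in> sphere_smooth"
  by (induction n) (auto intro!: smooth_mult smooth_add smooth_coordinate simp: zeta_def[abs_def])

lemma smooth_zpoly: "zpoly s n r \<in> sphere_smooth"
  unfolding zpoly_def[abs_def] by (intro smooth_mult smooth_zeta_power smooth_poly_coordinate)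

lemma X_field_derivative:
  "(f has_derivative f') (at p) \<Longrightarrow> X_field f p = - complex_of_real (p $ 3) * f' (axis 2 1) + complex_of_real (p $ 2) * f' (axis 3 1)"
  by (simp add: X_field_def partial_def scaleR_conv_of_real flip: frechet_derivative_at)

lemma Y_field_derivative:
  "(f has_derivative f') (at p) \<Longrightarrow> Y_field f p = - complex_of_real (p $ 3) * f' (axis 1 1) + complex_of_real (p $ 1) * f' (axis 3 1)"
  by (simp add: Y_field_def partial_def scaleR_conv_of_real flip: frechet_derivative_at)

lemma zpoly_has_derivative:
  "(zpoly s n r has_derivative (\<lambda>h. zeta s p ^ n * (poly (pderiv r) (complex_of_real (p $ 3)) * complex_of_real (h $ 3)) +
     of_nat n * ((complex_of_real (h $ 1) + \<i> * s * complex_of_real (h $ 2)) * zeta s p ^ (n - 1)) * poly r (complex_of_real (p $ 3)))) (at p)"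
  unfolding zpoly_def[abs_def]
  by (rule has_derivative_eq_rhs,
      (rule has_derivative_mult has_derivative_power zeta_has_derivative poly_coordinate_has_derivative)+)
     (simp add: mult.assoc)

lemma axis_nth_3 [simp]:
  "axis 1 (1::real) $ (1::3) = 1" "axis 1 (1::real) $ (2::3) = 0" "axis 1 (1::real) $ (3::3) = 0"
  "axis 2 (1::real) $ (1::3) = 0" "axis 2 (1::real) $ (2::3) = 1" "axis 2 (1::real) $ (3::3) = 0"
  "axis 3 (1::real) $ (1::3) = 0" "axis 3 (1::real) $ (2::3) = 0" "axis 3 (1::real) $ (3::3) = 1"
  by (simp_all add: axis_def)

lemma X_zpoly: "X_field (zpoly s n r) = (\<lambda>p. (- \<i> * s * of_nat n) * (complex_of_real (p $ 3) * zpoly s (n - 1) r p)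
   + complex_of_real (p $ 2) * zpoly s n (pderiv r) p)"
  by (rule ext, subst X_field_derivative[OF zpoly_has_derivative]) (simp add: zpoly_def algebra_simps)

lemma Y_zpoly: "Y_field (zpoly s n r) = (\<lambda>p. (- of_nat n) * (complex_of_real (p $ 3) * zpoly s (n - 1) r p)
   + complex_of_real (p $ 1) * zpoly s n (pderiv r) p)"
  by (rule ext, subst Y_field_derivative[OF zpoly_has_derivative]) (simp add: zpoly_def algebra_simps)

lemma field_zpoly_has_derivative:
  "((\<lambda>p. c * (complex_of_real (p $ 3) * zpoly s (n - 1) r p) + complex_of_real (p $ i) * zpoly s n (pderiv r) p)
   has_derivative (\<lambda>h. c * (complex_of_real (p $ 3) * (zeta s p ^ (n - 1) * (poly (pderiv r) (complex_of_real (p $ 3)) * complex_of_real (h $ 3)) +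
     of_nat (n - 1) * ((complex_of_real (h $ 1) + \<i> * s * complex_of_real (h $ 2)) * zeta s p ^ (n - 1 - 1)) * poly r (complex_of_real (p $ 3)))
     + complex_of_real (h $ 3) * zpoly s (n - 1) r p)
     + (complex_of_real (p $ i) * (zeta s p ^ n * (poly (pderiv (pderiv r)) (complex_of_real (p $ 3)) * complex_of_real (h $ 3)) +
     of_nat n * ((complex_of_real (h $ 1) + \<i> * s * complex_of_real (h $ 2)) * zeta s p ^ (n - 1)) * poly (pderiv r) (complex_of_real (p $ 3)))
     + complex_of_real (h $ i) * zpoly s n (pderiv r) p))) (at p)"
  by (intro has_derivative_add has_derivative_mult_right has_derivative_mult coordinate_has_derivative zpoly_has_derivative)

lemma sphere_coordinates: "p \<in> sphere 0 1 \<Longrightarrow> (p $ 1)\<^sup>2 + (p $ 2)\<^sup>2 + (p $ 3 :: real)\<^sup>2 = 1" for p :: "real^3"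
proof -
  assume "p \<in> sphere 0 1"
  then have "(norm p)\<^sup>2 = 1" by simp
  then show ?thesis unfolding power2_norm_eq_inner by (simp add: inner_vec_def sum_3 power2_eq_square)
qed

text \<open>The terms with the second derivative of \<open>zeta s p ^ n\<close> cancel between the
  two squares because \<open>s^2 = 1\<close> makes the square of \<open>i * s\<close> equal to -1;
  the equation of the sphere turns \<open>p1^2 + p2^2\<close> into \<open>1 - p3^2\<close>.\<close>

lemma XX_YY_zpoly:
  assumes s: "s\<^sup>2 = 1" and p: "p \<in> sphere 0 1"
  shows "X_field (X_field (zpoly s n r)) p + Y_field (Y_field (zpoly s n r)) p =
    zeta s p ^ n * ((1 - (complex_of_real (p $ 3))\<^sup>2) * poly (pderiv (pderiv r)) (complex_of_real (p $ 3))
      - 2 * (of_nat n + 1) * complex_of_real (p $ 3) * poly (pderiv r) (complex_of_real (p $ 3))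
      - of_nat n * poly r (complex_of_real (p $ 3)))"
proof -
  let ?p1 = "complex_of_real (p $ 1)" and ?p2 = "complex_of_real (p $ 2)" and ?p3 = "complex_of_real (p $ 3)"
  define R R1 R2 where "R = poly r ?p3" "R1 = poly (pderiv r) ?p3" "R2 = poly (pderiv (pderiv r)) ?p3"
  define Z Z1 Z2 where "Z = zeta s p ^ n" "Z1 = zeta s p ^ (n - 1)" "Z2 = of_nat (n - 1) * zeta s p ^ (n - 1 - 1)"
  define N :: complex where "N = of_nat n"
  \<comment> \<open>The factor \<open>N\<close> is kept on both sides: for \<open>n = 0\<close> the
    exponent \<open>n - 1\<close> is truncated, and the identity without \<open>N\<close>
    fails.\<close>
  have nz: "N * Z1 * (?p1 + \<i> * s * ?p2) = N * Z"
    unfolding Z_Z1_Z2_def(1,2) N_def zeta_def[symmetric] by (cases n) auto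
  have sph: "?p1\<^sup>2 + ?p2\<^sup>2 + ?p3\<^sup>2 = 1"
    using sphere_coordinates[OF p] by (simp flip: of_real_power of_real_add)
  have "X_field (X_field (zpoly s n r)) p = - ?p3 * ((- \<i> * s * N) * (?p3 * (\<i> * s * Z2 * R))
      + (?p2 * (N * (\<i> * s) * Z1 * R1) + Z * R1))
    + ?p2 * ((- \<i> * s * N) * (?p3 * (Z1 * R1) + Z1 * R) + ?p2 * (Z * R2))"
    unfolding X_zpoly X_field_derivative[OF field_zpoly_has_derivative[where i = 2]]
    unfolding zpoly_def R_R1_R2_def[symmetric] Z_Z1_Z2_def[symmetric] N_def[symmetric]
    by (simp add: Z_Z1_Z2_def)
  moreover have "Y_field (Y_field (zpoly s n r)) p = - ?p3 * ((- N) * (?p3 * (Z2 * R))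
      + (?p1 * (N * Z1 * R1) + Z * R1))
    + ?p1 * ((- N) * (?p3 * (Z1 * R1) + Z1 * R) + ?p1 * (Z * R2))"
    unfolding Y_zpoly Y_field_derivative[OF field_zpoly_has_derivative[where i = 1]]
    unfolding zpoly_def R_R1_R2_def[symmetric] Z_Z1_Z2_def[symmetric] N_def[symmetric]
    by (simp add: Z_Z1_Z2_def)
  moreover have "- ?p3 * ((- \<i> * s * N) * (?p3 * (\<i> * s * Z2 * R)) + (?p2 * (N * (\<i> * s) * Z1 * R1) + Z * R1))
    + ?p2 * ((- \<i> * s * N) * (?p3 * (Z1 * R1) + Z1 * R) + ?p2 * (Z * R2))
    + (- ?p3 * ((- N) * (?p3 * (Z2 * R)) + (?p1 * (N * Z1 * R1) + Z * R1))
    + ?p1 * ((- N) * (?p3 * (Z1 * R1) + Z1 * R) + ?p1 * (Z * R2)))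
    = Z * ((1 - ?p3\<^sup>2) * R2 - 2 * (N + 1) * ?p3 * R1 - N * R)"
  proof -
    have "\<i> * \<i> = - 1" by simp
    then show ?thesis using nz sph s by algebra
  qed
  ultimately show ?thesis unfolding R_R1_R2_def Z_Z1_Z2_def(1) N_def by simp
qed

text \<open>The second argument \<open>d\<close> is the degree in \<open>x\<^sub>3\<close>; the usual degree of the spherical harmonic is \<open>\<bar>m\<bar> + d\<close>.\<close>

definition harmonic :: "int \<Rightarrow> nat \<Rightarrow> real^3 \<Rightarrow> complex" where
  "harmonic m d = zpoly (if m \<ge> 0 then 1 else -1) (nat \<bar>m\<bar>) (ultra (nat \<bar>m\<bar>) d)"

text \<open>With \<open>l = abs m + d\<close> this is \<open>l * (l + 1) - m^2\<close>: the
  Laplace-Beltrami eigenvalue without the contribution of the rotation about the polar axis.\<close>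

definition eigval :: "int \<Rightarrow> nat \<Rightarrow> real" where
  "eigval m d = real (d * (2 * nat \<bar>m\<bar> + d + 1) + nat \<bar>m\<bar>)"

lemma smooth_harmonic: "harmonic m d \<in> sphere_smooth"
  by (simp add: harmonic_def smooth_zpoly)

lemma AE_sphere: "AE p in sphere_measure. p \<in> sphere 0 1"
  by (rule AE_I2) (simp add: sphere_measure_eq space_restrict_space)

lemma L_smooth_harmonic: "AE p in sphere_measure. L_smooth (harmonic m d) p = - complex_of_real (eigval m d) * harmonic m d p"
  using L_smooth_AE[OF smooth_harmonic[of m d]] AE_sphere
proof eventually_elim
  case (elim p)
  let ?n = "nat \<bar>m\<bar>" and ?s = "if m \<ge> 0 then 1 else -1 :: complex"
  have "X_field (X_field (harmonic m d)) p + Y_field (Y_field (harmonic m d)) p =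
    zeta ?s p ^ ?n * ((1 - (complex_of_real (p $ 3))\<^sup>2) * poly (pderiv (pderiv (ultra ?n d))) (complex_of_real (p $ 3))
      - 2 * (of_nat ?n + 1) * complex_of_real (p $ 3) * poly (pderiv (ultra ?n d)) (complex_of_real (p $ 3))
      - of_nat ?n * poly (ultra ?n d) (complex_of_real (p $ 3)))"
    unfolding harmonic_def by (rule XX_YY_zpoly) (use elim in auto)
  also have "\<dots> = - complex_of_real (eigval m d) * harmonic m d p"
    unfolding ultra_ode by (simp add: harmonic_def zpoly_def eigval_def algebra_simps)
  finally show ?case using elim by simp
qed

text \<open>An arbitrary polynomial is allowed in place of \<open>ultra\<close>, so that every
  linear combination of harmonics of the same order is again a single mode, to which inequalities
  for polynomials apply.\<close>

definition mode :: "int \<Rightarrow> complex poly \<Rightarrow> real \<times> real \<Rightarrow> complex" where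
  "mode m r = (\<lambda>(x, y). cis (of_int m * y) * complex_of_real (cos x ^ nat \<bar>m\<bar>) * poly r (complex_of_real (sin x)))"

lemma zpoly_Phi: "zpoly (if m \<ge> 0 then 1 else -1) (nat \<bar>m\<bar>) r (Phi q) = mode m r q"
proof (cases q)
  case (Pair x y)
  let ?s = "if m \<ge> 0 then 1 else -1 :: real"
  have "zeta (complex_of_real ?s) (Phi (x, y)) = complex_of_real (cos x) * cis (?s * y)"
    by (auto simp: zeta_def complex_eq_iff)
  then have "zeta (complex_of_real ?s) (Phi (x, y)) ^ nat \<bar>m\<bar> = complex_of_real (cos x ^ nat \<bar>m\<bar>) * cis (real (nat \<bar>m\<bar>) * (?s * y))"
    by (simp only: power_mult_distrib Complex.DeMoivre of_real_power)
  moreover have "real (nat \<bar>m\<bar>) * (?s * y) = of_int m * y" by simp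
  moreover have "complex_of_real ?s = (if m \<ge> 0 then 1 else -1)" by simp
  ultimately show ?thesis by (simp only: zpoly_def Pair mode_def prod.case Phi_nth mult_ac)
qed

lemma harmonic_Phi: "harmonic m d (Phi q) = mode m (ultra (nat \<bar>m\<bar>) d) q"
  by (simp add: harmonic_def zpoly_Phi)

lemma continuous_mode: "continuous_on A (mode m r)"
  using continuous_smooth_Phi[OF smooth_zpoly[of "if m \<ge> 0 then 1 else -1" "nat \<bar>m\<bar>" r], of A]
  by (simp add: zpoly_Phi)

lemma mode_L2 [simp]: "mode m r \<in> L2 sigma_measure"
  by (rule continuous_L2_sigma[OF continuous_mode])

lemma ip_mode_sphere: "ip sphere_measure (harmonic m d) (harmonic m' d')
   = ip sigma_measure (mode m (ultra (nat \<bar>m\<bar>) d)) (mode m' (ultra (nat \<bar>m'\<bar>) d'))"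
  by (simp add: ip_sphere smooth_borel smooth_harmonic harmonic_Phi)

text \<open>Eigenfunctions of a symmetric operator for different eigenvalues: at fixed order,
  \<open>eigval m d\<close> is strictly increasing in \<open>d\<close>.\<close>

lemma ip_mode_orthogonal_degree:
  assumes "d \<noteq> d'"
  shows "ip sigma_measure (mode m (ultra (nat \<bar>m\<bar>) d)) (mode m (ultra (nat \<bar>m\<bar>) d')) = 0"
proof -
  let ?h = "harmonic m d" and ?h' = "harmonic m d'"
  have L: "ip sphere_measure (L_smooth (harmonic m d)) v = - complex_of_real (eigval m d) * ip sphere_measure (harmonic m d) v"
    if "v \<in> sphere_smooth" for v d
    by (subst ip_cong_AE[OF L_smooth_harmonic])
       (use that in \<open>auto intro!: smooth_L2 smooth_L_smooth smooth_harmonic L2_scale L2_uminus simp: ip_scale ip_uminus smooth_L2 smooth_harmonic\<close>)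
  have "ip sphere_measure ?h (L_smooth ?h') = cnj (ip sphere_measure (L_smooth ?h') ?h)" by (rule ip_cnj)
  also have "\<dots> = - complex_of_real (eigval m d') * ip sphere_measure ?h ?h'"
    unfolding L[OF smooth_harmonic] by (simp flip: ip_cnj)
  finally have "- complex_of_real (eigval m d) * ip sphere_measure ?h ?h' = - complex_of_real (eigval m d') * ip sphere_measure ?h ?h'"
    using L_smooth_symmetric[OF smooth_harmonic smooth_harmonic, of m d m d'] L[OF smooth_harmonic, of d m d'] by simp
  moreover have "eigval m d \<noteq> eigval m d'"
  proof -
    have "eigval m i < eigval m j" if "i < j" for i j
    proof -
      have "i * (2 * nat \<bar>m\<bar> + i + 1) < j * (2 * nat \<bar>m\<bar> + j + 1)"
        using that by (intro mult_strict_mono) auto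
      then show ?thesis by (simp only: eigval_def of_nat_less_iff add_less_cancel_right)
    qed
    then show ?thesis using assms by (metis less_irrefl linorder_neqE_nat)
  qed
  ultimately have "ip sphere_measure ?h ?h' = 0" by simp
  then show ?thesis by (simp add: ip_mode_sphere)
qed

lemma integral_cis_eq_0:
  assumes "k \<noteq> 0"
  shows "integral {0..2*pi} (\<lambda>y. cis (of_int k * y)) = 0"
proof -
  have "((\<lambda>y. cis (of_int k * y)) has_integral (cis (of_int k * (2*pi)) / (\<i> * of_int k) - cis (of_int k * 0) / (\<i> * of_int k))) {0..2*pi}"
  proof (rule fundamental_theorem_of_calculus)
    fix y
    have "((\<lambda>y. exp (\<i> * of_int k * of_real y) / (\<i> * of_int k)) has_vector_derivative exp (\<i> * of_int k * of_real y)) (at y within {0..2*pi})"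
      using assms by (auto intro!: derivative_eq_intros has_vector_derivative_real_field)
    then show "((\<lambda>y. cis (of_int k * y) / (\<i> * of_int k)) has_vector_derivative cis (of_int k * y)) (at y within {0..2*pi})"
      by (simp add: cis_conv_exp mult.assoc)
  qed simp
  moreover have "cis (of_int k * (2*pi)) = 1"
    using cis_multiple_2pi[of "of_int k"] by (simp add: mult_ac)
  ultimately show ?thesis by (simp add: integral_unique)
qed

lemma cis_mult_cnj: "cis (of_int m * y) * cnj (cis (of_int m' * y)) = cis (of_int (m - m') * y)"
  by (simp add: cis_cnj cis_mult left_diff_distrib)

lemma ip_mode_orthogonal_order:
  assumes "m \<noteq> m'"
  shows "ip sigma_measure (mode m r) (mode m' r') = 0"
proof -
  define h where "h x = cos x *\<^sub>R (complex_of_real (cos x ^ nat \<bar>m\<bar>) * poly r (complex_of_real (sin x)) *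
     cnj (complex_of_real (cos x ^ nat \<bar>m'\<bar>) * poly r' (complex_of_real (sin x))))" for x
  have "ip sigma_measure (mode m r) (mode m' r') = integral {-(pi/2)..pi/2} (\<lambda>x. integral {0..2*pi} (\<lambda>y. cos x *\<^sub>R (mode m r (x, y) * cnj (mode m' r' (x, y)))))"
    unfolding ip_def by (intro sigma_integral_continuous continuous_intros continuous_mode)
  also have "\<dots> = integral {-(pi/2)..pi/2} (\<lambda>x. integral {0..2*pi} (\<lambda>y. h x * cis (of_int (m - m') * y)))"
  proof -
    have "cos x *\<^sub>R (mode m r (x, y) * cnj (mode m' r' (x, y))) = h x * cis (of_int (m - m') * y)" for x y
      unfolding cis_mult_cnj[symmetric] by (simp add: mode_def h_def scaleR_conv_of_real mult_ac)
    then show ?thesis by (simp only:)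
  qed
  also have "\<dots> = 0"
    using assms by (simp only: Henstock_Kurzweil_Integration.integral_mult_right integral_cis_eq_0 mult_zero_right) simp
  finally show ?thesis .
qed

lemma sqn_mode: "sqn sigma_measure (mode m r) = 2 * pi * integral {-(pi/2)..pi/2} (\<lambda>x. cos x * (cos x ^ (2 * nat \<bar>m\<bar>) * (cmod (poly r (complex_of_real (sin x))))\<^sup>2))"
proof -
  have "sqn sigma_measure (mode m r) = integral {-(pi/2)..pi/2} (\<lambda>x. integral {0..2*pi} (\<lambda>y. cos x *\<^sub>R (cmod (mode m r (x, y)))\<^sup>2))"
    unfolding sqn_def by (intro sigma_integral_continuous continuous_intros continuous_mode)
  also have "\<dots> = integral {-(pi/2)..pi/2} (\<lambda>x. 2 * pi * (cos x * (cos x ^ (2 * nat \<bar>m\<bar>) * (cmod (poly r (complex_of_real (sin x))))\<^sup>2)))"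
  proof -
    have c: "(cmod (complex_of_real (cos x ^ n)))\<^sup>2 = cos x ^ (2 * n)" for x n
      by (simp add: power_mult[symmetric] mult.commute del: of_real_power)
    have "cos x *\<^sub>R (cmod (mode m r (x, y)))\<^sup>2 = cos x * (cos x ^ (2 * nat \<bar>m\<bar>) * (cmod (poly r (complex_of_real (sin x))))\<^sup>2)" for x y
      by (simp only: mode_def prod.case norm_mult power_mult_distrib c norm_cis) simp
    moreover have "integral {0..2*pi} (\<lambda>y. c) = 2 * pi * c" for c :: real by simp
    ultimately show ?thesis by (simp only:)
  qed
  finally show ?thesis by (simp only: Henstock_Kurzweil_Integration.integral_mult_right)
qed

text \<open>A zero norm would force the polynomial to vanish at \<open>sin x\<close> for all
  \<open>x\<close> in \<open>(0, pi/2)\<close>, where the weight is positive: infinitely many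
  zeros.\<close>

lemma sqn_mode_pos:
  assumes "r \<noteq> 0" shows "sqn sigma_measure (mode m r) > 0"
proof (rule ccontr)
  assume "\<not> ?thesis"
  then have "sqn sigma_measure (mode m r) = 0" using sqn_nonneg[of sigma_measure "mode m r"] by linarith
  then have z: "integral (cbox (-(pi/2)) (pi/2)) (\<lambda>x. cos x * (cos x ^ (2 * nat \<bar>m\<bar>) * (cmod (poly r (complex_of_real (sin x))))\<^sup>2)) = 0"
    by (simp add: sqn_mode)
  have "\<forall>x\<in>cbox (-(pi/2)) (pi/2). cos x * (cos x ^ (2 * nat \<bar>m\<bar>) * (cmod (poly r (complex_of_real (sin x))))\<^sup>2) = 0"
  proof (subst integral_cbox_eq_0_iff[symmetric])
    show "box (-(pi/2)) (pi/2) \<noteq> {}" by (simp add: not_le)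
    show "continuous_on (cbox (-(pi/2)) (pi/2)) (\<lambda>x. cos x * (cos x ^ (2 * nat \<bar>m\<bar>) * (cmod (poly r (complex_of_real (sin x))))\<^sup>2))"
      by (intro continuous_intros)
  qed (use z in \<open>auto intro!: mult_nonneg_nonneg cos_ge_zero zero_le_power\<close>)
  then have "poly r (complex_of_real (sin x)) = 0" if "x \<in> {0<..<pi/2}" for x
    using that cos_gt_zero_pi[of x] by (force simp: less_imp_neq[symmetric])
  then have "(\<lambda>x. complex_of_real (sin x)) ` {0<..<pi/2} \<subseteq> {z. poly r z = 0}" by auto
  then have "finite ((\<lambda>x. complex_of_real (sin x)) ` {0<..<pi/2})"
    by (rule finite_subset) (rule poly_roots_finite[OF assms])
  moreover have "inj_on (\<lambda>x. complex_of_real (sin x)) {0<..<pi/2}"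
  proof (rule inj_onI)
    fix x y assume "x \<in> {0<..<pi/2}" "y \<in> {0<..<pi/2}" "complex_of_real (sin x) = complex_of_real (sin y)"
    then show "x = y" using sin_inj_pi[of x y] by simp
  qed
  ultimately have "finite {0<..<pi/2}" by (rule finite_imageD)
  then show False using infinite_Ioo[of 0 "pi/2"] by simp
qed

section \<open>Completeness and the diagonalization of the Grushin operator\<close>

lemma ip_cong_AE_right:
  assumes "AE x in M. f x = g x" "f \<in> L2 M" "g \<in> L2 M" "h \<in> L2 M"
  shows "ip M h f = ip M h g"
  using ip_cong_AE[OF assms] by (metis ip_cnj)

lemma ip_scale_right:
  assumes "f \<in> L2 M" "h \<in> L2 M"
  shows "ip M h (\<lambda>x. c * f x) = cnj c * ip M h f"
proof -
  have "ip M h (\<lambda>x. c * f x) = cnj (ip M (\<lambda>x. c * f x) h)" by (rule ip_cnj)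
  also have "\<dots> = cnj c * cnj (ip M f h)" by (simp add: ip_scale assms)
  finally show ?thesis by (simp flip: ip_cnj)
qed

lemma Cauchy_Schwarz_ip:
  assumes f: "f \<in> L2 M" and h: "h \<in> L2 M"
  shows "(cmod (ip M f h))\<^sup>2 \<le> sqn M f * sqn M h"
proof (cases "sqn M h = 0")
  case True
  then have "AE x in M. h x = 0" by (rule sqn_0_AE[OF h])
  then have "ip M f h = ip M f (\<lambda>x. 0)" by (rule ip_cong_AE_right) (use f h in auto)
  then show ?thesis using True by (simp add: ip_def)
next
  case False
  then have pos: "sqn M h > 0" using sqn_nonneg[of M h] by linarith
  define c where "c = ip M f h / complex_of_real (sqn M h)"
  have "Re (ip M f (\<lambda>x. c * h x)) = (cmod (ip M f h))\<^sup>2 / sqn M h"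
    unfolding ip_scale_right[OF h f] c_def
    by (simp add: cmod_power2 add_divide_distrib) (simp add: power2_eq_square)
  moreover have "(cmod c)\<^sup>2 * sqn M h = (cmod (ip M f h))\<^sup>2 / sqn M h"
    using pos by (simp add: c_def norm_divide power_divide power2_eq_square)
  ultimately have "sqn M (\<lambda>x. f x - c * h x) = sqn M f - (cmod (ip M f h))\<^sup>2 / sqn M h"
    by (simp add: sqn_diff f h L2_scale sqn_scale)
  then have "(cmod (ip M f h))\<^sup>2 / sqn M h \<le> sqn M f"
    using sqn_nonneg[of M "\<lambda>x. f x - c * h x"] by linarith
  then show ?thesis using pos by (simp add: field_simps)
qed

text \<open>Parseval's identity for inner products; Cauchy-Schwarz reduces it to the convergence in
  norm of the partial sums of \<open>g\<close>.\<close>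

lemma (in onb) ip_series:
  assumes f: "f \<in> L2 M" and g: "g \<in> L2 M"
  shows "(\<lambda>N. \<Sum>j<N. cnj (cf g j) * cf f j) \<longlonglongrightarrow> ip M f g"
proof -
  have d: "(\<lambda>x. g x - comb {..<N} (cf g) x) \<in> L2 M" for N by (intro L2_diff g) simp
  have "(\<lambda>N. (cmod (ip M f (\<lambda>x. g x - comb {..<N} (cf g) x)))\<^sup>2) \<longlonglongrightarrow> 0"
  proof (rule tendsto_sandwich[OF _ _ tendsto_const])
    show "(\<lambda>N. sqn M f * sqn M (\<lambda>x. g x - comb {..<N} (cf g) x)) \<longlonglongrightarrow> 0"
      using tendsto_mult_right_zero[OF sqn_minus_comb_tendsto[OF g]] .
  qed (auto intro!: always_eventually Cauchy_Schwarz_ip[OF f d])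
  then have "(\<lambda>N. sqrt ((cmod (ip M f (\<lambda>x. g x - comb {..<N} (cf g) x)))\<^sup>2)) \<longlonglongrightarrow> sqrt 0"
    by (rule tendsto_real_sqrt)
  then have "(\<lambda>N. ip M f (\<lambda>x. g x - comb {..<N} (cf g) x)) \<longlonglongrightarrow> 0"
    by (simp add: tendsto_norm_zero_iff)
  moreover have "ip M f (\<lambda>x. g x - comb {..<N} (cf g) x) = ip M f g - (\<Sum>j<N. cnj (cf g j) * cf f j)" for N
  proof -
    have "ip M f (\<lambda>x. g x - comb {..<N} (cf g) x) = cnj (ip M g f) - cnj (ip M (comb {..<N} (cf g)) f)"
      by (subst ip_cnj) (simp add: ip_diff f g)
    then show ?thesis by (simp add: ip_comb[OF f] flip: ip_cnj)
  qed
  ultimately have "(\<lambda>N. ip M f g - (\<Sum>j<N. cnj (cf g j) * cf f j)) \<longlonglongrightarrow> 0" by simp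
  from tendsto_diff[OF tendsto_const[of "ip M f g"] this] show ?thesis by simp
qed

section \<open>Completeness of the spherical harmonics\<close>

inductive_set mode_span :: "(real \<times> real \<Rightarrow> complex) set" where
  mode: "mode m r \<in> mode_span"
| add: "f \<in> mode_span \<Longrightarrow> g \<in> mode_span \<Longrightarrow> (\<lambda>q. f q + g q) \<in> mode_span"

text \<open>Multipliers of the span are closed under products for trivial reasons, unlike members of
  the span. Polynomials in the coordinates thus become multipliers, and enter the span by acting on
  the constant 1.\<close>

definition mode_mult :: "(real \<times> real \<Rightarrow> complex) \<Rightarrow> bool" where
  "mode_mult g \<longleftrightarrow> (\<forall>f\<in>mode_span. (\<lambda>q. g q * f q) \<in> mode_span)"

lemma mode_multI:
  assumes "\<And>m r. (\<lambda>q. g q * mode m r q) \<in> mode_span"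
  shows "mode_mult g"
  unfolding mode_mult_def
proof
  fix f assume "f \<in> mode_span"
  then show "(\<lambda>q. g q * f q) \<in> mode_span"
  proof induction
    case (add f h)
    then show ?case using mode_span.add[OF add.IH] by (simp add: distrib_left)
  qed (rule assms)
qed

lemma mode_mult_add: "mode_mult g \<Longrightarrow> mode_mult h \<Longrightarrow> mode_mult (\<lambda>q. g q + h q)"
  unfolding mode_mult_def by (auto simp: distrib_right intro: mode_span.add)

lemma mode_mult_mult: "mode_mult g \<Longrightarrow> mode_mult h \<Longrightarrow> mode_mult (\<lambda>q. g q * h q)"
  unfolding mode_mult_def by (auto simp: mult.assoc)

lemma mode_mult_const: "mode_mult (\<lambda>q. c)"
proof (rule mode_multI)
  fix m r
  have "(\<lambda>q. c * mode m r q) = mode m (smult c r)" by (auto simp: mode_def fun_eq_iff)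
  then show "(\<lambda>q. c * mode m r q) \<in> mode_span" by (simp add: mode_span.mode)
qed

lemma mode_mult_sin: "mode_mult (\<lambda>(x, y). complex_of_real (sin x))"
proof (rule mode_multI)
  fix m r
  have "(\<lambda>q. (case q of (x, y) \<Rightarrow> complex_of_real (sin x)) * mode m r q) = mode m (pCons 0 r)"
    by (auto simp: mode_def fun_eq_iff)
  then show "(\<lambda>q. (case q of (x, y) \<Rightarrow> complex_of_real (sin x)) * mode m r q) \<in> mode_span"
    by (simp add: mode_span.mode)
qed

text \<open>Multiplication by \<open>cos x e\<^sup>\<plusminus>\<^sup>i\<^sup>y\<close> raises or lowers the order; when \<open>\<bar>m\<bar>\<close> decreases,
  the surplus factor \<open>cos\<^sup>2 x = 1 - sin\<^sup>2 x\<close> goes into the polynomial.\<close>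

lemma mode_mult_cos_cis:
  assumes k: "k = 1 \<or> k = (-1 :: int)"
  shows "mode_mult (\<lambda>(x, y). complex_of_real (cos x) * cis (of_int k * y))"
proof (rule mode_multI)
  fix m r
  have cis: "cis (of_int k * y) * cis (of_int m * y) = cis (of_int (m + k) * y)" for y
    by (simp add: cis_mult algebra_simps)
  show "(\<lambda>q. (case q of (x, y) \<Rightarrow> complex_of_real (cos x) * cis (of_int k * y)) * mode m r q) \<in> mode_span"
  proof (cases "nat \<bar>m + k\<bar> = Suc (nat \<bar>m\<bar>)")
    case True
    have "(\<lambda>q. (case q of (x, y) \<Rightarrow> complex_of_real (cos x) * cis (of_int k * y)) * mode m r q) = mode (m + k) r"
    proof (intro ext, clarify)
      fix x y
      have "complex_of_real (cos x) * cis (of_int k * y) * mode m r (x, y) =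
        (cis (of_int k * y) * cis (of_int m * y)) * complex_of_real (cos x ^ Suc (nat \<bar>m\<bar>)) * poly r (complex_of_real (sin x))"
        unfolding mode_def by (simp add: mult_ac)
      also have "\<dots> = mode (m + k) r (x, y)"
        unfolding cis mode_def True by simp
      finally show "complex_of_real (cos x) * cis (of_int k * y) * mode m r (x, y) = mode (m + k) r (x, y)" .
    qed
    then show ?thesis by (simp add: mode_span.mode)
  next
    case False
    with k have n: "nat \<bar>m\<bar> = Suc (nat \<bar>m + k\<bar>)" by auto
    have c: "complex_of_real (cos x) * complex_of_real (cos x) = 1 - (complex_of_real (sin x))\<^sup>2" for x
      by (simp add: sin_squared_eq power2_eq_square[symmetric] flip: of_real_power of_real_mult)
    have "(\<lambda>q. (case q of (x, y) \<Rightarrow> complex_of_real (cos x) * cis (of_int k * y)) * mode m r q) = mode (m + k) ([:1, 0, -1:] * r)"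
    proof (intro ext, clarify)
      fix x y
      have "complex_of_real (cos x) * cis (of_int k * y) * mode m r (x, y) =
        (cis (of_int k * y) * cis (of_int m * y)) * complex_of_real (cos x ^ nat \<bar>m + k\<bar>) * ((complex_of_real (cos x) * complex_of_real (cos x)) * poly r (complex_of_real (sin x)))"
        unfolding mode_def n by (simp add: mult_ac)
      also have "\<dots> = mode (m + k) ([:1, 0, -1:] * r) (x, y)"
        unfolding cis c mode_def by (simp add: power2_eq_square algebra_simps)
      finally show "complex_of_real (cos x) * cis (of_int k * y) * mode m r (x, y) = mode (m + k) ([:1, 0, -1:] * r) (x, y)" .
    qed
    then show ?thesis by (simp add: mode_span.mode)
  qed
qed

lemma mode_mult_coordinate: "mode_mult (\<lambda>q. complex_of_real (Phi q $ i))"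
proof -
  have "i = 1 \<or> i = 2 \<or> i = 3" by (rule exhaust_3)
  moreover have "(\<lambda>q. complex_of_real (Phi q $ 1)) = (\<lambda>q. (1/2) * ((case q of (x, y) \<Rightarrow> complex_of_real (cos x) * cis (of_int 1 * y)) + (case q of (x, y) \<Rightarrow> complex_of_real (cos x) * cis (of_int (-1) * y))))"
    by (auto simp: fun_eq_iff complex_eq_iff)
  moreover have "(\<lambda>q. complex_of_real (Phi q $ 2)) = (\<lambda>q. (- \<i>/2) * ((case q of (x, y) \<Rightarrow> complex_of_real (cos x) * cis (of_int 1 * y)) + (- 1) * (case q of (x, y) \<Rightarrow> complex_of_real (cos x) * cis (of_int (-1) * y))))"
    by (auto simp: fun_eq_iff complex_eq_iff)
  moreover have "(\<lambda>q. complex_of_real (Phi q $ 3)) = (\<lambda>(x, y). complex_of_real (sin x))"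
    by (auto simp: fun_eq_iff)
  ultimately show ?thesis
    by (elim disjE; simp only:; intro mode_mult_mult mode_mult_add mode_mult_const mode_mult_sin mode_mult_cos_cis; simp)
qed

lemma mode_mult_sum: "(\<And>i. i \<in> I \<Longrightarrow> mode_mult (g i)) \<Longrightarrow> mode_mult (\<lambda>q. \<Sum>i\<in>I. g i q)"
  by (induction I rule: infinite_finite_induct) (auto intro: mode_mult_add mode_mult_const)

lemma real_polynomial_in_mode_span:
  assumes "real_polynomial_function (G :: real^3 \<Rightarrow> real)"
  shows "(\<lambda>q. complex_of_real (G (Phi q))) \<in> mode_span"
proof -
  have "mode_mult (\<lambda>q. complex_of_real (G (Phi q)))"
    using assms
  proof induction
    case (linear f)
    then interpret bounded_linear f .
    have lin: "f p = (\<Sum>i\<in>UNIV. p $ i * f (axis i 1))" for p :: "real^3"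
    proof -
      have "p = (\<Sum>i\<in>UNIV. (p $ i) *\<^sub>R axis i 1)" by (simp add: basis_expansion scalar_mult_eq_scaleR[symmetric])
      then have "f p = f (\<Sum>i\<in>UNIV. (p $ i) *\<^sub>R axis i 1)" by simp
      then show ?thesis by (simp add: sum scaleR)
    qed
    have "(\<lambda>q. complex_of_real (f (Phi q))) = (\<lambda>q. \<Sum>i\<in>UNIV. complex_of_real (Phi q $ i) * complex_of_real (f (axis i 1)))"
      by (rule ext, subst lin) simp
    then show ?case by (simp only:) (intro mode_mult_sum mode_mult_mult mode_mult_coordinate mode_mult_const)
  next
    case (const c)
    then show ?case by (rule mode_mult_const)
  next
    case (add f g)
    then show ?case by (simp add: mode_mult_add)
  next
    case (mult f g)
    then show ?case by (simp add: mode_mult_mult)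
  qed
  moreover have "(\<lambda>q. 1) \<in> mode_span"
    using mode_span.mode[of 0 1] by (simp add: mode_def case_prod_unfold)
  ultimately show ?thesis by (force simp: mode_mult_def)
qed

text \<open>There is one \<open>ultra n d\<close> in each degree, so leading terms can be removed
  successively.\<close>

lemma poly_span_ultra:
  assumes "P 0" "\<And>p q. P p \<Longrightarrow> P q \<Longrightarrow> P (p + q)" "\<And>c d. P (smult c (ultra n d))"
  shows "P r"
proof (induction "degree r" arbitrary: r rule: less_induct)
  case less
  show ?case
  proof (cases "degree r = 0")
    case True
    have u: "degree (ultra n 0) = 0" "ultra n 0 \<noteq> 0" by (simp_all add: degree_ultra ultra_nonzero)
    then obtain b where b: "ultra n 0 = [:b:]" by (auto elim: degree_eq_zeroE)
    from True obtain a where "r = [:a:]" by (auto elim: degree_eq_zeroE)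
    then have "r = smult (a / b) (ultra n 0)" using b u by auto
    then show ?thesis using assms(3) by metis
  next
    case False
    define d where "d = degree r"
    define c where "c = lead_coeff r / lead_coeff (ultra n d)"
    define s where "s = r - smult c (ultra n d)"
    have "lead_coeff (ultra n d) \<noteq> 0" using ultra_nonzero by simp
    then have "coeff s d = 0" by (simp add: s_def c_def d_def degree_ultra)
    moreover have "degree s \<le> d"
      unfolding s_def by (rule degree_diff_le) (auto simp: d_def degree_ultra intro: order_trans[OF degree_smult_le])
    ultimately have "degree s < degree r"
      using False by (metis d_def degree_0 eq_zero_or_degree_less neq0_conv)
    from less[OF this] assms(2)[OF _ assms(3)[of c d], of s] show ?thesis by (simp add: s_def)
  qed
qed

text \<open>An inverse of \<open>Phi\<close> on \<open>Omega\<close> given by a formula, unlike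
  \<open>inv_into\<close>, and therefore visibly Borel. Clamping extends \<open>arcsin\<close> and
  \<open>arccos\<close> continuously to all reals; the sign of the second coordinate decides between
  \<open>t\<close> and \<open>2 * pi - t\<close>.\<close>

definition Psi :: "real^3 \<Rightarrow> real \<times> real" where
  "Psi p = (let clamp = (\<lambda>z::real. max (-1) (min 1 z)); t = arccos (clamp (p $ 1 / sqrt (1 - (p $ 3)\<^sup>2)))
     in (arcsin (clamp (p $ 3)), if p $ 2 \<ge> 0 then t else 2 * pi - t))"

lemma Psi_Phi: "q \<in> Omega \<Longrightarrow> Psi (Phi q) = q"
proof -
  assume "q \<in> Omega"
  then obtain x y where q: "q = (x, y)" and x: "-(pi/2) < x" "x < pi/2" and y: "0 \<le> y" "y < 2 * pi"
    by (auto simp: Omega_def)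
  have c: "cos x > 0" using x by (intro cos_gt_zero_pi)
  have s: "sqrt (1 - (sin x)\<^sup>2) = cos x" using c by (simp add: sin_squared_eq real_sqrt_unique)
  have cl: "max (- 1) (min 1 (sin z)) = sin z" "max (- 1) (min 1 (cos z)) = cos z" for z :: real by auto
  have a1: "arcsin (sin x) = x" using x by (intro arcsin_sin) auto
  have a0: "cos x * cos y / cos x = cos y" using c by simp
  have a2: "(if cos x * sin y \<ge> 0 then arccos (cos y) else 2 * pi - arccos (cos y)) = y"
  proof (cases "y \<le> pi")
    case True
    then have "sin y \<ge> 0" using y by (intro sin_ge_zero) auto
    then show ?thesis using c y True by (simp add: arccos_cos)
  next
    case False
    then have "sin y < 0" using y by (intro sin_lt_zero) auto
    then have "\<not> cos x * sin y \<ge> 0" using c by (simp add: not_le mult_pos_neg)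
    moreover have "cos y = cos (2 * pi - y)" by (simp add: cos_diff)
    then have "arccos (cos y) = 2 * pi - y" using False y by (simp only:) (intro arccos_cos; simp)
    ultimately show ?thesis by simp
  qed
  show ?thesis by (simp only: Psi_def q Let_def Phi_nth s cl a0 a1 a2)
qed

lemma Psi_measurable [measurable]: "Psi \<in> borel_measurable borel"
proof -
  have cc: "continuous_on UNIV (\<lambda>z::real. arccos (max (-1) (min 1 z)))" "continuous_on UNIV (\<lambda>z::real. arcsin (max (-1) (min 1 z)))"
    by (intro continuous_on_arccos continuous_on_arcsin continuous_intros; auto)+
  have nth: "(\<lambda>p::real^3. p $ i) \<in> borel_measurable borel" for i
    by (intro borel_measurable_continuous_onI continuous_intros)
  note [measurable] = nth[of 1] nth[of 2] nth[of 3]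
  have [measurable]: "(\<lambda>p::real^3. arccos (max (-1) (min 1 (p $ 1 / sqrt (1 - (p $ 3)\<^sup>2))))) \<in> borel_measurable borel"
    by (rule measurable_compose[OF _ borel_measurable_continuous_onI[OF cc(1)]])
       measurable
  have [measurable]: "(\<lambda>p::real^3. arcsin (max (-1) (min 1 (p $ 3)))) \<in> borel_measurable borel"
    by (rule measurable_compose[OF nth borel_measurable_continuous_onI[OF cc(2)]])
  show ?thesis unfolding Psi_def[abs_def] Let_def borel_prod[symmetric] by measurable
qed

lemma L2_finite_integrable:
  assumes "finite_measure M" "f \<in> L2 M" shows "integrable M f"
proof -
  interpret finite_measure M by fact
  have "integrable M (\<lambda>x. f x * cnj ((\<lambda>x. 1) x))"
    by (rule L2_mult_integrable[OF assms(2)]) (simp add: L2_def)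
  then show ?thesis by simp
qed

text \<open>Stone-Weierstrass is applied on the compact sphere, where polynomials are finite sums of
  modes. Orthogonality thus passes to continuous functions, from there to indicators of closed sets,
  and by a Dynkin argument to all Borel sets, after which all averages of \<open>v\<close>
  vanish.\<close>

lemma sigma_complete_sphere_polynomials:
  assumes v: "v \<in> L2 sigma_measure"
    and orth: "\<And>m d. ip sigma_measure v (mode m (ultra (nat \<bar>m\<bar>) d)) = 0"
  shows "AE q in sigma_measure. v q = 0"
proof -
  have vi: "integrable sigma_measure v" by (rule L2_finite_integrable[OF finite_measure_sigma v])
  have mode0: "ip sigma_measure (mode m r) v = 0" for m r
  proof (rule poly_span_ultra[where P = "\<lambda>r. ip sigma_measure (mode m r) v = 0" and n = "nat \<bar>m\<bar>"])
    show "ip sigma_measure (mode m 0) v = 0" by (simp add: mode_def ip_def case_prod_unfold)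
    fix p q assume "ip sigma_measure (mode m p) v = 0" "ip sigma_measure (mode m q) v = 0"
    moreover have "mode m (p + q) = (\<lambda>z. mode m p z + mode m q z)"
      by (auto simp: mode_def fun_eq_iff algebra_simps)
    ultimately show "ip sigma_measure (mode m (p + q)) v = 0" by (simp add: ip_add v)
  next
    fix c d
    have "mode m (smult c (ultra (nat \<bar>m\<bar>) d)) = (\<lambda>z. c * mode m (ultra (nat \<bar>m\<bar>) d) z)"
      by (auto simp: mode_def fun_eq_iff)
    moreover have "ip sigma_measure (mode m (ultra (nat \<bar>m\<bar>) d)) v = 0"
      using orth[of m d] by (metis ip_cnj complex_cnj_zero)
    ultimately show "ip sigma_measure (mode m (smult c (ultra (nat \<bar>m\<bar>) d))) v = 0"
      by (simp add: ip_scale v)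
  qed
  have span: "f \<in> L2 sigma_measure \<and> ip sigma_measure f v = 0" if "f \<in> mode_span" for f
    using that by induction (auto simp: mode0 ip_add v intro: L2_add)
  have poly0: "(LINT q|sigma_measure. complex_of_real (G (Phi q)) * v q) = 0" if "real_polynomial_function G" for G
  proof -
    have "ip sigma_measure v (\<lambda>q. complex_of_real (G (Phi q))) = 0"
      using span[OF real_polynomial_in_mode_span[OF that]] by (metis ip_cnj complex_cnj_zero)
    then show ?thesis by (simp add: ip_def mult.commute)
  qed
  have vm [measurable]: "v \<in> borel_measurable sigma_measure" by (rule L2_measurable[OF v])
  have bi: "integrable sigma_measure (\<lambda>q. complex_of_real (F (Phi q)) * v q)"
    if [measurable]: "F \<in> borel_measurable (restrict_space borel (sphere 0 1))" and b: "\<And>p. p \<in> sphere 0 1 \<Longrightarrow> \<bar>F p\<bar> \<le> B" for F B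
  proof (rule Bochner_Integration.integrable_bound)
    show "integrable sigma_measure (\<lambda>q. B * cmod (v q))" using vi by simp
    show "AE q in sigma_measure. norm (complex_of_real (F (Phi q)) * v q) \<le> norm (B * cmod (v q))"
    proof (rule AE_I2)
      fix q
      have "\<bar>F (Phi q)\<bar> * cmod (v q) \<le> B * cmod (v q)" by (intro mult_right_mono b Phi_sphere) simp
      moreover have "0 \<le> \<bar>F (Phi q)\<bar> * cmod (v q)" by simp
      ultimately show "norm (complex_of_real (F (Phi q)) * v q) \<le> norm (B * cmod (v q))"
        by (simp add: norm_mult)
    qed
  qed measurable
  have cont0: "(LINT q|sigma_measure. complex_of_real (F (Phi q)) * v q) = 0" if F: "continuous_on (sphere 0 1) F" for F
  proof -
    define I where "I = (LINT q|sigma_measure. cmod (v q))"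
    have I0: "I \<ge> 0" by (simp add: I_def)
    have "cmod (LINT q|sigma_measure. complex_of_real (F (Phi q)) * v q) \<le> e * I" if e: "e > 0" for e
    proof -
      obtain G where G: "real_polynomial_function G" "\<And>p. p \<in> sphere 0 1 \<Longrightarrow> \<bar>F p - G p\<bar> < e"
        using Stone_Weierstrass_real_polynomial_function[OF compact_sphere F e] by blast
      have cG: "continuous_on (sphere 0 1) G"
        using G(1) by (intro continuous_on_polymonial_function real_polynomial_function_eq[THEN iffD1]) auto
      have bnd: "\<exists>B. \<forall>p\<in>sphere 0 1. \<bar>H p\<bar> \<le> B" if "continuous_on (sphere 0 1) H" for H :: "real^3 \<Rightarrow> real"
        using compact_imp_bounded[OF compact_continuous_image[OF that compact_sphere]]
        by (auto simp: bounded_iff)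
      obtain B C where B: "\<And>p. p \<in> sphere 0 1 \<Longrightarrow> \<bar>F p\<bar> \<le> B" and C: "\<And>p. p \<in> sphere 0 1 \<Longrightarrow> \<bar>G p\<bar> \<le> C"
        using bnd[OF F] bnd[OF cG] by blast
      have iF: "integrable sigma_measure (\<lambda>q. complex_of_real (F (Phi q)) * v q)"
        by (rule bi[OF borel_measurable_continuous_on_restrict[OF F] B])
      have iG: "integrable sigma_measure (\<lambda>q. complex_of_real (G (Phi q)) * v q)"
        by (rule bi[OF borel_measurable_continuous_on_restrict[OF cG] C])
      have "(LINT q|sigma_measure. complex_of_real (F (Phi q)) * v q) = (LINT q|sigma_measure. complex_of_real (F (Phi q)) * v q - complex_of_real (G (Phi q)) * v q)"
        using iF iG poly0[OF G(1)] by simp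
      also have "cmod \<dots> \<le> (LINT q|sigma_measure. cmod (complex_of_real (F (Phi q)) * v q - complex_of_real (G (Phi q)) * v q))"
        by (rule integral_norm_bound)
      also have "\<dots> \<le> (LINT q|sigma_measure. e * cmod (v q))"
      proof (rule integral_mono)
        show "integrable sigma_measure (\<lambda>q. cmod (complex_of_real (F (Phi q)) * v q - complex_of_real (G (Phi q)) * v q))"
          using iF iG by (intro integrable_norm Bochner_Integration.integrable_diff)
        show "integrable sigma_measure (\<lambda>q. e * cmod (v q))" using vi by simp
        fix q
        have "cmod (complex_of_real (F (Phi q)) * v q - complex_of_real (G (Phi q)) * v q) = \<bar>F (Phi q) - G (Phi q)\<bar> * cmod (v q)"
          by (simp only: left_diff_distrib[symmetric] of_real_diff[symmetric] norm_mult norm_of_real)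
        also have "\<dots> \<le> e * cmod (v q)"
          by (intro mult_right_mono less_imp_le[OF G(2)] Phi_sphere) simp
        finally show "cmod (complex_of_real (F (Phi q)) * v q - complex_of_real (G (Phi q)) * v q) \<le> e * cmod (v q)" .
      qed
      finally show ?thesis by (simp add: I_def)
    qed
    then have le: "cmod (LINT q|sigma_measure. complex_of_real (F (Phi q)) * v q) \<le> e * I" if "e > 0" for e using that by blast
    have "cmod (LINT q|sigma_measure. complex_of_real (F (Phi q)) * v q) \<le> 0"
    proof (rule field_le_epsilon)
      fix e :: real assume e: "e > 0"
      have "e / (I + 1) * I \<le> e" using I0 e by (simp add: field_simps)
      with le[of "e / (I + 1)"] e I0 show "cmod (LINT q|sigma_measure. complex_of_real (F (Phi q)) * v q) \<le> 0 + e"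
        by (smt (verit) divide_pos_pos)
    qed
    then show ?thesis by simp
  qed
  \<comment> \<open>Sets are pulled back from the sphere by \<open>Phi\<close>. No measurable set is
    lost: a measurable subset of \<open>Omega\<close> is the pullback of its preimage under
    \<open>Psi\<close>, which is Borel.\<close>
  define A where "A B = Phi -` B \<inter> Omega" for B
  have A_sets: "A B \<in> sets sigma_measure" if "B \<in> sets borel" for B
    using measurable_sets[OF borel_measurable_sigma[OF Phi_measurable_borel] that] by (simp add: A_def space_sigma)
  have si: "set_integrable sigma_measure S v" if "S \<in> sets sigma_measure" for S
    unfolding set_integrable_def by (rule integrable_mult_indicator[OF that vi])
  have closed0: "set_lebesgue_integral sigma_measure (A K) v = 0" if K: "closed K" for K
  proof (cases "K = {}")
    case True
    then show ?thesis by (simp add: A_def set_lebesgue_integral_def)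
  next
    case False
    \<comment> \<open>Continuous functions equal to 1 on \<open>K\<close> that decrease to its
      indicator, because the distance to a closed set is positive off it. For empty \<open>K\<close>
      the value of \<open>infdist\<close> is 0, hence the separate case.\<close>
    define F where "F k p = max 0 (1 - real k * infdist p K)" for k p
    have cF: "continuous_on S (F k)" for S k unfolding F_def by (intro continuous_intros)
    have F01: "0 \<le> F k p" "F k p \<le> 1" for k p
      unfolding F_def using mult_nonneg_nonneg[OF of_nat_0_le_iff infdist_nonneg, of k p K] by auto
    have "(\<lambda>k. LINT q|sigma_measure. complex_of_real (F k (Phi q)) * v q) \<longlonglongrightarrow> (LINT q|sigma_measure. indicator (A K) q *\<^sub>R v q)"
    proof (rule integral_dominated_convergence[where w = "\<lambda>q. cmod (v q)"])
      show "(\<lambda>q. indicat_real (A K) q *\<^sub>R v q) \<in> borel_measurable sigma_measure"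
        using A_sets[of K] K by (intro borel_measurable_scaleR borel_measurable_indicator vm) auto
      have "F k \<in> borel_measurable (restrict_space borel (sphere 0 1))" for k
        by (rule borel_measurable_continuous_on_restrict[OF cF])
      then show "(\<lambda>q. complex_of_real (F k (Phi q)) * v q) \<in> borel_measurable sigma_measure" for k
        by measurable
      show "integrable sigma_measure (\<lambda>q. cmod (v q))" using vi by simp
      show "AE q in sigma_measure. norm (complex_of_real (F k (Phi q)) * v q) \<le> cmod (v q)" for k
        using F01 by (intro AE_I2) (simp add: norm_mult mult_left_le_one_le)
      show "AE q in sigma_measure. (\<lambda>k. complex_of_real (F k (Phi q)) * v q) \<longlonglongrightarrow> indicat_real (A K) q *\<^sub>R v q"
      proof (rule AE_I2)
        fix q assume "q \<in> space sigma_measure"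
        then have q: "q \<in> Omega" by (simp add: space_sigma)
        have "(\<lambda>k. F k (Phi q)) \<longlonglongrightarrow> indicat_real (A K) q"
        proof (cases "Phi q \<in> K")
          case True
          then show ?thesis using q by (simp add: F_def A_def)
        next
          case notin: False
          then have pos: "infdist (Phi q) K > 0"
            using K False by (metis in_closed_iff_infdist_zero infdist_nonneg less_le)
          obtain k0 :: nat where k0: "1 / infdist (Phi q) K < k0" using reals_Archimedean2 by blast
          have "F k (Phi q) = 0" if "k \<ge> k0" for k
          proof -
            have "1 \<le> real k0 * infdist (Phi q) K" using k0 pos by (simp add: field_simps)
            also have "\<dots> \<le> real k * infdist (Phi q) K" using that pos by (intro mult_right_mono) auto
            finally show ?thesis by (simp add: F_def)
          qed
          then have "\<forall>\<^sub>F k in sequentially. F k (Phi q) = 0" by (auto simp: eventually_sequentially)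
          then show ?thesis using notin by (simp add: A_def tendsto_eventually)
        qed
        then have "(\<lambda>k. complex_of_real (F k (Phi q)) * v q) \<longlonglongrightarrow> complex_of_real (indicat_real (A K) q) * v q"
          by (intro tendsto_intros)
        then show "(\<lambda>k. complex_of_real (F k (Phi q)) * v q) \<longlonglongrightarrow> indicat_real (A K) q *\<^sub>R v q"
          by (simp add: scaleR_conv_of_real)
      qed
    qed
    then have "(\<lambda>k::nat. 0) \<longlonglongrightarrow> (LINT q|sigma_measure. indicator (A K) q *\<^sub>R v q)"
      by (simp only: cont0[OF cF])
    then show ?thesis unfolding set_lebesgue_integral_def by (simp add: LIMSEQ_const_iff)
  qed
  have all0: "set_lebesgue_integral sigma_measure (A B) v = 0" if "B \<in> sets borel" for B
  proof -
    have Is: "Int_stable (Collect closed :: (real^3) set set)" by (auto simp: Int_stable_def)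
    have Pw: "(Collect closed :: (real^3) set set) \<subseteq> Pow UNIV" by simp
    have sb: "sets borel = sigma_sets UNIV (Collect closed :: (real^3) set set)"
      by (simp add: borel_eq_closed sets_measure_of)
    have "B \<in> sigma_sets UNIV (Collect closed)" using that sb by simp
    then show ?thesis
    proof (induction rule: sigma_sets_induct_disjoint[OF Is Pw, consumes 1, case_names basic empty compl union])
      case (basic K)
      then show ?case using closed0 by simp
    next
      case (compl K)
      have Kb: "K \<in> sets borel" using compl sb by simp
      have "set_lebesgue_integral sigma_measure (A UNIV) v = set_lebesgue_integral sigma_measure (A K \<union> A (UNIV - K)) v"
        by (rule arg_cong[of _ _ "\<lambda>S. set_lebesgue_integral sigma_measure S v"]) (auto simp: A_def)
      also have "\<dots> = set_lebesgue_integral sigma_measure (A K) v + set_lebesgue_integral sigma_measure (A (UNIV - K)) v"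
        using Kb by (intro set_integral_Un si A_sets) (auto simp: A_def)
      finally show ?case using closed0[of UNIV] compl by simp
    next
      case (union K)
      have Kb: "K i \<in> sets borel" for i using union sb by auto
      have eq: "A (\<Union>i. K i) = (\<Union>i. A (K i))" by (auto simp: A_def)
      have "set_lebesgue_integral sigma_measure (\<Union>i. A (K i)) v = (\<Sum>i. set_lebesgue_integral sigma_measure (A (K i)) v)"
      proof (rule lebesgue_integral_countable_add)
        show "A (K i) \<in> sets sigma_measure" for i by (rule A_sets[OF Kb])
        show "A (K i) \<inter> A (K j) = {}" if "i \<noteq> j" for i j
          using union(1) that by (auto simp: A_def disjoint_family_on_def)
        show "set_integrable sigma_measure (\<Union>i. A (K i)) v"
          using A_sets[of "\<Union>i. K i"] Kb by (intro si) (auto simp: eq[symmetric])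
      qed
      then show ?case using union by (simp add: eq)
    qed (auto simp: A_def set_lebesgue_integral_def)
  qed
  have setsA: "\<exists>B\<in>sets borel. S = A B" if "S \<in> sets sigma_measure" for S
  proof -
    from that obtain S' where S': "S' \<in> sets borel" "S = S' \<inter> Omega"
      by (auto simp: sets_sigma sets_restrict_space)
    then have "S = A (Psi -` S)" using Psi_Phi by (auto simp: A_def)
    moreover have "Psi -` S \<in> sets borel"
      using measurable_sets[OF Psi_measurable, of S] S' by simp
    ultimately show ?thesis by blast
  qed
  have "AE q in sigma_measure. v q \<in> {0}"
  proof (rule sigma.averaging_theorem[OF vi])
    fix S assume "S \<in> sets sigma_measure"
    then obtain B where "B \<in> sets borel" "S = A B" using setsA by blast
    then show "(1 / measure sigma_measure S) *\<^sub>R set_lebesgue_integral sigma_measure S v \<in> {0}"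
      using all0 by simp
  qed simp
  then show ?thesis by simp
qed

section \<open>The orthonormal basis of normalized harmonics\<close>

definition basis_order :: "nat \<Rightarrow> int" where "basis_order j = int_decode (fst (prod_decode j))"
definition basis_degree :: "nat \<Rightarrow> nat" where "basis_degree j = snd (prod_decode j)"

definition norm_factor :: "int \<Rightarrow> nat \<Rightarrow> real" where
  "norm_factor m d = 1 / sqrt (sqn sigma_measure (mode m (ultra (nat \<bar>m\<bar>) d)))"

definition basis_fun :: "int \<Rightarrow> nat \<Rightarrow> real \<times> real \<Rightarrow> complex" where
  "basis_fun m d = (\<lambda>q. complex_of_real (norm_factor m d) * mode m (ultra (nat \<bar>m\<bar>) d) q)"

definition basis :: "nat \<Rightarrow> real \<times> real \<Rightarrow> complex" where
  "basis j = basis_fun (basis_order j) (basis_degree j)"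

definition basis_eigval :: "nat \<Rightarrow> real" where
  "basis_eigval j = eigval (basis_order j) (basis_degree j)"

definition basis_index :: "int \<Rightarrow> nat \<Rightarrow> nat" where
  "basis_index m d = prod_encode (int_encode m, d)"

lemma basis_index [simp]: "basis_order (basis_index m d) = m" "basis_degree (basis_index m d) = d"
  by (simp_all add: basis_index_def basis_order_def basis_degree_def)

lemma basis_index_inverse: "basis_index (basis_order j) (basis_degree j) = j"
  by (simp add: basis_index_def basis_order_def basis_degree_def)

lemma norm_factor_pos: "norm_factor m d > 0"
  by (simp add: norm_factor_def sqn_mode_pos ultra_nonzero)

lemma basis_fun_L2: "basis_fun m d \<in> L2 sigma_measure"
  unfolding basis_fun_def by (intro L2_scale mode_L2)

lemma ip_basis_fun: "ip sigma_measure (basis_fun m d) (basis_fun m' d') = (if m = m' \<and> d = d' then 1 else 0)"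
proof -
  have "ip sigma_measure (basis_fun m d) (basis_fun m' d') = complex_of_real (norm_factor m d) * (complex_of_real (norm_factor m' d')
    * ip sigma_measure (mode m (ultra (nat \<bar>m\<bar>) d)) (mode m' (ultra (nat \<bar>m'\<bar>) d')))"
    unfolding basis_fun_def by (simp add: ip_scale ip_scale_right L2_scale)
  also have "\<dots> = (if m = m' \<and> d = d' then 1 else 0)"
  proof (cases "m = m' \<and> d = d'")
    case True
    have "sqn sigma_measure (mode m (ultra (nat \<bar>m\<bar>) d)) > 0" by (rule sqn_mode_pos[OF ultra_nonzero])
    then have "norm_factor m d * (norm_factor m d * sqn sigma_measure (mode m (ultra (nat \<bar>m\<bar>) d))) = 1"
      by (simp add: norm_factor_def)
    then show ?thesis using True by (simp add: ip_self flip: of_real_mult)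
  next
    case False
    then show ?thesis by (cases "m = m'") (auto simp: ip_mode_orthogonal_order ip_mode_orthogonal_degree)
  qed
  finally show ?thesis .
qed

lemma eigval_ge: "eigval m d \<ge> real d" "eigval m d \<ge> real_of_int \<bar>m\<bar>"
  unfolding eigval_def by simp_all

interpretation D: diag sigma_measure basis basis_eigval
proof
  show "basis j \<in> L2 sigma_measure" for j by (simp add: basis_def basis_fun_L2)
  show "ip sigma_measure (basis i) (basis j) = (if i = j then 1 else 0)" for i j
  proof -
    have "basis_order i = basis_order j \<and> basis_degree i = basis_degree j \<longleftrightarrow> i = j"
      by (metis basis_index_inverse)
    then show ?thesis by (simp add: basis_def ip_basis_fun)
  qed
  show "AE q in sigma_measure. f q = 0" if f: "f \<in> L2 sigma_measure" and 0: "\<And>j. ip sigma_measure f (basis j) = 0" for f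
  proof (rule sigma_complete_sphere_polynomials[OF f])
    fix m d
    show "ip sigma_measure f (mode m (ultra (nat \<bar>m\<bar>) d)) = 0"
      using 0[of "basis_index m d"] norm_factor_pos[of m d]
      by (simp add: basis_def basis_fun_def ip_scale_right f)
  qed
  show "0 \<le> basis_eigval j" for j by (simp add: basis_eigval_def eigval_def)
  show "finite {k. basis_eigval k = basis_eigval j}" for j
  proof (rule finite_subset)
    \<comment> \<open>An eigenvalue bounds both the order and the degree, so only finitely many
      index pairs share it.\<close>
    let ?N = "nat \<lceil>basis_eigval j\<rceil>"
    show "{k. basis_eigval k = basis_eigval j} \<subseteq> (\<lambda>(m, d). basis_index m d) ` ({- int ?N..int ?N} \<times> {..?N})"
    proof
      fix k assume "k \<in> {k. basis_eigval k = basis_eigval j}"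
      then have "real (basis_degree k) \<le> basis_eigval j" "real_of_int \<bar>basis_order k\<bar> \<le> basis_eigval j"
        using eigval_ge[where m = "basis_order k" and d = "basis_degree k"] by (simp_all add: basis_eigval_def)
      then have "basis_degree k \<le> ?N" "\<bar>basis_order k\<bar> \<le> int ?N" by linarith+
      then show "k \<in> (\<lambda>(m, d). basis_index m d) ` ({- int ?N..int ?N} \<times> {..?N})"
        by (intro image_eqI[of _ _ "(basis_order k, basis_degree k)"]) (auto simp: basis_index_inverse)
    qed
  qed simp
qed

section \<open>The Grushin operator as a diagonal operator\<close>

lemma T_Phi_Phi: "q \<in> Omega \<Longrightarrow> T_Phi v (Phi q) = v q"
  using bij_betw_imp_inj_on[OF Phi_bij_betw] by (simp add: T_Phi_def inv_into_f_f)

text \<open>\<open>inv_into\<close> carries no measurability by itself; on the image of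
  \<open>Omega\<close>, the sphere without two points, it agrees with the Borel map
  \<open>Psi\<close>.\<close>

lemma T_Phi_measurable:
  assumes v: "v \<in> borel_measurable sigma_measure"
  shows "T_Phi v \<in> borel_measurable (restrict_space borel (sphere 0 1))"
proof -
  have "v \<in> borel_measurable (restrict_space borel Omega)"
    using v by (simp add: measurable_cong_sets[OF sets_sigma refl])
  then have [measurable]: "(\<lambda>q. if q \<in> Omega then v q else 0) \<in> borel_measurable borel"
    using measurable_restrict_space_iff[of Omega borel "0::complex" borel v] by simp
  have img: "Phi ` Omega = sphere 0 1 - {axis 3 1, - axis 3 1}" using Phi_bij_betw by (simp add: bij_betw_def)
  have [measurable]: "Phi ` Omega \<in> sets borel" unfolding img by simp
  have "T_Phi v = (\<lambda>p. if p \<in> Phi ` Omega then (if Psi p \<in> Omega then v (Psi p) else 0) else 0)"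
  proof
    fix p
    show "T_Phi v p = (if p \<in> Phi ` Omega then (if Psi p \<in> Omega then v (Psi p) else 0) else 0)"
    proof (cases "p \<in> Phi ` Omega")
      case True
      then obtain q where "q \<in> Omega" "p = Phi q" by blast
      then show ?thesis by (simp add: T_Phi_Phi Psi_Phi)
    next
      case False
      then show ?thesis unfolding T_Phi_def by (simp only: if_False)
    qed
  qed
  moreover have "(\<lambda>p. if p \<in> Phi ` Omega then (if Psi p \<in> Omega then v (Psi p) else 0) else 0) \<in> borel_measurable borel"
    by measurable
  ultimately show ?thesis by (simp add: measurable_restrict_space1)
qed

lemma T_Phi_L2: "v \<in> L2 sigma_measure \<Longrightarrow> T_Phi v \<in> L2 sphere_measure"
proof -
  assume v: "v \<in> L2 sigma_measure"
  have m: "T_Phi v \<in> borel_measurable (restrict_space borel (sphere 0 1))" by (rule T_Phi_measurable[OF L2_measurable[OF v]])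
  note [measurable] = m
  have "(\<lambda>q. T_Phi v (Phi q)) \<in> L2 sigma_measure"
    by (rule L2_cong_AE[OF v]) (measurable, auto intro!: AE_I2 simp: space_sigma T_Phi_Phi)
  then show ?thesis by (simp add: L2_sphere_iff[OF m])
qed

lemma ip_T_Phi:
  assumes v: "v \<in> L2 sigma_measure" and f: "f \<in> sphere_smooth"
  shows "ip sphere_measure (T_Phi v) f = ip sigma_measure v (\<lambda>q. f (Phi q))"
proof -
  have "ip sphere_measure (T_Phi v) f = ip sigma_measure (\<lambda>q. T_Phi v (Phi q)) (\<lambda>q. f (Phi q))"
    by (intro ip_sphere smooth_borel f T_Phi_measurable L2_measurable v)
  also have "\<dots> = ip sigma_measure v (\<lambda>q. f (Phi q))"
    unfolding ip_def by (rule Bochner_Integration.integral_cong) (auto simp: space_sigma T_Phi_Phi)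
  finally show ?thesis .
qed

lemma ip_basis: "f \<in> L2 sigma_measure \<Longrightarrow> ip sigma_measure f (basis j) = complex_of_real (norm_factor (basis_order j) (basis_degree j))
   * ip sigma_measure f (\<lambda>q. harmonic (basis_order j) (basis_degree j) (Phi q))"
  by (simp add: basis_def basis_fun_def harmonic_Phi ip_scale_right)

text \<open>Testing the weak equation with harmonics gives the relation between the coefficients.
  Conversely, symmetry on smooth functions yields the coefficients of \<open>L_smooth \<phi>\<close>
  for every test function, and Parseval's identity for inner products recovers the weak equation.
  This stands in for an appeal to essential self-adjointness.\<close>

lemma grushin_graph_eq: "grushin_graph = D.diag_graph"
proof (intro set_eqI, clarify)
  fix v w
  show "(v, w) \<in> grushin_graph \<longleftrightarrow> (v, w) \<in> D.diag_graph"
  proof (cases "v \<in> L2 sigma_measure \<and> w \<in> L2 sigma_measure")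
    case True
    then have v: "v \<in> L2 sigma_measure" and w: "w \<in> L2 sigma_measure" by auto
    have g: "(v, w) \<in> grushin_graph \<longleftrightarrow>
      (\<forall>\<phi>\<in>sphere_smooth. ip sphere_measure (T_Phi v) (L_smooth \<phi>) = ip sphere_measure (T_Phi w) \<phi>)"
      using v w by (simp add: grushin_graph_def L_graph_def T_Phi_L2 ip_def)
    have Lh: "ip sphere_measure u (L_smooth (harmonic m d)) = - complex_of_real (eigval m d) * ip sphere_measure u (harmonic m d)"
      if u: "u \<in> L2 sphere_measure" for u m d
    proof -
      have "ip sphere_measure u (L_smooth (harmonic m d)) = ip sphere_measure u (\<lambda>p. (- complex_of_real (eigval m d)) * harmonic m d p)"
        by (rule ip_cong_AE_right[OF L_smooth_harmonic]) (intro smooth_L2 smooth_L_smooth smooth_harmonic L2_scale u)+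
      then show ?thesis by (simp only: ip_scale_right[OF smooth_L2[OF smooth_harmonic] u]) simp
    qed
    show ?thesis unfolding g
    proof
      assume eq: "\<forall>\<phi>\<in>sphere_smooth. ip sphere_measure (T_Phi v) (L_smooth \<phi>) = ip sphere_measure (T_Phi w) \<phi>"
      have "ip sigma_measure w (basis j) = - complex_of_real (basis_eigval j) * ip sigma_measure v (basis j)" for j
      proof -
        have "ip sigma_measure w (\<lambda>q. harmonic (basis_order j) (basis_degree j) (Phi q))
          = - complex_of_real (basis_eigval j) * ip sigma_measure v (\<lambda>q. harmonic (basis_order j) (basis_degree j) (Phi q))"
          using eq[rule_format, OF smooth_harmonic[of "basis_order j" "basis_degree j"]]
          unfolding Lh[OF T_Phi_L2[OF v]] basis_eigval_def
          by (simp add: ip_T_Phi v w smooth_harmonic)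
        then show ?thesis unfolding ip_basis[OF v] ip_basis[OF w] by simp
      qed
      then show "(v, w) \<in> D.diag_graph" using v w by (simp add: D.diag_graph_def)
    next
      assume "(v, w) \<in> D.diag_graph"
      then have cf: "ip sigma_measure w (basis j) = - complex_of_real (basis_eigval j) * ip sigma_measure v (basis j)" for j
        by (simp add: D.diag_graph_def)
      show "\<forall>\<phi>\<in>sphere_smooth. ip sphere_measure (T_Phi v) (L_smooth \<phi>) = ip sphere_measure (T_Phi w) \<phi>"
      proof
        fix \<phi> assume \<phi>: "\<phi> \<in> sphere_smooth"
        let ?f = "\<lambda>q. \<phi> (Phi q)" and ?Lf = "\<lambda>q. L_smooth \<phi> (Phi q)"
        have f: "?f \<in> L2 sigma_measure" and Lf: "?Lf \<in> L2 sigma_measure"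
          by (intro continuous_L2_sigma continuous_smooth_Phi \<phi> smooth_L_smooth)+
        have sph: "ip sigma_measure (\<lambda>q. h (Phi q)) (\<lambda>q. harmonic m d (Phi q)) = ip sphere_measure h (harmonic m d)"
          if "h \<in> sphere_smooth" for h m d
          using that by (simp add: ip_sphere smooth_borel smooth_harmonic)
        have cfL: "ip sigma_measure ?Lf (basis j) = - complex_of_real (basis_eigval j) * ip sigma_measure ?f (basis j)" for j
        proof -
          let ?h = "harmonic (basis_order j) (basis_degree j)"
          have "ip sphere_measure (L_smooth \<phi>) ?h = ip sphere_measure \<phi> (L_smooth ?h)"
            by (rule L_smooth_symmetric[OF \<phi> smooth_harmonic])
          also have "\<dots> = - complex_of_real (basis_eigval j) * ip sphere_measure \<phi> ?h"
            unfolding basis_eigval_def by (rule Lh[OF smooth_L2[OF \<phi>]])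
          finally show ?thesis
            by (simp add: ip_basis f Lf sph \<phi> smooth_L_smooth)
        qed
        have "(\<lambda>N. \<Sum>j<N. cnj (ip sigma_measure ?Lf (basis j)) * ip sigma_measure v (basis j)) \<longlonglongrightarrow> ip sigma_measure v ?Lf"
          by (rule D.ip_series[OF v Lf])
        moreover have "(\<lambda>N. \<Sum>j<N. cnj (ip sigma_measure ?f (basis j)) * ip sigma_measure w (basis j)) \<longlonglongrightarrow> ip sigma_measure w ?f"
          by (rule D.ip_series[OF w f])
        moreover have "cnj (ip sigma_measure ?Lf (basis j)) * ip sigma_measure v (basis j) = cnj (ip sigma_measure ?f (basis j)) * ip sigma_measure w (basis j)" for j
          unfolding cfL cf by simp
        ultimately have "ip sigma_measure v ?Lf = ip sigma_measure w ?f"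
          by (simp only:) (rule LIMSEQ_unique)
        then show "ip sphere_measure (T_Phi v) (L_smooth \<phi>) = ip sphere_measure (T_Phi w) \<phi>"
          by (simp add: ip_T_Phi v w \<phi> smooth_L_smooth)
      qed
    qed
  qed (auto simp: grushin_graph_def D.diag_graph_def)
qed

lemma solution_L2: "t \<ge> 0 \<Longrightarrow> g \<in> L2 sigma_measure \<Longrightarrow> solution g t \<in> L2 sigma_measure"
  unfolding solution_def grushin_graph_eq by (rule D.exp_semigroup_diag)

lemma ip_solution: "t \<ge> 0 \<Longrightarrow> g \<in> L2 sigma_measure \<Longrightarrow>
   ip sigma_measure (solution g t) (basis j) = complex_of_real (exp (- basis_eigval j * t)) * ip sigma_measure g (basis j)"
  unfolding solution_def grushin_graph_eq by (rule D.exp_semigroup_diag)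

section \<open>The spectral inequality\<close>

lemma degree_difference_le:
  fixes p :: "complex poly"
  assumes "degree p \<le> Suc d"
  shows "degree (pcompose p [:h, 1:] - p) \<le> d"
proof -
  let ?q = "pcompose p [:h, 1:]"
  have dq: "degree ?q = degree p" by (simp add: degree_pcompose)
  show ?thesis
  proof (cases "degree p = Suc d")
    case True
    have "lead_coeff ?q = lead_coeff p" by (subst lead_coeff_comp) auto
    then have "coeff (?q - p) (Suc d) = 0" using True dq by simp
    moreover have "degree (?q - p) \<le> Suc d" using assms dq by (intro degree_diff_le) auto
    ultimately show ?thesis
      by (metis degree_0 eq_zero_or_degree_less le_0_eq less_Suc_eq_le le_eq_less_or_eq zero_le)
  next
    case False
    then show ?thesis using assms dq by (intro degree_diff_le) auto
  qed
qed

text \<open>The base \<open>3\<close> comes from \<open>3\<^sup>k\<^sup>+\<^sup>1 = 3\<^sup>k + 2 \<cdot> 3\<^sup>k\<close>, the bound for the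
  difference polynomial being \<open>2B\<close>.\<close>

lemma poly_progression_bound:
  fixes p :: "complex poly" and t h :: complex
  assumes "degree p \<le> d" "\<And>i. i \<le> d \<Longrightarrow> cmod (poly p (t + of_nat i * h)) \<le> B"
  shows "cmod (poly p (t + of_nat k * h)) \<le> 3 ^ k * B"
  using assms
proof (induction d arbitrary: p B k)
  case 0
  then obtain c where p: "p = [:c:]" by (auto elim: degree_eq_zeroE)
  have "cmod c \<le> B" using "0.prems"(2)[of 0] by (simp add: p)
  moreover have "0 \<le> B" by (rule order_trans[OF norm_ge_zero calculation])
  then have "1 * B \<le> 3 ^ k * B" by (intro mult_right_mono) auto
  ultimately show ?case by (simp add: p)
next
  case (Suc d)
  define q where "q = pcompose p [:h, 1:] - p"
  have q: "poly q (t + of_nat i * h) = poly p (t + of_nat (Suc i) * h) - poly p (t + of_nat i * h)" for i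
    by (simp add: q_def poly_pcompose algebra_simps)
  have qb: "cmod (poly q (t + of_nat i * h)) \<le> 3 ^ i * (2 * B)" for i
  proof (rule Suc.IH)
    show "degree q \<le> d" unfolding q_def by (rule degree_difference_le[OF Suc.prems(1)])
    fix i assume "i \<le> d"
    then show "cmod (poly q (t + of_nat i * h)) \<le> 2 * B"
      using Suc.prems(2)[of "Suc i"] Suc.prems(2)[of i] norm_triangle_ineq4[of "poly p (t + of_nat (Suc i) * h)" "poly p (t + of_nat i * h)"]
      unfolding q by linarith
  qed
  show ?case
  proof (induction k)
    case 0
    then show ?case using Suc.prems(2)[of 0] by simp
  next
    case (Suc k)
    have "poly p (t + of_nat (Suc k) * h) = poly p (t + of_nat k * h) + poly q (t + of_nat k * h)" by (simp add: q)
    then have "cmod (poly p (t + of_nat (Suc k) * h)) \<le> cmod (poly p (t + of_nat k * h)) + cmod (poly q (t + of_nat k * h))"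
      by (simp only: norm_triangle_ineq)
    then show ?case using Suc qb[of k] by simp
  qed
qed

text \<open>The maximum over the first \<open>d + 1\<close> points is replaced by a sum of squares
  so that both sides can be integrated over the starting point \<open>t\<close>; the base is
  \<open>9 = 3^2\<close>.\<close>

lemma poly_progression_bound_sq:
  fixes p :: "complex poly" and t h :: real
  assumes "degree p \<le> d"
  shows "(cmod (poly p (complex_of_real (t + real k * h))))\<^sup>2 \<le> 9 ^ k * (\<Sum>i\<le>d. (cmod (poly p (complex_of_real (t + real i * h))))\<^sup>2)"
proof -
  define S where "S = (\<Sum>i\<le>d. (cmod (poly p (complex_of_real (t + real i * h))))\<^sup>2)"
  have S0: "S \<ge> 0" by (simp add: S_def sum_nonneg)
  have "cmod (poly p (complex_of_real t + of_nat i * complex_of_real h)) \<le> sqrt S" if "i \<le> d" for i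
  proof (rule real_le_rsqrt)
    show "(cmod (poly p (complex_of_real t + of_nat i * complex_of_real h)))\<^sup>2 \<le> S"
      unfolding S_def using member_le_sum[of i "{..d}" "\<lambda>i. (cmod (poly p (complex_of_real (t + real i * h))))\<^sup>2"] that by simp
  qed
  from poly_progression_bound[OF assms this, of k]
  have "cmod (poly p (complex_of_real (t + real k * h))) \<le> 3 ^ k * sqrt S" by simp
  then have "(cmod (poly p (complex_of_real (t + real k * h))))\<^sup>2 \<le> (3 ^ k * sqrt S)\<^sup>2" by (rule power_mono) simp
  also have "(3 ^ k * sqrt S)\<^sup>2 = 9 ^ k * S"
  proof -
    have "(3::real) ^ k * 3 ^ k = 9 ^ k" by (simp flip: power_mult_distrib)
    moreover have "(3 ^ k * sqrt S)\<^sup>2 = (3 ^ k * 3 ^ k) * (sqrt S * sqrt S)" by (simp only: power2_eq_square mult_ac)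
    ultimately show ?thesis using S0 by simp
  qed
  finally show ?thesis by (simp add: S_def)
qed

lemma integral_shift_nat:
  fixes f :: "real \<Rightarrow> real"
  assumes "continuous_on UNIV f"
  shows "integral {x..y} (\<lambda>t. f (t + c)) = integral {x + c..y + c} f"
  using integral_shift[of x c y f] continuous_on_subset[OF assms] by (simp add: o_def)

lemma integral_pieces:
  fixes f :: "real \<Rightarrow> real"
  assumes f: "continuous_on UNIV f" and h: "h \<ge> 0"
  shows "(\<Sum>k<K. integral {x + real k * h..x + h + real k * h} f) = integral {x..x + real K * h} f"
proof (induction K)
  case (Suc K)
  have "integral {x..x + real K * h} f + integral {x + real K * h..x + real (Suc K) * h} f = integral {x..x + real (Suc K) * h} f"
    by (rule Henstock_Kurzweil_Integration.integral_combine)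
       (use h in \<open>auto intro!: integrable_continuous_interval continuous_on_subset[OF f] simp: algebra_simps\<close>)
  then show ?case using Suc by (simp add: algebra_simps)
qed simp

text \<open>Cut \<open>[x, y]\<close> into \<open>d + 1\<close> pieces of length \<open>h\<close>.
  As \<open>t\<close> runs over the first piece, its translates by \<open>0, ..., d\<close> steps
  fill \<open>[x, y]\<close>, and they control \<open>p\<close> on the \<open>k\<close>-th translate
  at the cost of \<open>9^k\<close>. Summing the geometric series over \<open>L * Suc d\<close>
  pieces gives the bound.\<close>

lemma remez_right:
  fixes p :: "complex poly" and x y :: real
  defines "f \<equiv> \<lambda>s. (cmod (poly p (complex_of_real s)))\<^sup>2"
  assumes d: "degree p \<le> d" and xy: "x < y"
  shows "integral {x..x + real L * (y - x)} f \<le> 9 ^ (L * Suc d) * integral {x..y} f"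
proof -
  define h where "h = (y - x) / real (Suc d)"
  have h0: "h \<ge> 0" using xy by (simp add: h_def)
  have f: "continuous_on UNIV f" unfolding f_def by (intro continuous_intros)
  have fs: "continuous_on A (\<lambda>t. f (t + c))" for A c unfolding f_def by (intro continuous_intros)
  have f0: "f s \<ge> 0" for s by (simp add: f_def)
  define I where "I = integral {x..y} f"
  have I0: "I \<ge> 0" unfolding I_def by (rule integral_nonneg) (auto intro!: integrable_continuous_interval continuous_on_subset[OF f] f0)
  have yh: "x + real (Suc d) * h = y" by (simp add: h_def)
  have piece: "integral {x + real k * h..x + h + real k * h} f \<le> 9 ^ k * I" for k
  proof -
    have "integral {x + real k * h..x + h + real k * h} f = integral {x..x + h} (\<lambda>t. f (t + real k * h))"
      by (rule integral_shift_nat[OF f, symmetric])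
    also have "\<dots> \<le> integral {x..x + h} (\<lambda>t. 9 ^ k * (\<Sum>i\<le>d. f (t + real i * h)))"
    proof (rule integral_le)
      show "(\<lambda>t. 9 ^ k * (\<Sum>i\<le>d. f (t + real i * h))) integrable_on {x..x + h}"
        by (intro integrable_continuous_interval continuous_on_mult continuous_on_const continuous_on_sum fs)
      show "f (t + real k * h) \<le> 9 ^ k * (\<Sum>i\<le>d. f (t + real i * h))" for t
        unfolding f_def by (rule poly_progression_bound_sq[OF d])
    qed (intro integrable_continuous_interval fs)
    also have "\<dots> = 9 ^ k * (\<Sum>i\<le>d. integral {x..x + h} (\<lambda>t. f (t + real i * h)))"
      by (simp add: Henstock_Kurzweil_Integration.integral_sum integrable_continuous_interval fs)
    also have "(\<Sum>i\<le>d. integral {x..x + h} (\<lambda>t. f (t + real i * h))) = (\<Sum>i<Suc d. integral {x + real i * h..x + h + real i * h} f)"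
      unfolding integral_shift_nat[OF f] by (simp only: lessThan_Suc_atMost)
    also have "\<dots> = I" unfolding integral_pieces[OF f h0] yh I_def ..
    finally show ?thesis .
  qed
  have "integral {x..x + real L * (y - x)} f = (\<Sum>k<L * Suc d. integral {x + real k * h..x + h + real k * h} f)"
  proof -
    have "real (L * Suc d) * h = real L * (y - x)"
      by (simp only: of_nat_mult h_def) (simp del: of_nat_Suc)
    then show ?thesis unfolding integral_pieces[OF f h0] by (simp only:)
  qed
  also have "\<dots> \<le> (\<Sum>k<L * Suc d. 9 ^ k * I)" by (intro sum_mono piece)
  also have "\<dots> = (\<Sum>k<L * Suc d. 9 ^ k) * I" by (simp add: sum_distrib_right)
  also have "\<dots> \<le> 9 ^ (L * Suc d) * I"
  proof (rule mult_right_mono[OF _ I0])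
    have "(9 - 1) * (\<Sum>k<n. 9 ^ k) = 9 ^ n - (1::real)" for n
      by (simp add: power_diff_1_eq)
    from this[of "L * Suc d"] show "(\<Sum>k<L * Suc d. 9 ^ k) \<le> (9::real) ^ (L * Suc d)"
      using sum_nonneg[of "{..<L * Suc d}" "\<lambda>k. 9 ^ k :: real"] by simp
  qed
  finally show ?thesis by (simp add: I_def)
qed

text \<open>An \<open>L\<close>-fold enlargement has at least the length 2 of
  \<open>[-1, 1]\<close>, so it reaches the right end and, after reflection, the left end; the two
  sides give the factor 2.\<close>

lemma remez_integral:
  fixes p :: "complex poly" and x y :: real
  defines "f \<equiv> \<lambda>s. (cmod (poly p (complex_of_real s)))\<^sup>2"
  assumes d: "degree p \<le> d" and xy: "x < y" and L: "real L * (y - x) \<ge> 2" and x: "-1 \<le> x" "y \<le> 1"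
  shows "integral {-1..1} f \<le> 2 * 9 ^ (L * Suc d) * integral {x..y} f"
proof -
  have f: "continuous_on A f" for A unfolding f_def by (intro continuous_intros)
  have fi: "f integrable_on {u..v}" for u v by (intro integrable_continuous_interval f)
  have f0: "f s \<ge> 0" for s by (simp add: f_def)
  have right: "integral {x..1} f \<le> 9 ^ (L * Suc d) * integral {x..y} f"
  proof -
    have "integral {x..1} f \<le> integral {x..x + real L * (y - x)} f"
      by (rule integral_subset_le) (use L x f0 fi in auto)
    also have "\<dots> \<le> 9 ^ (L * Suc d) * integral {x..y} f"
      unfolding f_def by (rule remez_right[OF d xy])
    finally show ?thesis .
  qed
  define p' where "p' = pcompose p [:0, -1:]"
  have d': "degree p' \<le> d" using d by (simp add: p'_def degree_pcompose)
  have fm: "(\<lambda>s. (cmod (poly p' (complex_of_real s)))\<^sup>2) = (\<lambda>s. f (- s))"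
    by (simp add: p'_def f_def poly_pcompose)
  have refl: "integral {-v..-u} (\<lambda>s. f (- s)) = integral {u..v} f" for u v
    by (rule Henstock_Kurzweil_Integration.integral_reflect_real)
  have left: "integral {-1..y} f \<le> 9 ^ (L * Suc d) * integral {x..y} f"
  proof -
    have "integral {-1..y} f \<le> integral {x - (real L - 1) * (y - x)..y} f"
      by (rule integral_subset_le) (use L x f0 fi in \<open>auto simp: algebra_simps\<close>)
    also have "\<dots> = integral {-y..-y + real L * (-x - (-y))} (\<lambda>s. f (- s))"
      unfolding refl[symmetric] by (simp add: algebra_simps)
    also have "\<dots> \<le> 9 ^ (L * Suc d) * integral {-y..-x} (\<lambda>s. f (- s))"
      unfolding fm[symmetric] by (rule remez_right[OF d']) (use xy in simp)
    finally show ?thesis by (simp only: refl)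
  qed
  have "integral {-1..1} f = integral {-1..x} f + integral {x..1} f"
    by (rule Henstock_Kurzweil_Integration.integral_combine[symmetric]) (use x xy fi in auto)
  moreover have "integral {-1..x} f \<le> integral {-1..y} f"
    by (rule integral_subset_le) (use xy f0 fi in auto)
  ultimately show ?thesis using left right by simp
qed

lemma integral_sin_substitution:
  fixes F :: "real \<Rightarrow> real"
  assumes F: "continuous_on UNIV F" and uv: "-(pi/2) \<le> u" "u \<le> v" "v \<le> pi/2"
  shows "integral {u..v} (\<lambda>x. cos x * F (sin x)) = integral {sin u..sin v} F"
proof -
  have "((\<lambda>x. cos x *\<^sub>R F (sin x)) has_integral integral {sin u..sin v} F) {u..v}"
  proof (rule has_integral_substitution[where c = "-1" and d = 1])
    show "sin u \<le> sin v" using uv by (intro sin_monotone_2pi_le) auto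
  qed (use uv in \<open>auto intro!: continuous_on_subset[OF F] derivative_eq_intros\<close>)
  then show ?thesis by (simp add: integral_unique)
qed

text \<open>Under \<open>s = sin x\<close> the weight becomes \<open>(1 - s^2)^n\<close>: at most 1
  everywhere, and at least \<open>w^n\<close> on the observed interval, where
  \<open>w = (cos b)^2\<close> is positive as \<open>b < pi/2\<close>. The base \<open>K\<close>
  absorbs both \<open>9^L\<close> per degree and \<open>1 / w\<close> per order.\<close>

lemma spectral_weighted:
  assumes ab: "0 < a" "a < b" "b < pi / 2"
  obtains M K where "M \<ge> 1" "K \<ge> 1" "\<And>n d p. degree p \<le> d \<Longrightarrow>
    integral {-(pi/2)..pi/2} (\<lambda>x. cos x * (cos x ^ (2 * n) * (cmod (poly p (complex_of_real (sin x))))\<^sup>2))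
      \<le> M * K ^ (d + n) * integral {a..b} (\<lambda>x. cos x * (cos x ^ (2 * n) * (cmod (poly p (complex_of_real (sin x))))\<^sup>2))"
proof -
  define \<alpha> \<beta> where "\<alpha> = sin a" "\<beta> = sin b"
  have \<alpha>\<beta>: "\<alpha> < \<beta>" unfolding \<alpha>_\<beta>_def using ab by (intro sin_monotone_2pi) auto
  have \<alpha>0: "0 < \<alpha>" unfolding \<alpha>_\<beta>_def using ab by (intro sin_gt_zero) auto
  have \<beta>1: "\<beta> < 1" unfolding \<alpha>_\<beta>_def using sin_monotone_2pi[of b "pi/2"] ab by simp
  define w where "w = 1 - \<beta>\<^sup>2"
  have "\<beta>\<^sup>2 < 1" using \<alpha>0 \<alpha>\<beta> \<beta>1 by (simp add: power_less_one_iff abs_square_less_1)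
  then have w: "0 < w" "w \<le> 1" by (auto simp: w_def)
  obtain L :: nat where L: "2 / (\<beta> - \<alpha>) < L" using reals_Archimedean2 by blast
  then have L2: "real L * (\<beta> - \<alpha>) \<ge> 2" using \<alpha>\<beta> by (simp add: field_simps)
  define K :: real where "K = 9 ^ L * (1 / w)"
  have K1: "9 ^ L \<le> K" "1 / w \<le> K" "1 \<le> K"
  proof -
    have "1 \<le> 1 / w" "(1::real) \<le> 9 ^ L" using w by auto
    then show "9 ^ L \<le> K" "1 / w \<le> K" unfolding K_def
      using mult_left_mono[of 1 "1/w" "9^L"] mult_right_mono[of 1 "9^L" "1/w"] w by auto
    then show "1 \<le> K" using \<open>1 \<le> 9 ^ L\<close> by linarith
  qed
  show ?thesis
  proof (rule that[of "2 * K" K])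
    show "1 \<le> 2 * K" "1 \<le> K" using K1 by auto
    fix n d and p :: "complex poly" assume d: "degree p \<le> d"
    define f where "f s = (cmod (poly p (complex_of_real s)))\<^sup>2" for s :: real
    define F where "F s = (1 - s\<^sup>2) ^ n * f s" for s :: real
    have fc: "continuous_on A f" for A unfolding f_def by (intro continuous_intros)
    have Fc: "continuous_on A F" for A unfolding F_def by (intro continuous_intros fc)
    have f0: "f s \<ge> 0" for s by (simp add: f_def)
    have F_cos: "cos x ^ (2 * n) * (cmod (poly p (complex_of_real (sin x))))\<^sup>2 = F (sin x)" for x
      by (simp add: F_def f_def power_mult cos_squared_eq)
    have "integral {-(pi/2)..pi/2} (\<lambda>x. cos x * F (sin x)) = integral {-1..1} F"
      using integral_sin_substitution[OF Fc, of "-(pi/2)" "pi/2"] by simp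
    also have "\<dots> \<le> integral {-1..1} f"
    proof (rule integral_le)
      fix s :: real assume "s \<in> {-1..1}"
      then have "s\<^sup>2 \<le> 1" by (simp add: abs_square_le_1 abs_le_iff)
      then have "(1 - s\<^sup>2) ^ n \<le> 1" by (intro power_le_one) auto
      then show "F s \<le> f s" unfolding F_def using f0[of s] mult_right_mono[of "(1 - s\<^sup>2) ^ n" 1 "f s"] by simp
    qed (intro integrable_continuous_interval Fc fc)+
    also have "\<dots> \<le> 2 * 9 ^ (L * Suc d) * integral {\<alpha>..\<beta>} f"
      unfolding f_def by (rule remez_integral[OF d \<alpha>\<beta> L2]) (use \<alpha>0 \<beta>1 in auto)
    also have "integral {\<alpha>..\<beta>} f \<le> integral {\<alpha>..\<beta>} (\<lambda>s. (1 / w) ^ n * F s)"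
    proof (rule integral_le)
      fix s :: real assume s: "s \<in> {\<alpha>..\<beta>}"
      then have "s\<^sup>2 \<le> \<beta>\<^sup>2" using \<alpha>0 by (intro power_mono) auto
      then have "w ^ n \<le> (1 - s\<^sup>2) ^ n" using w by (intro power_mono) (auto simp: w_def)
      then have "1 \<le> (1 / w) ^ n * (1 - s\<^sup>2) ^ n" using w by (simp add: power_divide field_simps)
      then show "f s \<le> (1 / w) ^ n * F s"
        unfolding F_def using f0[of s] mult_right_mono[of 1 "(1 / w) ^ n * (1 - s\<^sup>2) ^ n" "f s"] by (simp add: mult.assoc)
    qed (intro integrable_continuous_interval continuous_on_mult continuous_on_const Fc fc)+
    also have "\<dots> = (1 / w) ^ n * integral {\<alpha>..\<beta>} F" by simp
    also have "2 * 9 ^ (L * Suc d) * ((1 / w) ^ n * integral {\<alpha>..\<beta>} F) \<le> 2 * K * K ^ (d + n) * integral {\<alpha>..\<beta>} F"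
    proof -
      have "9 ^ (L * Suc d) * (1 / w) ^ n \<le> K ^ Suc d * K ^ n"
        unfolding power_mult using K1 w by (intro mult_mono power_mono) auto
      also have "\<dots> = K * K ^ (d + n)" by (simp add: power_add)
      finally have *: "9 ^ (L * Suc d) * (1 / w) ^ n \<le> K * K ^ (d + n)" .
      have "F s \<ge> 0" if "s \<in> {\<alpha>..\<beta>}" for s
      proof -
        have "s\<^sup>2 \<le> \<beta>\<^sup>2" using \<alpha>0 that by (intro power_mono) auto
        then have "0 \<le> 1 - s\<^sup>2" using w by (simp add: w_def)
        then show ?thesis unfolding F_def using f0[of s] by simp
      qed
      then have "0 \<le> integral {\<alpha>..\<beta>} F" by (intro integral_nonneg integrable_continuous_interval Fc)
      from mult_right_mono[OF * this] show ?thesis by (simp add: mult_ac)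
    qed
    also have "integral {\<alpha>..\<beta>} F = integral {a..b} (\<lambda>x. cos x * F (sin x))"
      unfolding \<alpha>_\<beta>_def using integral_sin_substitution[OF Fc, of a b] ab by simp
    finally show "integral {-(pi/2)..pi/2} (\<lambda>x. cos x * (cos x ^ (2 * n) * (cmod (poly p (complex_of_real (sin x))))\<^sup>2))
      \<le> 2 * K * K ^ (d + n) * integral {a..b} (\<lambda>x. cos x * (cos x ^ (2 * n) * (cmod (poly p (complex_of_real (sin x))))\<^sup>2))"
      unfolding F_cos by simp
  qed
qed

text \<open>Observed energies become squared norms of restricted functions, so that inner products,
  orthogonality and Cauchy-Schwarz are available on a part of \<open>Omega\<close>.\<close>

definition restr :: "(real \<times> real) set \<Rightarrow> (real \<times> real \<Rightarrow> complex) \<Rightarrow> (real \<times> real \<Rightarrow> complex)" where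
  "restr S v = (\<lambda>q. complex_of_real (indicator S q) * v q)"

lemma set_integral_restr: "(LINT q:S|sigma_measure. (cmod (v q))\<^sup>2) = sqn sigma_measure (restr S v)"
  unfolding set_lebesgue_integral_def sqn_def restr_def
  by (rule Bochner_Integration.integral_cong) (auto simp: norm_mult power_mult_distrib split: split_indicator)

lemma restr_L2:
  assumes S: "S \<in> sets borel" and v: "v \<in> L2 sigma_measure"
  shows "restr S v \<in> L2 sigma_measure"
proof -
  have [measurable]: "v \<in> borel_measurable sigma_measure" by (rule L2_measurable[OF v])
  have [measurable]: "(\<lambda>q. indicat_real S q) \<in> borel_measurable sigma_measure"
    by (rule borel_measurable_sigma) (use S in simp)
  have "integrable sigma_measure (\<lambda>q. (cmod (restr S v q))\<^sup>2)"
    by (rule Bochner_Integration.integrable_bound[OF L2_integrable_sq[OF v]])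
       (auto simp: restr_def norm_mult split: split_indicator)
  then show ?thesis by (simp add: L2_def restr_def)
qed

lemma sqn_restr_le:
  assumes "S \<in> sets borel" "v \<in> L2 sigma_measure"
  shows "sqn sigma_measure (restr S v) \<le> sqn sigma_measure v"
  unfolding sqn_def
  by (rule integral_mono[OF L2_integrable_sq[OF restr_L2[OF assms]] L2_integrable_sq[OF assms(2)]])
     (auto simp: restr_def norm_mult split: split_indicator)

lemma omega_borel [measurable]: "omega a b \<in> sets borel"
proof -
  have "({-b<..<-a} \<union> {a<..<b}) \<times> {0<..<2*pi} \<in> sets (borel \<Otimes>\<^sub>M borel :: (real \<times> real) measure)" by measurable
  then show ?thesis unfolding omega_def borel_prod .
qed

lemma omega_integral:
  fixes F :: "real \<times> real \<Rightarrow> 'b::euclidean_space"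
  assumes F: "continuous_on UNIV F" and A: "A \<in> sets borel" "A \<subseteq> {-(pi/2)<..<pi/2}"
  shows "(LINT q:(A \<times> {0<..<2*pi})|sigma_measure. F q) = (LINT x:A|lborel. integral {0..2*pi} (\<lambda>y. cos x *\<^sub>R F (x, y)))"
proof -
  let ?S = "A \<times> {0<..<2*pi}"
  have S: "?S \<in> sets borel"
  proof -
    have "?S \<in> sets (borel \<Otimes>\<^sub>M borel :: (real \<times> real) measure)" using A(1) by measurable
    then show ?thesis unfolding borel_prod .
  qed
  have SO: "?S \<subseteq> Omega" using A(2) by (auto simp: Omega_def)
  let ?G = "\<lambda>q. indicat_real ?S q *\<^sub>R (cos (fst q) *\<^sub>R F q)"
  have Fm [measurable]: "F \<in> borel_measurable borel" by (rule borel_measurable_continuous_onI[OF F])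
  have gc: "continuous_on B (\<lambda>q. cos (fst q) *\<^sub>R F q)" for B
    by (intro continuous_intros continuous_on_subset[OF F]) auto
  have "integrable lborel (\<lambda>q. indicat_real (cbox (-(pi/2), 0) (pi/2, 2*pi)) q *\<^sub>R (cos (fst q) *\<^sub>R F q))"
    by (rule borel_integrable_compact) (auto intro: gc)
  from integrable_mult_indicator[of ?S lborel, OF _ this] S
  have "integrable lborel (\<lambda>q. indicat_real ?S q *\<^sub>R indicat_real (cbox (-(pi/2), 0) (pi/2, 2*pi)) q *\<^sub>R (cos (fst q) *\<^sub>R F q))" by simp
  moreover have sub: "?S \<subseteq> cbox (-(pi/2), 0) (pi/2, 2*pi)" using A(2) by (auto simp: subset_iff)
  have "(\<lambda>q. indicat_real ?S q *\<^sub>R indicat_real (cbox (-(pi/2), 0) (pi/2, 2*pi)) q *\<^sub>R (cos (fst q) *\<^sub>R F q)) = ?G"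
  proof
    fix q
    show "indicat_real ?S q *\<^sub>R indicat_real (cbox (-(pi/2), 0) (pi/2, 2*pi)) q *\<^sub>R (cos (fst q) *\<^sub>R F q) = ?G q"
    proof (cases "q \<in> ?S")
      case True
      then have "q \<in> cbox (-(pi/2), 0) (pi/2, 2*pi)" using sub by blast
      then show ?thesis by (simp only: indicator_simps scaleR_one)
    next
      case False
      then show ?thesis by (simp only: indicator_simps scaleR_zero_left not_False_eq_True)
    qed
  qed
  ultimately have Gi: "integrable (lborel \<Otimes>\<^sub>M lborel) ?G" by (simp add: lborel_prod)
  have m: "(\<lambda>q. indicat_real ?S q *\<^sub>R F q) \<in> borel_measurable sigma_measure"
    by (rule borel_measurable_sigma) (use S in measurable)
  have "(LINT q:?S|sigma_measure. F q) = (LINT q|lborel. indicat_real Omega q *\<^sub>R (cos (fst q) *\<^sub>R (indicat_real ?S q *\<^sub>R F q)))"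
    unfolding set_lebesgue_integral_def by (rule sigma_integral[OF m])
  also have "\<dots> = (LINT q|lborel. ?G q)"
    by (rule Bochner_Integration.integral_cong) (use SO in \<open>auto split: split_indicator\<close>)
  also have "\<dots> = (LBINT x. LBINT y. ?G (x, y))"
    using lborel_pair.integral_fst'[OF Gi] by (simp add: lborel_prod)
  also have "\<dots> = (LBINT x. indicat_real A x *\<^sub>R integral {0..2*pi} (\<lambda>y. cos x *\<^sub>R F (x, y)))"
  proof (rule Bochner_Integration.integral_cong[OF refl])
    fix x
    have c: "continuous_on {0..2*pi} (\<lambda>y. cos x *\<^sub>R F (x, y))"
      by (intro continuous_intros continuous_on_compose2[OF F]) auto
    have si: "set_integrable lborel {0<..<2*pi} (\<lambda>y. cos x *\<^sub>R F (x, y))"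
      by (rule set_integrable_subset[of _ "{0..2*pi}"]) (auto intro: borel_integrable_atLeastAtMost' c)
    have "(LBINT y. ?G (x, y)) = (LBINT y. indicat_real A x *\<^sub>R (indicat_real {0<..<2*pi} y *\<^sub>R (cos x *\<^sub>R F (x, y))))"
      by (rule Bochner_Integration.integral_cong) (auto split: split_indicator)
    also have "\<dots> = indicat_real A x *\<^sub>R (LBINT y:{0<..<2*pi}. cos x *\<^sub>R F (x, y))"
      unfolding set_lebesgue_integral_def by (rule Bochner_Integration.integral_scaleR_right)
    also have "(LBINT y:{0<..<2*pi}. cos x *\<^sub>R F (x, y)) = integral {0<..<2*pi} (\<lambda>y. cos x *\<^sub>R F (x, y))"
      by (rule set_borel_integral_eq_integral(2)[OF si])
    also have "\<dots> = integral {0..2*pi} (\<lambda>y. cos x *\<^sub>R F (x, y))"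
      by (rule integral_open_interval_real[symmetric])
    finally show "(LBINT y. ?G (x, y)) = indicat_real A x *\<^sub>R integral {0..2*pi} (\<lambda>y. cos x *\<^sub>R F (x, y))" .
  qed
  finally show ?thesis by (simp add: set_lebesgue_integral_def)
qed

lemma ip_restr: "ip sigma_measure (restr S u) (restr S v) = (LINT q:S|sigma_measure. u q * cnj (v q))"
  unfolding set_lebesgue_integral_def ip_def restr_def
  by (rule Bochner_Integration.integral_cong) (auto split: split_indicator)

context
  fixes a b :: real
  assumes ab: "0 < a" "a < b" "b \<le> pi / 2"
begin

lemma omega_slice: "{-b<..<-a} \<union> {a<..<b} \<in> sets borel" "{-b<..<-a} \<union> {a<..<b} \<subseteq> {-(pi/2)<..<pi/2}"
  using ab by auto

lemma ip_restr_mode_orthogonal: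
  assumes "m \<noteq> m'"
  shows "ip sigma_measure (restr (omega a b) (mode m r)) (restr (omega a b) (mode m' r')) = 0"
proof -
  define h where "h x = cos x *\<^sub>R (complex_of_real (cos x ^ nat \<bar>m\<bar>) * poly r (complex_of_real (sin x)) *
     cnj (complex_of_real (cos x ^ nat \<bar>m'\<bar>) * poly r' (complex_of_real (sin x))))" for x
  have h: "cos x *\<^sub>R (mode m r (x, y) * cnj (mode m' r' (x, y))) = h x * cis (of_int (m - m') * y)" for x y
    unfolding cis_mult_cnj[symmetric] by (simp add: mode_def h_def scaleR_conv_of_real mult_ac)
  have "ip sigma_measure (restr (omega a b) (mode m r)) (restr (omega a b) (mode m' r')) =
    (LINT x:({-b<..<-a} \<union> {a<..<b})|lborel. integral {0..2*pi} (\<lambda>y. cos x *\<^sub>R (mode m r (x, y) * cnj (mode m' r' (x, y)))))"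
    unfolding ip_restr unfolding omega_def
    by (intro omega_integral omega_slice continuous_intros continuous_mode)
  also have "\<dots> = 0" unfolding h set_lebesgue_integral_def
    using assms by (simp only: Henstock_Kurzweil_Integration.integral_mult_right integral_cis_eq_0) simp
  finally show ?thesis .
qed

lemma sqn_restr_mode: "sqn sigma_measure (restr (omega a b) (mode m r)) =
   (LINT x:({-b<..<-a} \<union> {a<..<b})|lborel. 2 * pi * (cos x * (cos x ^ (2 * nat \<bar>m\<bar>) * (cmod (poly r (complex_of_real (sin x))))\<^sup>2)))"
proof -
  have c: "(cmod (complex_of_real (cos x ^ n)))\<^sup>2 = cos x ^ (2 * n)" for x n
    by (simp add: power_mult[symmetric] mult.commute del: of_real_power)
  have e: "cos x *\<^sub>R (cmod (mode m r (x, y)))\<^sup>2 = cos x * (cos x ^ (2 * nat \<bar>m\<bar>) * (cmod (poly r (complex_of_real (sin x))))\<^sup>2)" for x y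
    by (simp only: mode_def prod.case norm_mult power_mult_distrib c norm_cis) simp
  have "sqn sigma_measure (restr (omega a b) (mode m r)) =
    (LINT x:({-b<..<-a} \<union> {a<..<b})|lborel. integral {0..2*pi} (\<lambda>y. cos x *\<^sub>R (cmod (mode m r (x, y)))\<^sup>2))"
    unfolding set_integral_restr[symmetric] unfolding omega_def
    by (intro omega_integral omega_slice continuous_intros continuous_mode)
  moreover have "integral {0..2*pi} (\<lambda>y. c) = 2 * pi * c" for c :: real by simp
  ultimately show ?thesis by (simp only: e)
qed

lemma sqn_restr_mode_ge:
  assumes b': "a < b'" "b' < b"
  shows "2 * pi * integral {a..b'} (\<lambda>x. cos x * (cos x ^ (2 * nat \<bar>m\<bar>) * (cmod (poly r (complex_of_real (sin x))))\<^sup>2))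
     \<le> sqn sigma_measure (restr (omega a b) (mode m r))"
proof -
  let ?A = "{-b<..<-a} \<union> {a<..<b}"
  let ?f = "\<lambda>x. 2 * pi * (cos x * (cos x ^ (2 * nat \<bar>m\<bar>) * (cmod (poly r (complex_of_real (sin x))))\<^sup>2))"
  have fc: "continuous_on B ?f" for B by (intro continuous_intros)
  have si: "set_integrable lborel {-(pi/2)..pi/2} ?f" by (rule borel_integrable_atLeastAtMost'[OF fc])
  have si1: "set_integrable lborel {a<..<b'} ?f" by (rule set_integrable_subset[OF si]) (use ab b' in auto)
  have si2: "set_integrable lborel ?A ?f" by (rule set_integrable_subset[OF si]) (use ab in auto)
  have "2 * pi * integral {a..b'} (\<lambda>x. cos x * (cos x ^ (2 * nat \<bar>m\<bar>) * (cmod (poly r (complex_of_real (sin x))))\<^sup>2)) = integral {a..b'} ?f"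
    by (rule Henstock_Kurzweil_Integration.integral_mult_right[symmetric])
  also have "\<dots> = (LINT x:{a<..<b'}|lborel. ?f x)"
    unfolding set_borel_integral_eq_integral(2)[OF si1] by (rule integral_open_interval_real)
  also have "\<dots> \<le> (LINT x:?A|lborel. ?f x)"
    unfolding set_lebesgue_integral_def
  proof (rule integral_mono)
    show "integrable lborel (\<lambda>x. indicat_real {a<..<b'} x *\<^sub>R ?f x)" "integrable lborel (\<lambda>x. indicat_real ?A x *\<^sub>R ?f x)"
      using si1 si2 by (simp_all add: set_integrable_def)
    fix x
    show "indicat_real {a<..<b'} x *\<^sub>R ?f x \<le> indicat_real ?A x *\<^sub>R ?f x"
    proof (cases "x \<in> ?A")
      case True
      then have "x \<in> {-(pi/2)<..<pi/2}" using omega_slice(2) by blast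
      then have "cos x > 0" by (auto intro: cos_gt_zero_pi)
      then have "?f x \<ge> 0" by simp
      moreover have "indicat_real {a<..<b'} x \<le> indicat_real ?A x" using b' by (auto split: split_indicator)
      ultimately show ?thesis by (intro scaleR_right_mono)
    next
      case False
      then have "x \<notin> {a<..<b'}" using b' by auto
      then show ?thesis using False by simp
    qed
  qed
  finally show ?thesis by (simp only: sqn_restr_mode)
qed

lemma spectral_mode:
  obtains M K where "M \<ge> 1" "K \<ge> 1" "\<And>m d r. degree r \<le> d \<Longrightarrow>
    sqn sigma_measure (mode m r) \<le> M * K ^ (d + nat \<bar>m\<bar>) * sqn sigma_measure (restr (omega a b) (mode m r))"
proof -
  \<comment> \<open>For \<open>b = pi/2\<close> the weight vanishes at the end of the interval;
    observing only up to the midpoint keeps it bounded below.\<close>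
  let ?b = "(a + b) / 2"
  obtain M K where MK: "M \<ge> 1" "K \<ge> 1" and sp: "\<And>n d p. degree p \<le> d \<Longrightarrow>
    integral {-(pi/2)..pi/2} (\<lambda>x. cos x * (cos x ^ (2 * n) * (cmod (poly p (complex_of_real (sin x))))\<^sup>2))
      \<le> M * K ^ (d + n) * integral {a..?b} (\<lambda>x. cos x * (cos x ^ (2 * n) * (cmod (poly p (complex_of_real (sin x))))\<^sup>2))"
    using spectral_weighted[of a ?b] ab by (auto simp: field_simps)
  show ?thesis
  proof (rule that[OF MK])
    fix m d and r :: "complex poly" assume d: "degree r \<le> d"
    have "sqn sigma_measure (mode m r) \<le> 2 * pi * (M * K ^ (d + nat \<bar>m\<bar>) * integral {a..?b} (\<lambda>x. cos x * (cos x ^ (2 * nat \<bar>m\<bar>) * (cmod (poly r (complex_of_real (sin x))))\<^sup>2)))"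
      unfolding sqn_mode by (intro mult_left_mono sp d) simp
    also have "\<dots> = M * K ^ (d + nat \<bar>m\<bar>) * (2 * pi * integral {a..?b} (\<lambda>x. cos x * (cos x ^ (2 * nat \<bar>m\<bar>) * (cmod (poly r (complex_of_real (sin x))))\<^sup>2)))"
      by (simp only: mult_ac)
    also have "\<dots> \<le> M * K ^ (d + nat \<bar>m\<bar>) * sqn sigma_measure (restr (omega a b) (mode m r))"
      using MK ab by (intro mult_left_mono sqn_restr_mode_ge) auto
    finally show "sqn sigma_measure (mode m r) \<le> M * K ^ (d + nat \<bar>m\<bar>) * sqn sigma_measure (restr (omega a b) (mode m r))" .
  qed
qed

end

section \<open>The Lebeau--Robbiano argument\<close>

text \<open>The telescoping argument of Lebeau and Robbiano in the form due to Miller: on the dyadic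
  interval \<open>[\<theta>/2\<^sup>k\<^sup>+\<^sup>1, \<theta>/2\<^sup>k]\<close> the modes below \<open>2\<^sup>k\<close> are observed and the others are dissipated.
  Since \<open>lam\<close> grows at least like \<open>n\<close>, the factor \<open>K\<^sup>n\<close> is absorbed by waiting once more.\<close>

lemma lebeau_robbiano:
  fixes Q :: "(nat \<Rightarrow> complex) \<Rightarrow> real" and lam :: "nat \<Rightarrow> real" and c :: "nat \<Rightarrow> complex"
    and M K \<theta> T :: real and N n :: nat
  defines "a \<equiv> \<lambda>t d. c d * complex_of_real (exp (- lam d * t))"
  assumes Q0: "\<And>a. Q a \<ge> 0"
    and Q_split: "\<And>a D. Q (\<lambda>d. if d \<le> D then a d else 0) \<le> 2 * Q a + 2 * (\<Sum>d\<in>{D<..<N}. (cmod (a d))\<^sup>2)"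
    and spectral: "\<And>a D. (\<Sum>d\<in>{..<N} \<inter> {..D}. (cmod (a d))\<^sup>2) \<le> M * K ^ (D + n) * Q (\<lambda>d. if d \<le> D then a d else 0)"
    and lam: "\<And>d. lam d = real (d * (2 * n + d + 1) + n)"
    and cont: "continuous_on {0..} (\<lambda>t. Q (a t))"
    and M: "M \<ge> 1" and K: "K \<ge> 1" and \<theta>: "\<theta> = 2 * ln (6 * M * K\<^sup>2)" and T: "T \<ge> 2 * \<theta>"
  shows "(\<Sum>d<N. (cmod (a T d))\<^sup>2) \<le> 8 * M / \<theta> * integral {0..T} (\<lambda>t. Q (a t))"
proof -
  \<comment> \<open>\<open>\<theta>\<close> is chosen so that \<open>exp (\<theta> / 2) = X\<close>,
    where \<open>X\<close> collects the constants that the dissipation has to beat.\<close>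
  define X where "X = 6 * M * K\<^sup>2"
  have K2: "K\<^sup>2 \<ge> 1" using K by simp
  have X6: "X \<ge> 6" unfolding X_def using mult_mono[of 6 "6 * M" 1 "K\<^sup>2"] M K2 by simp
  have eX: "exp (\<theta> / 2) = X" unfolding \<theta> using X6 by (simp add: X_def)
  have \<theta>0: "\<theta> > 0" using X6 by (simp add: \<theta> X_def)
  define q where "q t = Q (a t)" for t
  have q0: "q t \<ge> 0" for t by (simp add: q_def Q0)
  have qi: "q integrable_on {x..y}" if "x \<ge> 0" for x y
    unfolding q_def by (rule integrable_continuous_interval, rule continuous_on_subset[OF cont]) (use that in auto)
  define n2 where "n2 t = (\<Sum>d<N. (cmod (a t d))\<^sup>2)" for t
  have decay: "(cmod (a t d))\<^sup>2 = exp (- 2 * lam d * (t - s)) * (cmod (a s d))\<^sup>2" for s t d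
    by (simp add: a_def norm_mult power_mult_distrib power2_eq_square algebra_simps flip: exp_add)
  have lam_mono: "lam d \<le> lam e" if "d \<le> e" for d e
    unfolding lam using that by (intro of_nat_mono add_right_mono mult_mono) auto
  have lam_ge: "real n \<le> lam d" for d by (simp add: lam)
  have n2_pos: "n2 t \<ge> 0" for t by (simp add: n2_def sum_nonneg)
  have n2_decay: "n2 t \<le> exp (- 2 * real n * (t - s)) * n2 s" if "s \<le> t" for s t
    unfolding n2_def sum_distrib_left
  proof (intro sum_mono)
    fix d
    have "real n * (t - s) \<le> lam d * (t - s)" by (rule mult_right_mono[OF lam_ge]) (use that in simp)
    then show "(cmod (a t d))\<^sup>2 \<le> exp (- 2 * real n * (t - s)) * (cmod (a s d))\<^sup>2"
      unfolding decay[of t d s] by (intro mult_right_mono) (auto simp: mult.assoc)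
  qed
  have n2_anti: "n2 t \<le> n2 s" if "s \<le> t" for s t
  proof -
    have "exp (- 2 * real n * (t - s)) \<le> 1" using that by simp
    then show ?thesis using n2_decay[OF that] n2_pos[of s] mult_right_mono[of "exp (- 2 * real n * (t - s))" 1 "n2 s"] by linarith
  qed
  \<comment> \<open>Degrees up to \<open>D\<close> are observed, with the higher ones as an error in
    \<open>Q\<close>; these have decayed since time \<open>s\<close> at least at the rate of degree
    \<open>D + 1\<close>. The constant 3 comes from \<open>2 * B + 1 <= 3 * B\<close>.\<close>
  have est: "n2 t \<le> 2 * (M * K ^ (D + n)) * q t + 3 * (M * K ^ (D + n)) * (exp (- 2 * lam (Suc D) * (t - s)) * n2 s)"
    if st: "s \<le> t" for s t D
  proof -
    define B where "B = M * K ^ (D + n)"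
    have B1: "B \<ge> 1" unfolding B_def using mult_mono[of 1 M 1 "K ^ (D + n)"] M K by (simp add: one_le_power)
    define lo where "lo = (\<Sum>d\<in>{..<N} \<inter> {..D}. (cmod (a t d))\<^sup>2)"
    define hi where "hi = (\<Sum>d\<in>{D<..<N}. (cmod (a t d))\<^sup>2)"
    have "{..<N} = ({..<N} \<inter> {..D}) \<union> {D<..<N}" by auto
    then have n2: "n2 t = lo + hi" unfolding n2_def lo_def hi_def
      by (metis (no_types, lifting) Int_iff atMost_iff finite_Int finite_greaterThanLessThan finite_lessThan
          greaterThanLessThan_iff disjoint_iff not_less sum.union_disjoint)
    have "lo \<le> B * Q (\<lambda>d. if d \<le> D then a t d else 0)" unfolding lo_def B_def by (rule spectral)
    also have "\<dots> \<le> B * (2 * q t + 2 * hi)"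
      unfolding q_def hi_def by (rule mult_left_mono[OF Q_split]) (use B1 in simp)
    finally have lo: "lo \<le> B * (2 * q t + 2 * hi)" .
    have hi0: "hi \<ge> 0" by (simp add: hi_def sum_nonneg)
    have "hi \<le> (\<Sum>d\<in>{D<..<N}. exp (- 2 * lam (Suc D) * (t - s)) * (cmod (a s d))\<^sup>2)"
      unfolding hi_def
    proof (intro sum_mono)
      fix d assume "d \<in> {D<..<N}"
      then have "lam (Suc D) * (t - s) \<le> lam d * (t - s)" by (intro mult_right_mono lam_mono) (use st in auto)
      then show "(cmod (a t d))\<^sup>2 \<le> exp (- 2 * lam (Suc D) * (t - s)) * (cmod (a s d))\<^sup>2"
        unfolding decay[of t d s] by (intro mult_right_mono) (auto simp: mult.assoc)
    qed
    also have "\<dots> \<le> exp (- 2 * lam (Suc D) * (t - s)) * n2 s"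
      unfolding n2_def sum_distrib_left by (rule sum_mono2) auto
    finally have hi: "hi \<le> exp (- 2 * lam (Suc D) * (t - s)) * n2 s" .
    have "n2 t \<le> 2 * B * q t + (2 * B + 1) * hi" using n2 lo by (simp add: algebra_simps)
    also have "\<dots> \<le> 2 * B * q t + 3 * B * hi" using B1 hi0 by (intro add_left_mono mult_right_mono) auto
    also have "\<dots> \<le> 2 * B * q t + 3 * B * (exp (- 2 * lam (Suc D) * (t - s)) * n2 s)"
      using hi B1 by (intro add_left_mono mult_left_mono) auto
    finally show ?thesis by (simp add: B_def)
  qed
  define \<tau> where "\<tau> k = \<theta> / 2 ^ k" for k :: nat
  have \<tau>0: "\<tau> k > 0" for k using \<theta>0 by (simp add: \<tau>_def)
  have \<tau>S: "\<tau> (Suc k) = \<tau> k / 2" for k by (simp add: \<tau>_def)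
  \<comment> \<open>The first dissipated degree is then exactly \<open>2^k\<close>; for
    \<open>k = 0\<close> only degree 0 is observed.\<close>
  define D where "D k = 2 ^ k - (1::nat)" for k :: nat
  have SD: "Suc (D k) = 2 ^ k" for k by (simp add: D_def)
  define B where "B k = M * K ^ (D k + n)" for k
  have B1: "B k \<ge> 1" for k unfolding B_def using mult_mono[of 1 M 1 "K ^ (D k + n)"] M K by (simp add: one_le_power)
  \<comment> \<open>The 8 is 4 times 2: the observation lasts a quarter of \<open>\<tau> k\<close>,
    and \<open>est\<close> has the factor 2 in front of \<open>q t\<close>.\<close>
  define f where "f k = \<tau> k / (8 * B k)" for k
  have f0: "f k \<ge> 0" for k using \<tau>0[of k] B1[of k] by (simp add: f_def)
  have XB: "6 * B (Suc k) \<le> X ^ (2 ^ k + 2 * n)" for k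
  proof -
    have "D (Suc k) + n \<le> 2 * (2 ^ k + 2 * n)" by (simp add: D_def)
    then have "K ^ (D (Suc k) + n) \<le> K ^ (2 * (2 ^ k + 2 * n))" using K by (rule power_increasing)
    then have "(6 * M) * K ^ (D (Suc k) + n) \<le> (6 * M) * K ^ (2 * (2 ^ k + 2 * n))"
      using M by (intro mult_left_mono) auto
    then have "6 * B (Suc k) \<le> (6 * M) * (K\<^sup>2) ^ (2 ^ k + 2 * n)"
      by (simp only: B_def power_mult mult.assoc)
    also have "6 * M = (6 * M) ^ 1" by simp
    also have "(6 * M) ^ 1 * (K\<^sup>2) ^ (2 ^ k + 2 * n) \<le> (6 * M) ^ (2 ^ k + 2 * n) * (K\<^sup>2) ^ (2 ^ k + 2 * n)"
      using M by (intro mult_right_mono power_increasing) (auto simp: trans_le_add1)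
    also have "\<dots> = X ^ (2 ^ k + 2 * n)" by (simp add: X_def power_mult_distrib)
    finally show ?thesis .
  qed
  \<comment> \<open>The eigenvalue at degree \<open>2^k\<close> is at least
    \<open>2^k * (2^k + 2 * n)\<close>. Over a time \<open>\<tau> k / 4\<close> the factor
    \<open>2^k\<close> cancels, which leaves an exponent linear in \<open>2^k + 2 * n\<close>, like
    that of the spectral loss in \<open>XB\<close>. The cross term of the eigenvalue is what makes
    this uniform in \<open>n\<close>.\<close>
  have exp_le: "exp (- 2 * lam (Suc (D k)) * (t - \<tau> (Suc k))) \<le> 1 / (6 * B (Suc k))" if t: "t \<ge> 3 * \<tau> k / 4" for k t
  proof -
    have "real (2 ^ k) * (real (2 ^ k) + 2 * real n) \<le> lam (Suc (D k))"
      unfolding SD lam by (simp add: algebra_simps)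
    then have "(real (2 ^ k) * (real (2 ^ k) + 2 * real n)) * (\<tau> k / 4) \<le> lam (Suc (D k)) * (t - \<tau> (Suc k))"
      using t \<tau>0[of k] by (intro mult_mono) (auto simp: \<tau>S lam)
    moreover have "(real (2 ^ k) * (real (2 ^ k) + 2 * real n)) * (\<tau> k / 4) = (real (2 ^ k) + 2 * real n) * (\<theta> / 4)"
      by (simp add: \<tau>_def)
    ultimately have "(real (2 ^ k) + 2 * real n) * (\<theta> / 4) \<le> lam (Suc (D k)) * (t - \<tau> (Suc k))" by (simp only:)
    moreover have "real (2 ^ k + 2 * n) * (\<theta> / 2) = 2 * ((real (2 ^ k) + 2 * real n) * (\<theta> / 4))" by simp
    ultimately have "real (2 ^ k + 2 * n) * (\<theta> / 2) \<le> 2 * lam (Suc (D k)) * (t - \<tau> (Suc k))"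
      by (simp only: mult.assoc)
    then have "exp (real (2 ^ k + 2 * n) * (\<theta> / 2)) \<le> exp (2 * lam (Suc (D k)) * (t - \<tau> (Suc k)))" by simp
    moreover have "exp (real (2 ^ k + 2 * n) * (\<theta> / 2)) = X ^ (2 ^ k + 2 * n)" by (simp only: exp_of_nat_mult eX)
    ultimately have "6 * B (Suc k) \<le> exp (2 * lam (Suc (D k)) * (t - \<tau> (Suc k)))" using XB[of k] by linarith
    moreover have "exp (- 2 * lam (Suc (D k)) * (t - \<tau> (Suc k))) = 1 / exp (2 * lam (Suc (D k)) * (t - \<tau> (Suc k)))"
      by (simp add: exp_minus inverse_eq_divide)
    ultimately show ?thesis using B1[of "Suc k"] by (simp add: frac_le)
  qed
  \<comment> \<open>During the first half of \<open>[\<tau> k / 2, \<tau> k]\<close> the high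
    degrees decay; over the second half the estimate is averaged. The 6 in \<open>XB\<close> makes
    the remainder exactly \<open>f (Suc k) * n2 (\<tau> (Suc k))\<close>, so that the steps
    telescope.\<close>
  have step: "f k * n2 (\<tau> k) \<le> integral {\<tau> (Suc k)..\<tau> k} q + f (Suc k) * n2 (\<tau> (Suc k))" for k
  proof -
    define R where "R = 3 * B k * (1 / (6 * B (Suc k)) * n2 (\<tau> (Suc k)))"
    let ?u = "3 * \<tau> k / 4"
    have u: "?u \<le> \<tau> k" "\<tau> (Suc k) \<le> ?u" "0 \<le> ?u" using \<tau>0[of k] by (simp_all add: \<tau>S)
    have pt: "n2 (\<tau> k) - R \<le> 2 * B k * q t" if t: "t \<in> {?u..\<tau> k}" for t
    proof -
      have "n2 (\<tau> k) \<le> n2 t" using t by (intro n2_anti) auto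
      also have "\<dots> \<le> 2 * B k * q t + 3 * B k * (exp (- 2 * lam (Suc (D k)) * (t - \<tau> (Suc k))) * n2 (\<tau> (Suc k)))"
        unfolding B_def by (rule est) (use t u in auto)
      also have "\<dots> \<le> 2 * B k * q t + R"
        unfolding R_def using B1[of k] t
        by (intro add_left_mono mult_left_mono mult_right_mono exp_le n2_pos) auto
      finally show ?thesis by simp
    qed
    have "integral {?u..\<tau> k} (\<lambda>t. n2 (\<tau> k) - R) \<le> integral {?u..\<tau> k} (\<lambda>t. 2 * B k * q t)"
    proof (rule integral_le)
      show "(\<lambda>t. 2 * B k * q t) integrable_on {?u..\<tau> k}"
        using integrable_cmul[OF qi[OF u(3)], of "2 * B k" "\<tau> k"] by simp
    qed (use pt in auto)
    also have "\<dots> = 2 * B k * integral {?u..\<tau> k} q" by simp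
    also have "\<dots> \<le> 2 * B k * integral {\<tau> (Suc k)..\<tau> k} q"
    proof (intro mult_left_mono integral_subset_le)
      show "{?u..\<tau> k} \<subseteq> {\<tau> (Suc k)..\<tau> k}" using u by auto
      show "0 \<le> 2 * B k" using B1[of k] by simp
    qed (use qi u \<tau>0[of "Suc k"] q0 in auto)
    finally have "(\<tau> k / 4) * (n2 (\<tau> k) - R) \<le> 2 * B k * integral {\<tau> (Suc k)..\<tau> k} q"
      using u by simp
    then have "f k * n2 (\<tau> k) \<le> integral {\<tau> (Suc k)..\<tau> k} q + f k * R"
      using B1[of k] by (simp add: f_def field_simps)
    moreover have "f k * R = f (Suc k) * n2 (\<tau> (Suc k))"
      using B1[of k] B1[of "Suc k"] by (simp add: f_def R_def \<tau>S field_simps)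
    ultimately show ?thesis by simp
  qed
  have \<tau>_le: "\<tau> k \<le> \<theta>" for k unfolding \<tau>_def using \<theta>0 by (simp add: field_simps mult_left_mono[of 1 "2^k" \<theta>, simplified])
  have tele: "f 0 * n2 (\<tau> 0) \<le> integral {\<tau> k..\<theta>} q + f k * n2 (\<tau> k)" for k
  proof (induction k)
    case 0
    then show ?case by (simp add: \<tau>_def)
  next
    case (Suc k)
    have "integral {\<tau> (Suc k)..\<tau> k} q + integral {\<tau> k..\<theta>} q = integral {\<tau> (Suc k)..\<theta>} q"
      by (rule Henstock_Kurzweil_Integration.integral_combine) (use \<tau>0[of k] \<tau>_le qi in \<open>auto simp: \<tau>S\<close>)
    then show ?case using Suc step[of k] by linarith
  qed
  \<comment> \<open>Since \<open>B k >= 1\<close>, the remainder of the telescoping is at most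
    \<open>\<tau> k * n2 0\<close> and tends to 0.\<close>
  have "f 0 * n2 \<theta> \<le> integral {0..\<theta>} q"
  proof (rule LIMSEQ_le_const)
    show "(\<lambda>k. integral {0..\<theta>} q + \<theta> * (1/2) ^ k * n2 0) \<longlonglongrightarrow> integral {0..\<theta>} q"
    proof -
      have "(\<lambda>k. integral {0..\<theta>} q + \<theta> * (1/2) ^ k * n2 0) \<longlonglongrightarrow> integral {0..\<theta>} q + \<theta> * 0 * n2 0"
        by (intro tendsto_intros LIMSEQ_realpow_zero) auto
      then show ?thesis by simp
    qed
    have "f 0 * n2 \<theta> \<le> integral {0..\<theta>} q + \<theta> * (1/2) ^ k * n2 0" for k
    proof -
      have "integral {\<tau> k..\<theta>} q \<le> integral {0..\<theta>} q"
        by (rule integral_subset_le) (use \<tau>0[of k] qi q0 in auto)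
      moreover have "f k * n2 (\<tau> k) \<le> (\<theta> * (1/2) ^ k) * n2 0"
      proof (rule mult_mono)
        have "f k \<le> \<tau> k / 1" unfolding f_def using B1[of k] \<tau>0[of k] by (intro divide_left_mono) auto
        then show "f k \<le> \<theta> * (1/2) ^ k" by (simp add: \<tau>_def power_divide)
        show "n2 (\<tau> k) \<le> n2 0" using \<tau>0[of k] by (intro n2_anti) simp
      qed (use \<theta>0 n2_pos in auto)
      ultimately show ?thesis using tele[of k] by (simp add: \<tau>_def)
    qed
    then show "\<exists>N. \<forall>k\<ge>N. f 0 * n2 \<theta> \<le> integral {0..\<theta>} q + \<theta> * (1/2) ^ k * n2 0" by blast
  qed
  moreover have "f 0 = \<theta> / (8 * M * K ^ n)" by (simp add: f_def \<tau>_def B_def D_def)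
  ultimately have "n2 \<theta> \<le> K ^ n * (8 * M / \<theta> * integral {0..\<theta>} q)"
    using \<theta>0 M K by (simp add: field_simps)
  \<comment> \<open>The factor \<open>K^n\<close> stems from \<open>B 0\<close>, the loss on the
    last interval before \<open>\<theta>\<close>. A further time
    \<open>T - \<theta> >= \<theta>\<close> of decay at rate \<open>n\<close> compensates it,
    because \<open>K <= exp (2 * \<theta>)\<close>.\<close>
  moreover have "K ^ n \<le> exp (2 * real n * \<theta>)"
  proof -
    have "K \<le> K\<^sup>2" using K by (simp add: power2_eq_square)
    also have "\<dots> \<le> X" unfolding X_def using M K2 mult_mono[of 1 "6 * M" "K\<^sup>2" "K\<^sup>2"] by simp
    also have "\<dots> \<le> exp (2 * \<theta>)" unfolding eX[symmetric] using \<theta>0 by simp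
    finally have "K ^ n \<le> exp (2 * \<theta>) ^ n" using K by (intro power_mono) auto
    then show ?thesis by (simp add: mult_ac flip: exp_of_nat_mult)
  qed
  moreover have I0: "8 * M / \<theta> * integral {0..\<theta>} q \<ge> 0"
    using \<theta>0 M q0 by (intro mult_nonneg_nonneg integral_nonneg qi) auto
  ultimately have n2\<theta>: "n2 \<theta> \<le> exp (2 * real n * \<theta>) * (8 * M / \<theta> * integral {0..\<theta>} q)"
    by (meson mult_right_mono order_trans)
  have "n2 T \<le> exp (- 2 * real n * (T - \<theta>)) * n2 \<theta>" using T \<theta>0 by (intro n2_decay) auto
  also have "\<dots> \<le> exp (- 2 * real n * \<theta>) * n2 \<theta>"
    using T n2_pos by (intro mult_right_mono) (auto intro!: mult_left_mono)
  also have "\<dots> \<le> exp (- 2 * real n * \<theta>) * (exp (2 * real n * \<theta>) * (8 * M / \<theta> * integral {0..\<theta>} q))"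
    by (rule mult_left_mono[OF n2\<theta>]) simp
  also have "\<dots> = 8 * M / \<theta> * integral {0..\<theta>} q"
    by (simp add: mult.assoc[symmetric] exp_minus)
  also have "\<dots> \<le> 8 * M / \<theta> * integral {0..T} q"
    using T \<theta>0 M q0 by (intro mult_left_mono integral_subset_le qi) auto
  finally show ?thesis by (simp add: n2_def q_def[abs_def])
qed

section \<open>Observability\<close>

lemma pythagoras:
  assumes "finite I" "\<And>i. i \<in> I \<Longrightarrow> f i \<in> L2 M" "\<And>i j. i \<in> I \<Longrightarrow> j \<in> I \<Longrightarrow> i \<noteq> j \<Longrightarrow> ip M (f i) (f j) = 0"
  shows "sqn M (\<lambda>x. \<Sum>i\<in>I. f i x) = (\<Sum>i\<in>I. sqn M (f i))"
  using assms
proof (induction I rule: finite_induct)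
  case empty
  then show ?case by (simp add: sqn_def)
next
  case (insert i I)
  let ?s = "\<lambda>x. \<Sum>i\<in>I. f i x"
  have s: "?s \<in> L2 M" and fi: "f i \<in> L2 M" using insert.prems by (auto intro: L2_sum)
  have "ip M ?s (f i) = (\<Sum>j\<in>I. ip M (f j) (f i))" using insert.prems by (intro ip_sum) auto
  also have "\<dots> = 0" using insert by (intro sum.neutral) auto
  finally have "ip M (\<lambda>x. - ?s x) (f i) = 0" by (simp add: ip_uminus)
  then have "ip M (f i) (\<lambda>x. - ?s x) = 0" by (metis ip_cnj complex_cnj_zero)
  then have "sqn M (\<lambda>x. f i x - - ?s x) = sqn M (f i) + sqn M (\<lambda>x. - ?s x)"
    by (simp add: sqn_diff fi L2_uminus s del: diff_minus_eq_add)
  then show ?case using insert by (simp add: sqn_def)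
qed

text \<open>The squared norm of a finite sum is a Hermitian form in the coefficients, given by the
  Gram matrix of the functions, hence continuous in them.\<close>

lemma continuous_on_sqn_sum:
  assumes f: "\<And>i. i \<in> I \<Longrightarrow> f i \<in> L2 M" and c: "\<And>i. i \<in> I \<Longrightarrow> continuous_on S (\<lambda>t. c t i)"
  shows "continuous_on S (\<lambda>t. sqn M (\<lambda>x. \<Sum>i\<in>I. c t i * f i x))"
proof -
  have "sqn M (\<lambda>x. \<Sum>i\<in>I. c t i * f i x) = Re (\<Sum>i\<in>I. c t i * cnj (\<Sum>j\<in>I. c t j * ip M (f j) (f i)))" for t
  proof -
    let ?g = "\<lambda>x. \<Sum>i\<in>I. c t i * f i x"
    have g: "?g \<in> L2 M" by (intro L2_sum L2_scale f)
    have "sqn M ?g = Re (ip M ?g ?g)" by (simp add: ip_self)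
    also have "ip M ?g ?g = (\<Sum>i\<in>I. ip M (\<lambda>x. c t i * f i x) ?g)" by (intro ip_sum L2_scale f g)
    also have "\<dots> = (\<Sum>i\<in>I. c t i * ip M (f i) ?g)" by (intro sum.cong refl ip_scale f g)
    also have "\<dots> = (\<Sum>i\<in>I. c t i * cnj (ip M ?g (f i)))" by (simp flip: ip_cnj)
    also have "\<dots> = (\<Sum>i\<in>I. c t i * cnj (\<Sum>j\<in>I. c t j * ip M (f j) (f i)))"
    proof (intro sum.cong refl)
      fix i assume i: "i \<in> I"
      have "ip M ?g (f i) = (\<Sum>j\<in>I. ip M (\<lambda>x. c t j * f j x) (f i))" by (intro ip_sum L2_scale f i)
      also have "\<dots> = (\<Sum>j\<in>I. c t j * ip M (f j) (f i))" by (intro sum.cong refl ip_scale f i)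
      finally show "c t i * cnj (ip M ?g (f i)) = c t i * cnj (\<Sum>j\<in>I. c t j * ip M (f j) (f i))" by simp
    qed
    finally show ?thesis .
  qed
  then show ?thesis by (simp only:) (intro continuous_intros c; assumption)
qed

lemma restr_sum: "restr S (\<lambda>q. \<Sum>i\<in>I. f i q) = (\<lambda>q. \<Sum>i\<in>I. restr S (f i) q)"
  by (simp add: restr_def sum_distrib_left)

lemma restr_scale: "restr S (\<lambda>q. c * f q) = (\<lambda>q. c * restr S f q)"
  by (simp add: restr_def mult_ac)

lemma restr_add: "restr S (\<lambda>q. f q + g q) = (\<lambda>q. restr S f q + restr S g q)"
  by (simp add: restr_def distrib_left)

definition order_sum :: "nat \<Rightarrow> int \<Rightarrow> (nat \<Rightarrow> complex) \<Rightarrow> real \<times> real \<Rightarrow> complex" where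
  "order_sum N m a = (\<lambda>q. \<Sum>d<N. a d * basis_fun m d q)"

lemma order_sum_mode: "order_sum N m a = mode m (\<Sum>d<N. smult (a d * complex_of_real (norm_factor m d)) (ultra (nat \<bar>m\<bar>) d))"
  by (auto simp: order_sum_def basis_fun_def mode_def fun_eq_iff poly_sum sum_distrib_left mult_ac)

lemma order_sum_L2: "order_sum N m a \<in> L2 sigma_measure"
  unfolding order_sum_mode by simp

lemma sqn_order_sum: "sqn sigma_measure (order_sum N m a) = (\<Sum>d<N. (cmod (a d))\<^sup>2)"
proof -
  have "sqn sigma_measure (order_sum N m a) = (\<Sum>d<N. sqn sigma_measure (\<lambda>q. a d * basis_fun m d q))"
    unfolding order_sum_def
    by (rule pythagoras) (auto simp: L2_scale basis_fun_L2 ip_scale ip_scale_right ip_basis_fun)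
  also have "\<dots> = (\<Sum>d<N. (cmod (a d))\<^sup>2)"
  proof (rule sum.cong[OF refl])
    fix d
    have "complex_of_real (sqn sigma_measure (basis_fun m d)) = 1" by (simp add: ip_basis_fun flip: ip_self)
    then show "sqn sigma_measure (\<lambda>q. a d * basis_fun m d q) = (cmod (a d))\<^sup>2" by (simp add: sqn_scale)
  qed
  finally show ?thesis .
qed

context
  fixes \<alpha> \<beta> :: real
  assumes ab: "0 < \<alpha>" "\<alpha> < \<beta>" "\<beta> \<le> pi / 2"
begin

text \<open>\<open>\<theta>\<close> and \<open>C\<close> are obtained before the order
  \<open>m\<close> and the truncation \<open>N\<close>. This uniformity is what later allows
  summation over all orders and removal of the truncation. The splitting hypothesis of the
  telescoping holds because restriction does not increase the norm.\<close>

lemma observability_order: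
  obtains \<theta> C where "\<theta> > 0" "C > 0" "\<And>N m c T. T \<ge> 2 * \<theta> \<Longrightarrow>
    (\<Sum>d<N. (cmod (c d * complex_of_real (exp (- eigval m d * T))))\<^sup>2)
      \<le> C * integral {0..T} (\<lambda>t. sqn sigma_measure (restr (omega \<alpha> \<beta>) (order_sum N m (\<lambda>d. c d * complex_of_real (exp (- eigval m d * t))))))"
proof -
  obtain M K where M: "M \<ge> 1" and K: "K \<ge> 1" and sp: "\<And>m d r. degree r \<le> d \<Longrightarrow>
    sqn sigma_measure (mode m r) \<le> M * K ^ (d + nat \<bar>m\<bar>) * sqn sigma_measure (restr (omega \<alpha> \<beta>) (mode m r))"
    using spectral_mode[OF ab] by blast
  define \<theta> where "\<theta> = 2 * ln (6 * M * K\<^sup>2)"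
  have "6 * M * K\<^sup>2 \<ge> 6" using mult_mono[of 6 "6 * M" 1 "K\<^sup>2"] M K by simp
  then have \<theta>0: "\<theta> > 0" by (simp add: \<theta>_def)
  show ?thesis
  proof (rule that[OF \<theta>0])
    show "8 * M / \<theta> > 0" using M \<theta>0 by simp
    fix N :: nat and m :: int and c :: "nat \<Rightarrow> complex" and T :: real
    assume T: "T \<ge> 2 * \<theta>"
    let ?Q = "\<lambda>a. sqn sigma_measure (restr (omega \<alpha> \<beta>) (order_sum N m a))"
    show "(\<Sum>d<N. (cmod (c d * complex_of_real (exp (- eigval m d * T))))\<^sup>2)
      \<le> 8 * M / \<theta> * integral {0..T} (\<lambda>t. ?Q (\<lambda>d. c d * complex_of_real (exp (- eigval m d * t))))"
    proof (rule lebeau_robbiano[where Q = ?Q and lam = "eigval m" and n = "nat \<bar>m\<bar>", OF _ _ _ _ _ M K \<theta>_def T])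
      show "0 \<le> ?Q a" for a by simp
      show "eigval m d = real (d * (2 * nat \<bar>m\<bar> + d + 1) + nat \<bar>m\<bar>)" for d by (simp add: eigval_def)
      show "?Q (\<lambda>d. if d \<le> D then a d else 0) \<le> 2 * ?Q a + 2 * (\<Sum>d\<in>{D<..<N}. (cmod (a d))\<^sup>2)" for a D
      proof -
        let ?h = "\<lambda>d. if d \<le> D then 0 else - a d"
        have "order_sum N m (\<lambda>d. if d \<le> D then a d else 0) = (\<lambda>q. order_sum N m a q + order_sum N m ?h q)"
          unfolding order_sum_def sum.distrib[symmetric] by (intro ext sum.cong) auto
        then have "?Q (\<lambda>d. if d \<le> D then a d else 0) \<le> 2 * ?Q a + 2 * ?Q ?h"
          by (simp only: restr_add) (intro sqn_add_le restr_L2 omega_borel order_sum_L2)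
        moreover have "?Q ?h \<le> (\<Sum>d<N. (cmod (?h d))\<^sup>2)"
          unfolding sqn_order_sum[of N m, symmetric] by (intro sqn_restr_le omega_borel order_sum_L2)
        moreover have "(\<Sum>d<N. (cmod (?h d))\<^sup>2) = (\<Sum>d\<in>{D<..<N}. (cmod (a d))\<^sup>2)"
          by (rule sum.mono_neutral_cong_right) auto
        ultimately show ?thesis by linarith
      qed
      show "(\<Sum>d\<in>{..<N} \<inter> {..D}. (cmod (a d))\<^sup>2) \<le> M * K ^ (D + nat \<bar>m\<bar>) * ?Q (\<lambda>d. if d \<le> D then a d else 0)" for a D
      proof -
        let ?h = "\<lambda>d. if d \<le> D then a d else 0"
        have "(\<Sum>d\<in>{..<N} \<inter> {..D}. (cmod (a d))\<^sup>2) = (\<Sum>d<N. (cmod (?h d))\<^sup>2)"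
          by (rule sum.mono_neutral_cong_left) auto
        also have "\<dots> = sqn sigma_measure (order_sum N m ?h)" by (rule sqn_order_sum[symmetric])
        also have "\<dots> \<le> M * K ^ (D + nat \<bar>m\<bar>) * ?Q ?h"
          unfolding order_sum_mode
        proof (rule sp, rule degree_sum_le)
          show "degree (smult (?h d * complex_of_real (norm_factor m d)) (ultra (nat \<bar>m\<bar>) d)) \<le> D" for d
            using degree_smult_le[of "a d * complex_of_real (norm_factor m d)" "ultra (nat \<bar>m\<bar>) d"]
            by (auto simp: degree_ultra)
        qed simp
        finally show ?thesis .
      qed
      show "continuous_on {0..} (\<lambda>t. ?Q (\<lambda>d. c d * complex_of_real (exp (- eigval m d * t))))"
        unfolding order_sum_def restr_sum restr_scale
        by (intro continuous_on_sqn_sum restr_L2 omega_borel basis_fun_L2 continuous_intros)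
    qed
  qed
qed

text \<open>Needed to treat the first \<open>J\<close> basis functions order by order. The sum of
  all degrees serves as a crude common bound for the degrees; pairs whose index is not below
  \<open>J\<close> contribute 0.\<close>

lemma sum_basis_regroup:
  fixes F :: "nat \<Rightarrow> 'z::comm_monoid_add"
  defines "G \<equiv> \<lambda>J m d. if basis_index m d < J then F (basis_index m d) else 0"
  shows "(\<Sum>j<J. F j) = (\<Sum>m\<in>basis_order ` {..<J}. \<Sum>d<Suc (\<Sum>j<J. basis_degree j). G J m d)"
proof -
  let ?O = "basis_order ` {..<J}" and ?N = "Suc (\<Sum>j<J. basis_degree j)"
  have "(\<Sum>m\<in>?O. \<Sum>d<?N. G J m d) = (\<Sum>(m, d)\<in>?O \<times> {..<?N}. G J m d)"
    by (rule sum.cartesian_product)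
  also have "\<dots> = (\<Sum>(m, d)\<in>{(m, d). (m, d) \<in> ?O \<times> {..<?N} \<and> basis_index m d < J}. F (basis_index m d))"
    by (rule sum.mono_neutral_cong_right) (auto simp: G_def split: if_splits)
  also have "\<dots> = (\<Sum>j<J. F j)"
  proof (rule sum.reindex_bij_witness[of _ "\<lambda>j. (basis_order j, basis_degree j)" "\<lambda>(m, d). basis_index m d"])
    fix j assume j: "j \<in> {..<J}"
    have "basis_degree j \<le> (\<Sum>j<J. basis_degree j)" by (rule member_le_sum) (use j in auto)
    then show "(basis_order j, basis_degree j) \<in> {(m, d). (m, d) \<in> ?O \<times> {..<?N} \<and> basis_index m d < J}"
      using j by (auto simp: basis_index_inverse)
  qed (auto simp: basis_index_inverse)
  finally show ?thesis ..
qed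

text \<open>The observed energies of different orders simply add up, so one inequality per order,
  with common constants, suffices.\<close>

lemma observability_finite:
  obtains \<theta> C where "\<theta> > 0" "C > 0" "\<And>J c T. T \<ge> 2 * \<theta> \<Longrightarrow>
    (\<Sum>j<J. (cmod (c j * complex_of_real (exp (- basis_eigval j * T))))\<^sup>2)
      \<le> C * integral {0..T} (\<lambda>t. sqn sigma_measure (restr (omega \<alpha> \<beta>) (D.comb {..<J} (\<lambda>j. c j * complex_of_real (exp (- basis_eigval j * t))))))"
proof -
  obtain \<theta> C where \<theta>: "\<theta> > 0" and C: "C > 0" and obs: "\<And>N m c T. T \<ge> 2 * \<theta> \<Longrightarrow>
    (\<Sum>d<N. (cmod (c d * complex_of_real (exp (- eigval m d * T))))\<^sup>2)
      \<le> C * integral {0..T} (\<lambda>t. sqn sigma_measure (restr (omega \<alpha> \<beta>) (order_sum N m (\<lambda>d. c d * complex_of_real (exp (- eigval m d * t))))))"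
    using observability_order by blast
  show ?thesis
  proof (rule that[OF \<theta> C])
    fix J and c :: "nat \<Rightarrow> complex" and T :: real
    assume T: "T \<ge> 2 * \<theta>"
    define N where "N = Suc (\<Sum>j<J. basis_degree j)"
    define Os where "Os = basis_order ` {..<J}"
    have fin: "finite Os" by (simp add: Os_def)
    define c' where "c' m d = (if basis_index m d < J then c (basis_index m d) else 0)" for m d
    define u where "u m t = order_sum N m (\<lambda>d. c' m d * complex_of_real (exp (- eigval m d * t)))" for m t
    have eb: "basis_eigval (basis_index m d) = eigval m d" "basis (basis_index m d) = basis_fun m d" for m d
      by (simp_all add: basis_eigval_def basis_def)
    have comb: "D.comb {..<J} (\<lambda>j. c j * complex_of_real (exp (- basis_eigval j * t))) = (\<lambda>q. \<Sum>m\<in>Os. u m t q)" for t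
      unfolding D.comb_def
    proof
      fix q
      show "(\<Sum>j<J. c j * complex_of_real (exp (- basis_eigval j * t)) * basis j q) = (\<Sum>m\<in>Os. u m t q)"
        unfolding sum_basis_regroup[of "\<lambda>j. c j * complex_of_real (exp (- basis_eigval j * t)) * basis j q"] Os_def[symmetric] N_def[symmetric]
        by (intro sum.cong refl) (auto simp: u_def order_sum_def c'_def eb intro!: sum.cong)
    qed
    have uL: "u m t \<in> L2 sigma_measure" for m t by (simp add: u_def order_sum_L2)
    have pyth: "sqn sigma_measure (restr (omega \<alpha> \<beta>) (\<lambda>q. \<Sum>m\<in>Os. u m t q)) = (\<Sum>m\<in>Os. sqn sigma_measure (restr (omega \<alpha> \<beta>) (u m t)))" for t
      unfolding restr_sum
    proof (rule pythagoras[OF fin])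
      show "restr (omega \<alpha> \<beta>) (u m t) \<in> L2 sigma_measure" for m by (intro restr_L2 omega_borel uL)
      show "ip sigma_measure (restr (omega \<alpha> \<beta>) (u m t)) (restr (omega \<alpha> \<beta>) (u m' t)) = 0" if "m \<noteq> m'" for m m'
        unfolding u_def order_sum_mode by (rule ip_restr_mode_orthogonal[OF ab that])
    qed
    have ui: "(\<lambda>t. sqn sigma_measure (restr (omega \<alpha> \<beta>) (u m t))) integrable_on {0..T}" for m
      unfolding u_def order_sum_def restr_sum restr_scale
      by (intro integrable_continuous_interval continuous_on_sqn_sum restr_L2 omega_borel basis_fun_L2 continuous_intros)
    have "(\<Sum>j<J. (cmod (c j * complex_of_real (exp (- basis_eigval j * T))))\<^sup>2)
      = (\<Sum>m\<in>Os. \<Sum>d<N. (cmod (c' m d * complex_of_real (exp (- eigval m d * T))))\<^sup>2)"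
      unfolding sum_basis_regroup[of "\<lambda>j. (cmod (c j * complex_of_real (exp (- basis_eigval j * T))))\<^sup>2"] Os_def[symmetric] N_def[symmetric]
      by (intro sum.cong refl) (auto simp: c'_def eb)
    also have "\<dots> \<le> (\<Sum>m\<in>Os. C * integral {0..T} (\<lambda>t. sqn sigma_measure (restr (omega \<alpha> \<beta>) (u m t))))"
      unfolding u_def by (intro sum_mono obs T)
    also have "\<dots> = C * integral {0..T} (\<lambda>t. \<Sum>m\<in>Os. sqn sigma_measure (restr (omega \<alpha> \<beta>) (u m t)))"
      by (simp add: Henstock_Kurzweil_Integration.integral_sum fin ui sum_distrib_left)
    finally show "(\<Sum>j<J. (cmod (c j * complex_of_real (exp (- basis_eigval j * T))))\<^sup>2)
      \<le> C * integral {0..T} (\<lambda>t. sqn sigma_measure (restr (omega \<alpha> \<beta>) (D.comb {..<J} (\<lambda>j. c j * complex_of_real (exp (- basis_eigval j * t))))))"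
      by (simp only: comb pyth)
  qed
qed

end

section \<open>Removing the truncation\<close>

lemma sqn_diff_abs_le:
  assumes f: "f \<in> L2 M" and g: "g \<in> L2 M"
  shows "\<bar>sqn M f - sqn M g\<bar> \<le> sqrt (sqn M (\<lambda>x. f x - g x) * (2 * sqn M f + 2 * sqn M g))"
proof -
  let ?d = "\<lambda>x. f x - g x" and ?s = "\<lambda>x. f x + g x"
  have d: "?d \<in> L2 M" and s: "?s \<in> L2 M" using f g by (auto intro: L2_diff L2_add)
  \<comment> \<open>The difference of the squared norms is the real part of the inner product of
    \<open>f - g\<close> and \<open>f + g\<close>, to which Cauchy-Schwarz applies.\<close>
  have "cnj (ip M ?d ?s) = ip M f ?d + ip M g ?d" by (simp add: ip_add f g d flip: ip_cnj)
  also have "\<dots> = cnj (ip M ?d f) + cnj (ip M ?d g)" by (simp flip: ip_cnj)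
  also have "\<dots> = cnj (ip M f f - ip M g f) + cnj (ip M f g - ip M g g)" by (simp add: ip_diff f g)
  finally have "Re (cnj (ip M ?d ?s)) = Re (cnj (ip M f f - ip M g f) + cnj (ip M f g - ip M g g))" by simp
  moreover have "Re (ip M g f) = Re (ip M f g)" using ip_cnj[of M g f] by simp
  ultimately have "sqn M f - sqn M g = Re (ip M ?d ?s)" by (simp add: ip_self)
  then have "\<bar>sqn M f - sqn M g\<bar> \<le> cmod (ip M ?d ?s)" using abs_Re_le_cmod[of "ip M ?d ?s"] by simp
  also have "\<dots> \<le> sqrt (sqn M ?d * sqn M ?s)" by (rule real_le_rsqrt[OF Cauchy_Schwarz_ip[OF d s]])
  also have "\<dots> \<le> sqrt (sqn M ?d * (2 * sqn M f + 2 * sqn M g))"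
    by (intro real_sqrt_le_mono mult_left_mono sqn_add_le f g sqn_nonneg)
  finally show ?thesis .
qed

text \<open>Decay only shrinks the coefficients, so the truncation error at any time is at most the
  one at time 0. Convergence is therefore uniform in time, which yields the continuity of the
  observed energy, although the representatives \<open>solution g t\<close> are arbitrary, and the
  limit of the integrals.\<close>

lemma observed_energy_limit:
  assumes g: "g \<in> L2 sigma_measure" and S: "S \<in> sets borel"
  defines "c \<equiv> \<lambda>j. ip sigma_measure g (basis j)"
  defines "q \<equiv> \<lambda>t. sqn sigma_measure (restr S (solution g t))"
  defines "qJ \<equiv> \<lambda>J t. sqn sigma_measure (restr S (D.comb {..<J} (\<lambda>j. c j * complex_of_real (exp (- basis_eigval j * t)))))"
  shows "continuous_on {0..} q"
    and "T \<ge> 0 \<Longrightarrow> (\<lambda>J. integral {0..T} (qJ J)) \<longlonglongrightarrow> integral {0..T} q"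
proof -
  define \<epsilon> where "\<epsilon> J = sqrt (sqn sigma_measure (\<lambda>x. g x - D.comb {..<J} c x) * (4 * sqn sigma_measure g))" for J
  have \<epsilon>0: "\<epsilon> \<longlonglongrightarrow> 0"
  proof -
    have "\<epsilon> \<longlonglongrightarrow> sqrt (0 * (4 * sqn sigma_measure g))"
      unfolding \<epsilon>_def c_def by (intro tendsto_intros D.sqn_minus_comb_tendsto g)
    then show ?thesis by simp
  qed
  have qJ: "continuous_on A (qJ J)" for A J
    unfolding qJ_def D.comb_def restr_sum restr_scale
    by (intro continuous_on_sqn_sum restr_L2 S D.E_L2 continuous_intros)
  have est: "\<bar>qJ J t - q t\<bar> \<le> \<epsilon> J" if t: "t \<ge> 0" for J t
  proof -
    let ?v = "solution g t" and ?w = "D.comb {..<J} (\<lambda>j. c j * complex_of_real (exp (- basis_eigval j * t)))"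
    have v: "?v \<in> L2 sigma_measure" by (rule solution_L2[OF t g])
    have cfv: "ip sigma_measure ?v (basis j) = c j * complex_of_real (exp (- basis_eigval j * t))" for j
      by (simp add: ip_solution[OF t g] c_def)
    have le: "cmod (ip sigma_measure ?v (basis j)) \<le> cmod (c j)" for j
    proof -
      have "exp (- basis_eigval j * t) \<le> 1" using t D.lam_nonneg[of j] by simp
      then show ?thesis unfolding cfv norm_mult by (intro mult_right_le_one_le) auto
    qed
    have "sqn sigma_measure ?v \<le> sqn sigma_measure g"
      by (rule D.sqn_mono_cf[OF v g]) (use le in \<open>simp add: c_def\<close>)
    moreover have "sqn sigma_measure ?w \<le> sqn sigma_measure ?v"
      using D.bessel[OF v, of "{..<J}"] by (simp add: D.sqn_comb cfv)
    moreover have "sqn sigma_measure (restr S ?v) \<le> sqn sigma_measure ?v" "sqn sigma_measure (restr S ?w) \<le> sqn sigma_measure ?w"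
      by (intro sqn_restr_le S v D.comb_L2)+
    ultimately have b: "2 * sqn sigma_measure (restr S ?v) + 2 * sqn sigma_measure (restr S ?w) \<le> 4 * sqn sigma_measure g"
      by linarith
    have d: "(\<lambda>x. ?v x - ?w x) \<in> L2 sigma_measure" by (intro L2_diff v D.comb_L2)
    have "sqn sigma_measure (\<lambda>x. restr S ?v x - restr S ?w x) = sqn sigma_measure (restr S (\<lambda>x. ?v x - ?w x))"
      by (simp add: restr_def right_diff_distrib)
    also have "\<dots> \<le> sqn sigma_measure (\<lambda>x. ?v x - ?w x)" by (rule sqn_restr_le[OF S d])
    also have "\<dots> \<le> sqn sigma_measure (\<lambda>x. g x - D.comb {..<J} c x)"
    proof (rule D.sqn_mono_cf[OF d])
      show "(\<lambda>x. g x - D.comb {..<J} c x) \<in> L2 sigma_measure" by (intro L2_diff g D.comb_L2)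
      show "cmod (ip sigma_measure (\<lambda>x. ?v x - ?w x) (basis j)) \<le> cmod (ip sigma_measure (\<lambda>x. g x - D.comb {..<J} c x) (basis j))" for j
        using le[of j] by (cases "j < J") (simp_all add: ip_diff v g D.cf_comb cfv c_def)
    qed
    finally have dd: "sqn sigma_measure (\<lambda>x. restr S ?v x - restr S ?w x) \<le> sqn sigma_measure (\<lambda>x. g x - D.comb {..<J} c x)" .
    have "\<bar>sqn sigma_measure (restr S ?v) - sqn sigma_measure (restr S ?w)\<bar> \<le> \<epsilon> J"
      unfolding \<epsilon>_def
      by (rule order_trans[OF sqn_diff_abs_le[OF restr_L2[OF S v] restr_L2[OF S D.comb_L2]]])
         (intro real_sqrt_le_mono mult_mono dd b; simp)
    then show ?thesis by (simp add: q_def qJ_def abs_minus_commute)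
  qed
  have "uniform_limit {0..} qJ q sequentially"
  proof (rule uniform_limitI)
    fix e :: real assume "e > 0"
    then have "\<forall>\<^sub>F J in sequentially. \<epsilon> J < e" by (rule order_tendstoD(2)[OF \<epsilon>0])
    then show "\<forall>\<^sub>F J in sequentially. \<forall>t\<in>{0..}. dist (qJ J t) (q t) < e"
    proof (eventually_elim, intro ballI)
      fix J and t :: real assume "\<epsilon> J < e" "t \<in> {0..}"
      then show "dist (qJ J t) (q t) < e" using est[of t J] by (simp add: dist_real_def)
    qed
  qed
  then show qc: "continuous_on {0..} q"
    by (rule uniform_limit_theorem[rotated]) (use qJ in \<open>auto intro: always_eventually\<close>)
  assume T: "T \<ge> 0"
  have qi: "q integrable_on {0..T}" by (rule integrable_continuous_interval[OF continuous_on_subset[OF qc]]) auto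
  have qJi: "qJ J integrable_on {0..T}" for J by (rule integrable_continuous_interval[OF qJ])
  have b: "norm (integral {0..T} (qJ J) - integral {0..T} q) \<le> \<epsilon> J * T" for J
  proof -
    have "integral {0..T} (qJ J) - integral {0..T} q = integral {0..T} (\<lambda>t. qJ J t - q t)"
      by (rule Henstock_Kurzweil_Integration.integral_diff[symmetric, OF qJi qi])
    also have "norm \<dots> \<le> integral {0..T} (\<lambda>t. \<epsilon> J)"
      by (rule integral_norm_bound_integral) (use est qi qJi in \<open>auto intro!: integrable_diff\<close>)
    finally show ?thesis using T by (simp add: mult.commute)
  qed
  have "(\<lambda>J. integral {0..T} (qJ J) - integral {0..T} q) \<longlonglongrightarrow> 0"
    by (rule Lim_null_comparison[OF always_eventually[OF allI[OF b]] tendsto_mult_left_zero[OF \<epsilon>0]])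
  then show "(\<lambda>J. integral {0..T} (qJ J)) \<longlonglongrightarrow> integral {0..T} q" by (rule LIM_zero_cancel)
qed

text \<open>Continuity of the observed energy in time makes the Lebesgue integral of the definition
  a genuine one, equal to the gauge integral of the estimates.\<close>

lemma observable_iff: "observable S T \<longleftrightarrow> T > 0 \<and> (\<exists>C>0. \<forall>g\<in>L2 sigma_measure.
    sqn sigma_measure (solution g T) \<le> C * integral {0..T} (\<lambda>t. sqn sigma_measure (restr S (solution g t))))"
  if S: "S \<in> sets borel"
proof -
  have "(LINT t:{0..T}|lborel. sqn sigma_measure (restr S (solution g t))) = integral {0..T} (\<lambda>t. sqn sigma_measure (restr S (solution g t)))"
    if "g \<in> L2 sigma_measure" for g
    by (intro set_borel_integral_eq_integral borel_integrable_atLeastAtMost'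
        continuous_on_subset[OF observed_energy_limit(1)[OF that S]]) auto
  then show ?thesis by (auto simp: observable_def set_integral_restr sqn_def[of sigma_measure "solution _ T", symmetric])
qed

lemma observable_large_time:
  assumes ab: "0 < a" "a < b" "b \<le> pi / 2"
  shows "\<exists>Tstar>0. \<forall>T\<ge>Tstar. observable (omega a b) T"
proof -
  obtain \<theta> C where \<theta>: "\<theta> > 0" and C: "C > 0" and obs: "\<And>J c T. T \<ge> 2 * \<theta> \<Longrightarrow>
    (\<Sum>j<J. (cmod (c j * complex_of_real (exp (- basis_eigval j * T))))\<^sup>2)
      \<le> C * integral {0..T} (\<lambda>t. sqn sigma_measure (restr (omega a b) (D.comb {..<J} (\<lambda>j. c j * complex_of_real (exp (- basis_eigval j * t))))))"
    using observability_finite[OF ab] by blast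
  have "observable (omega a b) T" if T: "T \<ge> 2 * \<theta>" for T
  proof -
    have T0: "T > 0" "T \<ge> 0" using T \<theta> by auto
    have "sqn sigma_measure (solution g T) \<le> C * integral {0..T} (\<lambda>t. sqn sigma_measure (restr (omega a b) (solution g t)))"
      if g: "g \<in> L2 sigma_measure" for g
    proof (rule LIMSEQ_le)
      let ?c = "\<lambda>j. ip sigma_measure g (basis j)"
      show "(\<lambda>J. \<Sum>j<J. (cmod (?c j * complex_of_real (exp (- basis_eigval j * T))))\<^sup>2) \<longlonglongrightarrow> sqn sigma_measure (solution g T)"
        using D.parseval[OF solution_L2[OF T0(2) g]] by (simp add: sums_def ip_solution[OF T0(2) g] mult.commute)
      show "(\<lambda>J. C * integral {0..T} (\<lambda>t. sqn sigma_measure (restr (omega a b) (D.comb {..<J} (\<lambda>j. ?c j * complex_of_real (exp (- basis_eigval j * t)))))))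
        \<longlonglongrightarrow> C * integral {0..T} (\<lambda>t. sqn sigma_measure (restr (omega a b) (solution g t)))"
        by (intro tendsto_intros observed_energy_limit(2) g omega_borel T0)
      show "\<exists>N. \<forall>J\<ge>N. (\<Sum>j<J. (cmod (?c j * complex_of_real (exp (- basis_eigval j * T))))\<^sup>2)
        \<le> C * integral {0..T} (\<lambda>t. sqn sigma_measure (restr (omega a b) (D.comb {..<J} (\<lambda>j. ?c j * complex_of_real (exp (- basis_eigval j * t))))))"
        by (intro exI allI impI obs T)
    qed
    then show ?thesis using T0 C by (auto simp: observable_iff)
  qed
  then show ?thesis using \<theta> by (intro exI[of _ "2 * \<theta>"]) auto
qed

section \<open>The lower bound on the observation time\<close>

lemma ultra_0: obtains c where "c \<noteq> 0" "ultra n 0 = [:c:]"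
proof -
  have "degree (ultra n 0) = 0" by (rule degree_ultra)
  then obtain c where c: "ultra n 0 = [:c:]" by (auto elim: degree_eq_zeroE)
  then have "c \<noteq> 0" using ultra_nonzero[of n 0] by auto
  with c that show ?thesis by blast
qed

text \<open>In degree 0 the ultraspherical polynomial is a nonzero constant, so
  \<open>mode (int n) 1\<close> is a multiple of a single basis function, whose eigenvalue is
  \<open>n\<close>.\<close>

lemma solution_highest_weight:
  assumes t: "t \<ge> 0"
  shows "AE q in sigma_measure. solution (mode (int n) 1) t q = complex_of_real (exp (- real n * t)) * mode (int n) 1 q"
proof (rule D.cf_eq_imp_AE[OF solution_L2[OF t mode_L2] L2_scale[OF mode_L2]])
  fix j
  show "ip sigma_measure (solution (mode (int n) 1) t) (basis j)
    = ip sigma_measure (\<lambda>q. complex_of_real (exp (- real n * t)) * mode (int n) 1 q) (basis j)"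
  proof (cases "basis_order j = int n \<and> basis_degree j = 0")
    case True
    then have "basis_eigval j = real n" by (simp add: basis_eigval_def eigval_def)
    then show ?thesis by (simp add: ip_solution[OF t] ip_scale)
  next
    case False
    obtain c where c: "c \<noteq> 0" "ultra n 0 = [:c:]" by (rule ultra_0)
    have m: "mode (int n) 1 = (\<lambda>q. (1 / c) * mode (int n) (ultra (nat \<bar>int n\<bar>) 0) q)"
      using c by (auto simp: mode_def fun_eq_iff)
    have "ip sigma_measure (mode (int n) 1) (mode (basis_order j) (ultra (nat \<bar>basis_order j\<bar>) (basis_degree j))) = 0"
    proof (cases "basis_order j = int n")
      case True
      have "ip sigma_measure (mode (int n) 1) (mode (int n) (ultra (nat \<bar>int n\<bar>) (basis_degree j)))
        = (1 / c) * ip sigma_measure (mode (int n) (ultra (nat \<bar>int n\<bar>) 0)) (mode (int n) (ultra (nat \<bar>int n\<bar>) (basis_degree j)))"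
        unfolding m by (rule ip_scale[OF mode_L2 mode_L2])
      also have "\<dots> = 0" using True False by (subst ip_mode_orthogonal_degree) auto
      finally show ?thesis unfolding True .
    next
      case False
      then show ?thesis by (intro ip_mode_orthogonal_order) simp
    qed
    then have "ip sigma_measure (mode (int n) 1) (basis j) = 0"
      unfolding basis_def basis_fun_def by (subst ip_scale_right) auto
    then show ?thesis by (simp add: ip_solution[OF t] ip_scale)
  qed
qed

lemma cmod_mode_1: "(cmod (mode (int n) 1 (x, y)))\<^sup>2 = (cos x)\<^sup>2 ^ n"
proof -
  have "cmod (mode (int n) 1 (x, y)) = \<bar>cos x\<bar> ^ n" by (simp add: mode_def norm_mult norm_power)
  moreover have "(\<bar>cos x\<bar> ^ n)\<^sup>2 = \<bar>cos x\<bar>\<^sup>2 ^ n" by (simp only: power_mult[symmetric] mult.commute)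
  ultimately show ?thesis by simp
qed

text \<open>The functions \<open>e\<^sup>i\<^sup>n\<^sup>y cos\<^sup>n x\<close> concentrate at \<open>x = 0\<close> as \<open>n\<close> grows, at the cost of a
  decay rate of only \<open>n\<close>.\<close>

lemma not_observable_short_time:
  assumes ab: "0 < a" "a < b" "b \<le> pi / 2" and obs: "observable (omega a b) T"
  shows "T \<ge> ln (1 / cos a)"
proof (rule ccontr)
  assume "\<not> T \<ge> ln (1 / cos a)"
  then have T: "T < ln (1 / cos a)" by simp
  have ca: "cos a > 0" using ab by (intro cos_gt_zero_pi) auto
  from T have "T < - ln (cos a)" using ca by (simp add: ln_div)
  then have "exp (ln (cos a)) < exp (- T)" by simp
  then have eT: "cos a < exp (- T)" using ca by simp
  have T0: "T > 0" using obs by (simp add: observable_def)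
  obtain C where C: "C > 0" and est: "\<And>g. g \<in> L2 sigma_measure \<Longrightarrow>
    sqn sigma_measure (solution g T) \<le> C * integral {0..T} (\<lambda>t. sqn sigma_measure (restr (omega a b) (solution g t)))"
    using obs by (auto simp: observable_iff)
  \<comment> \<open>The strict inequality \<open>cos a < exp (- T)\<close> leaves room: a value
    \<open>cos \<epsilon>\<close> close to 1 replaces a sharp computation of the norm of the
    mode.\<close>
  have "((\<lambda>x. exp (- T) * cos x) \<longlongrightarrow> exp (- T) * cos 0) (at_right 0)" by (intro tendsto_intros)
  then have "\<forall>\<^sub>F x in at_right 0. cos a < exp (- T) * cos x" using eT by (intro order_tendstoD(1)) auto
  moreover have "\<forall>\<^sub>F x::real in at_right 0. x \<in> {0<..<pi/2}" by (rule eventually_at_right_real) simp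
  ultimately have "\<forall>\<^sub>F x in at_right 0. cos a < exp (- T) * cos x \<and> x \<in> {0<..<pi/2}" by (rule eventually_conj)
  then obtain \<epsilon> where \<epsilon>: "cos a < exp (- T) * cos \<epsilon>" "0 < \<epsilon>" "\<epsilon> < pi/2"
    using eventually_happens'[OF trivial_limit_at_right_real] by force
  have ce: "cos \<epsilon> > 0" using \<epsilon> by (intro cos_gt_zero_pi) auto
  define \<mu> where "\<mu> = measure sigma_measure (space sigma_measure)"
  have up: "sqn sigma_measure (restr (omega a b) (mode (int n) 1)) \<le> (cos a)\<^sup>2 ^ n * \<mu>" for n
  proof -
    have "sqn sigma_measure (restr (omega a b) (mode (int n) 1)) \<le> (LINT q|sigma_measure. (cos a)\<^sup>2 ^ n)"
      unfolding sqn_def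
    proof (rule integral_mono)
      show "integrable sigma_measure (\<lambda>q. (cmod (restr (omega a b) (mode (int n) 1) q))\<^sup>2)"
        by (intro L2_integrable_sq restr_L2 omega_borel mode_L2)
      fix q :: "real \<times> real"
      obtain x y where q: "q = (x, y)" by (cases q)
      show "(cmod (restr (omega a b) (mode (int n) 1) q))\<^sup>2 \<le> (cos a)\<^sup>2 ^ n"
      proof (cases "q \<in> omega a b")
        case True
        then have x: "a \<le> \<bar>x\<bar>" "\<bar>x\<bar> \<le> pi / 2" using ab by (auto simp: omega_def q)
        have "cos \<bar>x\<bar> \<le> cos a" using x ab by (intro cos_monotone_0_pi_le) auto
        moreover have "cos \<bar>x\<bar> \<ge> 0" using x by (intro cos_ge_zero) auto
        ultimately have "(cos x)\<^sup>2 \<le> (cos a)\<^sup>2" by (intro power_mono) (auto simp: cos_abs_real)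
        then have "(cos x)\<^sup>2 ^ n \<le> (cos a)\<^sup>2 ^ n" using power_mono[of "(cos x)\<^sup>2" "(cos a)\<^sup>2" n] by simp
        then show ?thesis using True by (simp add: restr_def q cmod_mode_1)
      qed (simp add: restr_def)
    qed simp
    then show ?thesis by (simp add: \<mu>_def mult.commute)
  qed
  \<comment> \<open>Only the strip \<open>abs x <= \<epsilon>\<close> is kept, where the mode is at
    least \<open>(cos \<epsilon>)^n\<close>; the remaining factors do not depend on
    \<open>n\<close>.\<close>
  have low: "2 * pi * (2 * \<epsilon> * (cos \<epsilon> * (cos \<epsilon>)\<^sup>2 ^ n)) \<le> sqn sigma_measure (mode (int n) 1)" for n
  proof -
    let ?f = "\<lambda>x. cos x * (cos x ^ (2 * nat \<bar>int n\<bar>) * (cmod (poly 1 (complex_of_real (sin x))))\<^sup>2)"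
    have fc: "?f integrable_on {u..v}" for u v by (intro integrable_continuous_interval continuous_intros)
    have "2 * \<epsilon> * (cos \<epsilon> * (cos \<epsilon>)\<^sup>2 ^ n) = integral {-\<epsilon>..\<epsilon>} (\<lambda>x. cos \<epsilon> * (cos \<epsilon>)\<^sup>2 ^ n)"
      using \<epsilon> by simp
    also have "\<dots> \<le> integral {-\<epsilon>..\<epsilon>} ?f"
    proof (rule integral_le)
      fix x assume x: "x \<in> {-\<epsilon>..\<epsilon>}"
      then have "cos \<epsilon> \<le> cos \<bar>x\<bar>" using \<epsilon> by (intro cos_monotone_0_pi_le) auto
      then have c: "cos \<epsilon> \<le> cos x" by (simp add: cos_abs_real)
      then have "(cos \<epsilon>)\<^sup>2 ^ n \<le> (cos x)\<^sup>2 ^ n" using ce by (intro power_mono) auto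
      then have "cos \<epsilon> * (cos \<epsilon>)\<^sup>2 ^ n \<le> cos x * (cos x)\<^sup>2 ^ n" using c ce by (intro mult_mono) auto
      then show "cos \<epsilon> * (cos \<epsilon>)\<^sup>2 ^ n \<le> ?f x" by (simp add: power_mult)
    qed (use fc in auto)
    also have "\<dots> \<le> integral {-(pi/2)..pi/2} ?f"
    proof (rule integral_subset_le)
      show "\<forall>x\<in>{-(pi/2)..pi/2}. 0 \<le> ?f x"
        by (intro ballI mult_nonneg_nonneg cos_ge_zero zero_le_power) auto
    qed (use fc \<epsilon> in auto)
    finally show ?thesis unfolding sqn_mode by (intro mult_left_mono) auto
  qed
  define D where "D = 2 * pi * (2 * \<epsilon> * cos \<epsilon>)"
  have D: "D > 0" using \<epsilon> ce by (simp add: D_def)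
  \<comment> \<open>Quotient of the exponential rates of the two sides of the observability
    inequality; as it exceeds 1, no constant \<open>C\<close> can serve all
    \<open>n\<close>.\<close>
  define r where "r = (exp (- T) * cos \<epsilon> / cos a)\<^sup>2"
  have r: "r > 1" unfolding r_def using \<epsilon>(1) ca by (intro one_less_power) auto
  have bound: "r ^ n \<le> C * T * \<mu> / D" for n
  proof -
    let ?g = "mode (int n) 1"
    have sc: "sqn sigma_measure (solution ?g t) = exp (- 2 * real n * t) * sqn sigma_measure ?g"
      "sqn sigma_measure (restr (omega a b) (solution ?g t)) = exp (- 2 * real n * t) * sqn sigma_measure (restr (omega a b) ?g)"
      if t: "t \<ge> 0" for t
    proof -
      have ex: "(cmod (complex_of_real (exp (- real n * t))))\<^sup>2 = exp (- 2 * real n * t)"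
        by (simp add: power2_eq_square flip: exp_add)
      have "sqn sigma_measure (solution ?g t) = sqn sigma_measure (\<lambda>q. complex_of_real (exp (- real n * t)) * ?g q)"
        by (rule sqn_cong_AE[OF solution_highest_weight[OF t]])
           (intro L2_measurable solution_L2[OF t] L2_scale mode_L2)+
      then show "sqn sigma_measure (solution ?g t) = exp (- 2 * real n * t) * sqn sigma_measure ?g"
        by (simp only: sqn_scale ex)
      have "AE q in sigma_measure. restr (omega a b) (solution ?g t) q = complex_of_real (exp (- real n * t)) * restr (omega a b) ?g q"
        using solution_highest_weight[OF t, of n] by eventually_elim (simp add: restr_def)
      then have "sqn sigma_measure (restr (omega a b) (solution ?g t)) = sqn sigma_measure (\<lambda>q. complex_of_real (exp (- real n * t)) * restr (omega a b) ?g q)"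
        by (rule sqn_cong_AE) (intro L2_measurable restr_L2 omega_borel solution_L2[OF t] L2_scale mode_L2)+
      then show "sqn sigma_measure (restr (omega a b) (solution ?g t)) = exp (- 2 * real n * t) * sqn sigma_measure (restr (omega a b) ?g)"
        by (simp only: sqn_scale ex)
    qed
    have "exp (- 2 * real n * T) * sqn sigma_measure ?g \<le> C * integral {0..T} (\<lambda>t. sqn sigma_measure (restr (omega a b) (solution ?g t)))"
      using est[OF mode_L2, of "int n" 1] sc(1)[of T] T0 by simp
    also have "\<dots> \<le> C * integral {0..T} (\<lambda>t. (cos a)\<^sup>2 ^ n * \<mu>)"
    proof (intro mult_left_mono integral_le)
      show "(\<lambda>t. sqn sigma_measure (restr (omega a b) (solution ?g t))) integrable_on {0..T}"
        by (rule integrable_continuous_interval, rule continuous_on_subset[OF observed_energy_limit(1)]) auto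
      fix t assume "t \<in> {0..T}"
      then have t: "t \<ge> 0" by simp
      have "exp (- 2 * real n * t) \<le> 1" using t by simp
      then have "sqn sigma_measure (restr (omega a b) (solution ?g t)) \<le> sqn sigma_measure (restr (omega a b) ?g)"
        unfolding sc(2)[OF t] by (intro mult_left_le_one_le) auto
      then show "sqn sigma_measure (restr (omega a b) (solution ?g t)) \<le> (cos a)\<^sup>2 ^ n * \<mu>"
        using up[of n] by simp
    qed (use C in auto)
    also have "\<dots> = C * T * \<mu> * (cos a)\<^sup>2 ^ n" using T0 by simp
    finally have 1: "exp (- 2 * real n * T) * sqn sigma_measure ?g \<le> C * T * \<mu> * (cos a)\<^sup>2 ^ n" .
    have 2: "exp (- 2 * real n * T) * (D * (cos \<epsilon>)\<^sup>2 ^ n) \<le> exp (- 2 * real n * T) * sqn sigma_measure ?g"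
      using low[of n] by (intro mult_left_mono) (auto simp: D_def mult.assoc)
    have 3: "exp (- 2 * real n * T) = (exp (- T))\<^sup>2 ^ n"
      by (simp add: mult_ac flip: exp_of_nat_mult power_mult)
    have "(exp (- T))\<^sup>2 ^ n * (D * (cos \<epsilon>)\<^sup>2 ^ n) \<le> C * T * \<mu> * (cos a)\<^sup>2 ^ n"
      using order_trans[OF 2 1] unfolding 3 .
    moreover have "r ^ n * (cos a)\<^sup>2 ^ n = (exp (- T))\<^sup>2 ^ n * (cos \<epsilon>)\<^sup>2 ^ n"
      unfolding power_mult_distrib[symmetric] r_def using ca by (simp add: power_divide power_mult_distrib)
    ultimately have "(r ^ n * D) * (cos a)\<^sup>2 ^ n \<le> (C * T * \<mu>) * (cos a)\<^sup>2 ^ n" by (simp add: mult_ac)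
    then have "r ^ n * D \<le> C * T * \<mu>" using ca by (simp add: mult_le_cancel_right)
    then show ?thesis using D by (simp add: field_simps)
  qed
  obtain n where "C * T * \<mu> / D < r ^ n" using real_arch_pow[OF r] by blast
  with bound[of n] show False by simp
qed

theorem theorem3:
  fixes a b :: real
  assumes "0 < a" and "a < b" and "b \<le> pi / 2"
  shows "T_min (omega a b) \<ge> ereal (ln (1 / cos a)) \<and>
         (\<exists>Tstar>0. \<forall>T\<ge>Tstar. observable (omega a b) T)"
proof
  show "T_min (omega a b) \<ge> ereal (ln (1 / cos a))"
    unfolding T_min_def
  proof (rule Inf_greatest)
    fix x assume "x \<in> ereal ` {T. T > 0 \<and> observable (omega a b) T}"
    then show "ereal (ln (1 / cos a)) \<le> x" using not_observable_short_time[OF assms] by auto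
  qed
  show "\<exists>Tstar>0. \<forall>T\<ge>Tstar. observable (omega a b) T" by (rule observable_large_time[OF assms])
qed

end
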